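(* Let $m,s\in\mathbb{R}$, $p,q\in[1,\infty]$, $\rho\in\mathbb{N}$ with $\rho\ge n+1$, and $a\in S^{m,\rho}$. Then $$\mathrm{op}[a]\colon B_{pq}^{s+m}(\mathbb{T}^n,E)\to B_{pq}^s(\mathbb{T}^n,E)$$ is linear and continuous. Moreover, the map $a\mapsto \mathrm{op}[a]$ is a continuous linear map from $S^{m,\rho}$ to $L\big(B_{pq}^{s+m}(\mathbb{T}^n,E), B_{pq}^s(\mathbb{T}^n,E)\big)$.
   Context: Fix $n\in\mathbb{N}$ and an arbitrary (complex) Banach space $E$ with norm $\|\cdot\|$. $L(X,Y)$ is the space of continuous linear maps $X\to Y$ and $L(X)=L(X,X)$. $\langle x\rangle:=(1+|x|^2)^{1/2}$ for $x\in\mathbb{R}^n$, with $|\cdot|$ the Euclidean norm. $\mathbb{T}^n=(\mathbb{R}/2\pi\mathbb{Z})^n$ is equipped with the normalized measure $(2\pi)^{-n}dx$; functions on $\mathbb{T}^n$ are identified with functions on $\mathbb{R}^n$ that are $2\pi$-periodic in all variables. Distributions: $C^\infty(\mathbb{T}^n,E)$ is the Fréchet space of smooth functions $\mathbb{T}^n\to E$ with seminorms $\max_{|\alpha|\le N}\sup_x\|\partial^\alpha\varphi(x)\|$, $N\in\mathbb{N}_0$, and $C^\infty(\mathbb{T}^n):=C^\infty(\mathbb{T}^n,\mathbb{C})$. $\mathscr D'(\mathbb{T}^n,E):=L(C^\infty(\mathbb{T}^n),E)$, with $\langle u,\varphi\rangle:=u(\varphi)$. An integrable function $f\colon\mathbb{T}^n\to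 E$ is identified with the distribution $\varphi\mapsto(2\pi)^{-n}\int_{\mathbb{T}^n}\varphi(x)f(x)\,dx$. The Fourier coefficients of $u\in\mathscr D'(\mathbb{T}^n,E)$ are $\hat u(\mathbf k):=\langle u,e_{-\mathbf k}\rangle$, where $e_{\mathbf k}(x):=e^{i\mathbf k\cdot x}$, $\mathbf k\in\mathbb{Z}^n$. Toroidal pseudodifferential operators: for $a\colon\mathbb{Z}^n\to L(E)$ of at most polynomial growth, $\mathrm{op}[a]\colon\mathscr D'(\mathbb{T}^n,E)\to\mathscr D'(\mathbb{T}^n,E)$ is defined by $\langle\mathrm{op}[a]u,\varphi\rangle:=\sum_{\mathbf k\in\mathbb{Z}^n}\hat\varphi(-\mathbf k)a(\mathbf k)\hat u(\mathbf k)$ for $\varphi\in C^\infty(\mathbb{T}^n)$, i.e. $\mathrm{op}[a]u$ has Fourier coefficients $a(\mathbf k)\hat u(\mathbf k)$. If $\phi$ is a scalar function on $\mathbb{R}^n$ with polynomially bounded restriction to $\mathbb{Z}^n$, then $\mathrm{op}[\phi]$ means $\mathrm{op}[\phi|_{\mathbb{Z}^n}\,\mathrm{id}_E]$. Symbol class: with $\delta_j$ the $j$-th unit vector, $\Delta_{k_j}a(\mathbf k):=a(\mathbf k+\delta_j)-a(\mathbf k)$ and $\Delta_{\mathbf k}^\alpha:=\Delta_{k_1}^{\alpha_1}\cdots\Delta_{k_n}^{\alpha_n}$. For $m\in\mathbb{R}$, $\rho\in\mathbb{N}_0$, $S^{m,\rho}$ is the space of all $a\colon\mathbb{Z}^n\to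 L(E)$ with $\|a\|_{S^{m,\rho}}:=\max_{|\alpha|\le\rho}\sup_{\mathbf k\in\mathbb{Z}^n}\langle\mathbf k\rangle^{|\alpha|-m}\|\Delta_{\mathbf k}^\alpha a(\mathbf k)\|_{L(E)}<\infty$, with this norm. Besov spaces: a dyadic decomposition is a sequence $(\phi_j)_{j\in\mathbb{N}_0}\subset\mathscr S(\mathbb{R}^n)$ with $\operatorname{supp}\phi_0\subset\{|\xi|\le2\}$, $\operatorname{supp}\phi_j\subset\{2^{j-1}\le|\xi|\le2^{j+1}\}$ for $j\ge1$, $\sum_{j\ge0}\phi_j=1$ on $\mathbb{R}^n$, and for each $\alpha\in\mathbb{N}_0^n$ a constant $c_\alpha>0$ such that $|D^\alpha\phi_j(\xi)|\le c_\alpha2^{-j|\alpha|}$ for all $\xi,j$. Fix one (different choices give equivalent norms). For $s\in\mathbb{R}$, $p,q\in[1,\infty]$, $B^s_{pq}(\mathbb{T}^n,E)$ is the space of all $u\in\mathscr D'(\mathbb{T}^n,E)$ with $\|u\|_{B^s_{pq}(\mathbb{T}^n,E)}:=\big\|\big(2^{js}\|\mathrm{op}[\phi_j]u\|_{L^p(\mathbb{T}^n,E)}\big)_{j\in\mathbb{N}_0}\big\|_{\ell^q(\mathbb{N}_0)}<\infty$, where $L^p(\mathbb{T}^n,E)$ is the usual Bochner space with respect to the normalized measure. *)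

theory Defs
  imports "HOL-Analysis.Analysis" "HOL-Library.Function_Algebras"
begin

section \<open>Complex vector spaces and complex Banach spaces\<close>

class complex_vector = ab_group_add +
  fixes scaleC :: "complex \<Rightarrow> 'a \<Rightarrow> 'a" (infixr \<open>*\<^sub>C\<close> 75)
  assumes scaleC_add_right: "c *\<^sub>C (x + y) = c *\<^sub>C x + c *\<^sub>C y"
    and scaleC_add_left: "(c + d) *\<^sub>C x = c *\<^sub>C x + d *\<^sub>C x"
    and scaleC_scaleC: "c *\<^sub>C d *\<^sub>C x = (c * d) *\<^sub>C x"
    and scaleC_one: "1 *\<^sub>C x = x"

class complex_normed_vector = real_normed_vector + complex_vector +
  assumes scaleR_scaleC: "r *\<^sub>R x = complex_of_real r *\<^sub>C x"
    and norm_scaleC: "norm (c *\<^sub>C x) = cmod c * norm x"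

class complex_banach = complex_normed_vector + banach

instantiation complex :: complex_banach
begin
definition scaleC_complex :: "complex \<Rightarrow> complex \<Rightarrow> complex"
  where "scaleC_complex c z = c * z"
instance
  by standard (simp_all add: scaleC_complex_def algebra_simps norm_mult scaleR_conv_of_real)
end

instantiation "fun" :: (type, complex_vector) complex_vector
begin
definition scaleC_fun :: "complex \<Rightarrow> ('a \<Rightarrow> 'b) \<Rightarrow> 'a \<Rightarrow> 'b"
  where "scaleC_fun c f = (\<lambda>x. c *\<^sub>C f x)"
instance
  by standard (simp_all add: scaleC_fun_def fun_eq_iff scaleC_add_right scaleC_add_left
      scaleC_scaleC scaleC_one)
end

lemma bounded_linear_scaleC: "bounded_linear ((*\<^sub>C) c :: 'a \<Rightarrow> 'a::complex_normed_vector)"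
proof (rule bounded_linear_intro[where K = "cmod c"])
  fix r and x y :: 'a
  show "c *\<^sub>C (x + y) = c *\<^sub>C x + c *\<^sub>C y" by (rule scaleC_add_right)
  show "c *\<^sub>C (r *\<^sub>R x) = r *\<^sub>R (c *\<^sub>C x)"
    by (simp add: scaleR_scaleC scaleC_scaleC mult.commute)
  show "norm (c *\<^sub>C x) \<le> norm x * cmod c" by (simp add: norm_scaleC)
qed

instantiation blinfun :: (real_normed_vector, complex_normed_vector) complex_vector
begin
lift_definition scaleC_blinfun :: "complex \<Rightarrow> ('a \<Rightarrow>\<^sub>L 'b) \<Rightarrow> 'a \<Rightarrow>\<^sub>L 'b"
  is "\<lambda>c f x. c *\<^sub>C f x"
  by (rule bounded_linear_compose[OF bounded_linear_scaleC])
instance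
  by standard (transfer, simp add: fun_eq_iff scaleC_add_right scaleC_add_left scaleC_scaleC
      scaleC_one)+
end


section \<open>Normed spaces on carriers and continuous linear maps\<close>

text \<open>The spaces involved depend on real parameters, so they are given by a carrier inside a complex
  vector space together with a norm on that carrier.\<close>

record 'v nspace =
  carr :: "'v set"
  nrm :: "'v \<Rightarrow> real"

definition clinear_on :: "'v::complex_vector set \<Rightarrow> ('v \<Rightarrow> 'w::complex_vector) \<Rightarrow> bool" where
  "clinear_on X T \<longleftrightarrow>
     (\<forall>x\<in>X. \<forall>y\<in>X. T (x + y) = T x + T y) \<and> (\<forall>c. \<forall>x\<in>X. T (c *\<^sub>C x) = c *\<^sub>C T x)"

definition continuous_clinear ::
    "'v::complex_vector nspace \<Rightarrow> 'w::complex_vector nspace \<Rightarrow> ('v \<Rightarrow> 'w) \<Rightarrow> bool" where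
  "continuous_clinear X Y T \<longleftrightarrow>
     (\<forall>x\<in>carr X. T x \<in> carr Y) \<and> clinear_on (carr X) T \<and>
     (\<forall>x\<in>carr X. \<forall>\<epsilon>>0. \<exists>\<delta>>0. \<forall>y\<in>carr X. nrm X (y - x) < \<delta> \<longrightarrow> nrm Y (T y - T x) < \<epsilon>)"

definition restrict0 :: "'v set \<Rightarrow> ('v \<Rightarrow> 'w::zero) \<Rightarrow> 'v \<Rightarrow> 'w" where
  "restrict0 X T = (\<lambda>x. if x \<in> X then T x else 0)"

text \<open>\<open>L(X,Y)\<close> with the operator norm. Maps defined on \<open>X\<close> are represented by their extension
  by \<open>0\<close>, so that equality of functions is equality on \<open>X\<close>.\<close>

definition L_space ::
    "'v::complex_vector nspace \<Rightarrow> 'w::complex_vector nspace \<Rightarrow> ('v \<Rightarrow> 'w) nspace" where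
  "L_space X Y = \<lparr>
     carr = {T. continuous_clinear X Y T \<and> restrict0 (carr X) T = T},
     nrm = (\<lambda>T. SUP x\<in>{x \<in> carr X. nrm X x \<le> 1}. nrm Y (T x)) \<rparr>"


section \<open>Multi-indices and smooth functions\<close>

definition coords :: "'n::finite list" where
  "coords = (SOME js. distinct js \<and> set js = UNIV)"

definition mi_abs :: "nat ^ 'n::finite \<Rightarrow> nat" where
  "mi_abs \<alpha> = (\<Sum>j\<in>UNIV. \<alpha> $ j)"

definition mi_upto :: "nat \<Rightarrow> (nat ^ 'n::finite) set" where
  "mi_upto N = {\<alpha>. mi_abs \<alpha> \<le> N}"

text \<open>\<open>D\<^sup>\<alpha> = D\<^sub>1\<^bsup>\<alpha>\<^sub>1\<^esup> \<cdots> D\<^sub>n\<^bsup>\<alpha>\<^sub>n\<^esup>\<close> for a family of operators. The coordinates are enumerated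
  in some fixed order; the operators used below (partial derivatives of smooth functions,
  forward differences) commute, so the order is irrelevant.\<close>

definition mi_power :: "('n::finite \<Rightarrow> 'f \<Rightarrow> 'f) \<Rightarrow> nat ^ 'n \<Rightarrow> 'f \<Rightarrow> 'f" where
  "mi_power D \<alpha> = foldr (\<lambda>j. D j ^^ (\<alpha> $ j)) coords"

definition partial ::
    "'n::finite \<Rightarrow> (real ^ 'n \<Rightarrow> 'b::real_normed_vector) \<Rightarrow> real ^ 'n \<Rightarrow> 'b" where
  "partial j f = (\<lambda>x. vector_derivative (\<lambda>t. f (x + t *\<^sub>R axis j 1)) (at 0))"

text \<open>All iterated partial derivatives exist and are (totally) differentiable.\<close>

definition smooth :: "(real ^ 'n::finite \<Rightarrow> 'b::real_normed_vector) \<Rightarrow> bool" where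
  "smooth f \<longleftrightarrow> (\<forall>js x. foldr partial js f differentiable (at x))"

definition periodic :: "(real ^ 'n::finite \<Rightarrow> 'b) \<Rightarrow> bool" where
  "periodic f \<longleftrightarrow> (\<forall>j x. f (x + (2 * pi) *\<^sub>R axis j 1) = f x)"

lemma coords: "distinct (coords :: 'n::finite list)" "set (coords :: 'n list) = UNIV"
proof -
  have "\<exists>js. distinct js \<and> set js = (UNIV :: 'n set)"
    using finite_distinct_list[OF finite[of "UNIV :: 'n set"]] by blast
  from someI_ex[OF this] show "distinct (coords :: 'n list)" "set (coords :: 'n list) = UNIV"
    by (simp_all add: coords_def)
qed

lemma finite_mi_upto: "finite (mi_upto N :: (nat ^ 'n::finite) set)"
proof (rule finite_subset)
  show "mi_upto N \<subseteq> vec_lambda ` (PiE (UNIV :: 'n set) (\<lambda>_. {..N}))"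
  proof
    fix \<alpha> :: "nat ^ 'n" assume "\<alpha> \<in> mi_upto N"
    then have "\<alpha> $ j \<le> N" for j
      using member_le_sum[of j UNIV "\<lambda>j. \<alpha> $ j"] by (simp add: mi_upto_def mi_abs_def)
    then have "vec_nth \<alpha> \<in> PiE UNIV (\<lambda>_. {..N})" by auto
    then show "\<alpha> \<in> vec_lambda ` (PiE (UNIV :: 'n set) (\<lambda>_. {..N}))"
      by (metis imageI vec_nth_inverse)
  qed
  show "finite (vec_lambda ` (PiE (UNIV :: 'n set) (\<lambda>_. {..N})))"
    by (intro finite_imageI finite_PiE) auto
qed

lemma zero_in_mi_upto: "0 \<in> mi_upto N"
  by (simp add: mi_upto_def mi_abs_def)

lemma mi_upto_mono: "M \<le> N \<Longrightarrow> mi_upto M \<subseteq> mi_upto N"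
  by (auto simp: mi_upto_def)

lemma partial_eq:
  assumes "(f has_derivative f') (at x)"
  shows "partial j f x = f' (axis j 1)"
proof -
  have 1: "((\<lambda>t. x + t *\<^sub>R axis j 1) has_derivative (\<lambda>t. t *\<^sub>R axis j 1)) (at (0::real))"
    by (auto intro!: derivative_eq_intros)
  have "(f has_derivative f') (at (x + 0 *\<^sub>R axis j 1))"
    using assms by simp
  from has_derivative_compose[OF 1 this]
  have "((\<lambda>t. f (x + t *\<^sub>R axis j 1)) has_derivative (\<lambda>t. f' (t *\<^sub>R axis j 1))) (at 0)" .
  moreover have "(\<lambda>t. f' (t *\<^sub>R axis j 1)) = (\<lambda>t. t *\<^sub>R f' (axis j 1))"
    using has_derivative_linear[OF assms] by (simp add: linear_cmul)
  ultimately show ?thesis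
    unfolding partial_def by (intro vector_derivative_at) (simp add: has_vector_derivative_def)
qed

lemma smooth_add_aux:
  assumes "smooth f" "smooth g"
  shows "foldr partial js (\<lambda>x. f x + g x) = (\<lambda>x. foldr partial js f x + foldr partial js g x)"
proof (induction js)
  case (Cons j js)
  show ?case
  proof
    fix x
    obtain f' g' where
      f: "(foldr partial js f has_derivative f') (at x)" and
      g: "(foldr partial js g has_derivative g') (at x)"
      using assms unfolding smooth_def differentiable_def by blast
    show "foldr partial (j # js) (\<lambda>x. f x + g x) x
        = foldr partial (j # js) f x + foldr partial (j # js) g x"
      using Cons.IH partial_eq[OF f] partial_eq[OF g] partial_eq[OF has_derivative_add[OF f g]]
      by simp
  qed
qed simp

lemma smooth_bounded_linear_aux:
  assumes "smooth f" "bounded_linear h"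
  shows "foldr partial js (\<lambda>x. h (f x)) = (\<lambda>x. h (foldr partial js f x))"
proof (induction js)
  case (Cons j js)
  show ?case
  proof
    fix x
    obtain f' where f: "(foldr partial js f has_derivative f') (at x)"
      using assms unfolding smooth_def differentiable_def by blast
    show "foldr partial (j # js) (\<lambda>x. h (f x)) x = h (foldr partial (j # js) f x)"
      using Cons.IH partial_eq[OF f] partial_eq[OF bounded_linear.has_derivative[OF assms(2) f]]
      by simp
  qed
qed simp

lemma smooth_add: "smooth f \<Longrightarrow> smooth g \<Longrightarrow> smooth (\<lambda>x. f x + g x)"
  unfolding smooth_def[of "\<lambda>x. f x + g x"] smooth_add_aux
  by (auto simp: smooth_def intro!: differentiable_add)

lemma smooth_bounded_linear:
  assumes "smooth f" "bounded_linear h"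
  shows "smooth (\<lambda>x. h (f x))"
  unfolding smooth_def smooth_bounded_linear_aux[OF assms]
proof (intro allI)
  fix js x
  obtain f' where f: "(foldr partial js f has_derivative f') (at x)"
    using assms unfolding smooth_def differentiable_def by blast
  show "(\<lambda>x. h (foldr partial js f x)) differentiable at x"
    using bounded_linear.has_derivative[OF assms(2) f] by (auto simp: differentiable_def)
qed

lemma smooth_zero: "smooth (\<lambda>x::real^'n::finite. 0::'b::real_normed_vector)"
proof -
  have "foldr partial js (\<lambda>x::real^'n. 0::'b) = (\<lambda>x. 0)" for js
    by (induction js) (simp_all add: partial_def)
  then show ?thesis by (simp add: smooth_def)
qed


section \<open>Test functions and distributions on the torus\<close>

text \<open>\<open>C\<^sup>\<infinity>(T\<^sup>n)\<close>, as a type, with its Frechet topology.\<close>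

typedef (overloaded) 'n::finite test_fun =
  "{\<phi> :: real ^ 'n \<Rightarrow> complex. smooth \<phi> \<and> periodic \<phi>}"
  by (rule exI[of _ "\<lambda>x. 0"]) (simp add: smooth_zero periodic_def)

setup_lifting type_definition_test_fun

instantiation test_fun :: (finite) complex_vector
begin
lift_definition zero_test_fun :: "'a test_fun" is "\<lambda>x. 0"
  by (simp add: smooth_zero periodic_def)
lift_definition plus_test_fun :: "'a test_fun \<Rightarrow> 'a test_fun \<Rightarrow> 'a test_fun"
  is "\<lambda>\<phi> \<psi> x. \<phi> x + \<psi> x"
  by (simp add: smooth_add periodic_def)
lift_definition uminus_test_fun :: "'a test_fun \<Rightarrow> 'a test_fun" is "\<lambda>\<phi> x. - \<phi> x"
  by (simp add: smooth_bounded_linear[OF _ bounded_linear_minus[OF bounded_linear_ident]]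
      periodic_def)
lift_definition minus_test_fun :: "'a test_fun \<Rightarrow> 'a test_fun \<Rightarrow> 'a test_fun"
  is "\<lambda>\<phi> \<psi> x. \<phi> x - \<psi> x"
  subgoal for \<phi> \<psi>
    using smooth_add[of \<phi> "\<lambda>x. - \<psi> x"]
    by (simp add: smooth_bounded_linear[OF _ bounded_linear_minus[OF bounded_linear_ident]]
        periodic_def)
  done
lift_definition scaleC_test_fun :: "complex \<Rightarrow> 'a test_fun \<Rightarrow> 'a test_fun"
  is "\<lambda>c \<phi> x. c * \<phi> x"
  by (simp add: smooth_bounded_linear[OF _ bounded_linear_mult_right] periodic_def)
instance
  by standard (transfer, simp add: fun_eq_iff algebra_simps)+
end

definition test_seminorm :: "nat \<Rightarrow> 'n::finite test_fun \<Rightarrow> real" where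
  "test_seminorm N \<phi> =
     (MAX \<alpha>\<in>mi_upto N. SUP x. norm (mi_power partial \<alpha> (Rep_test_fun \<phi>) x))"

lemma test_seminorm_mono: "M \<le> N \<Longrightarrow> test_seminorm M \<phi> \<le> test_seminorm N \<phi>"
  unfolding test_seminorm_def
  by (intro Max_mono image_mono mi_upto_mono finite_imageI finite_mi_upto)
    (use zero_in_mi_upto in auto)

text \<open>The seminorms increase with \<open>N\<close>, so their open balls form neighbourhood bases.\<close>

instantiation test_fun :: (finite) topological_space
begin
definition open_test_fun :: "'a test_fun set \<Rightarrow> bool" where
  "open_test_fun U \<longleftrightarrow> (\<forall>\<phi>\<in>U. \<exists>N. \<exists>\<epsilon>>0. \<forall>\<psi>. test_seminorm N (\<psi> - \<phi>) < \<epsilon> \<longrightarrow> \<psi> \<in> U)"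
instance
proof
  show "open (UNIV :: 'a test_fun set)"
    by (auto simp: open_test_fun_def intro: exI[of _ 1])
next
  fix S T :: "'a test_fun set" assume ST: "open S" "open T"
  show "open (S \<inter> T)"
    unfolding open_test_fun_def
  proof
    fix \<phi> assume "\<phi> \<in> S \<inter> T"
    then obtain M \<delta> N \<epsilon> where
      1: "\<delta> > 0" "\<And>\<psi>. test_seminorm M (\<psi> - \<phi>) < \<delta> \<Longrightarrow> \<psi> \<in> S" and
      2: "\<epsilon> > 0" "\<And>\<psi>. test_seminorm N (\<psi> - \<phi>) < \<epsilon> \<Longrightarrow> \<psi> \<in> T"
      using ST unfolding open_test_fun_def by (metis IntD1 IntD2)
    have "\<psi> \<in> S \<inter> T" if "test_seminorm (max M N) (\<psi> - \<phi>) < min \<delta> \<epsilon>" for \<psi>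
      using that 1(2)[of \<psi>] 2(2)[of \<psi>] test_seminorm_mono[of M "max M N" "\<psi> - \<phi>"]
        test_seminorm_mono[of N "max M N" "\<psi> - \<phi>"] by auto
    then show "\<exists>N. \<exists>\<epsilon>>0. \<forall>\<psi>. test_seminorm N (\<psi> - \<phi>) < \<epsilon> \<longrightarrow> \<psi> \<in> S \<inter> T"
      using 1(1) 2(1) by (intro exI[of _ "max M N"] exI[of _ "min \<delta> \<epsilon>"]) auto
  qed
next
  fix K :: "'a test_fun set set" assume "\<forall>S\<in>K. open S"
  then show "open (\<Union>K)"
    unfolding open_test_fun_def by (meson UnionE UnionI)
qed
end

definition distributions :: "('n::finite test_fun \<Rightarrow> 'e::complex_banach) set" where
  "distributions = {u. clinear_on UNIV u \<and> continuous_on UNIV u}"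

definition rvec :: "int ^ 'n::finite \<Rightarrow> real ^ 'n" where
  "rvec k = (\<chi> j. real_of_int (k $ j))"

lemma smooth_exponential: "smooth (\<lambda>x::real^'n::finite. exp (\<i> * complex_of_real (y \<bullet> x)))"
proof -
  let ?e = "\<lambda>x::real^'n. exp (\<i> * complex_of_real (y \<bullet> x))"
  have D: "((\<lambda>x. c * ?e x) has_derivative (\<lambda>h. c * (\<i> * complex_of_real (y \<bullet> h)) * ?e x)) (at x)"
    for c x
  proof -
    have "((\<lambda>x. \<i> * complex_of_real (y \<bullet> x)) has_derivative (\<lambda>h. \<i> * complex_of_real (y \<bullet> h)))
        (at x)"
      by (intro bounded_linear.has_derivative[OF bounded_linear_mult_right]
          bounded_linear.has_derivative[OF bounded_linear_of_real]
          bounded_linear_imp_has_derivative bounded_linear_inner_right)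
    from bounded_linear.has_derivative[OF bounded_linear_mult_right[of c]
        has_derivative_compose[OF this DERIV_exp[unfolded has_field_derivative_def]]]
    show ?thesis by (simp add: mult_ac)
  qed
  have "\<exists>c. foldr partial js ?e = (\<lambda>x. c * ?e x)" for js
  proof (induction js)
    case Nil
    show ?case by (intro exI[of _ 1]) simp
  next
    case (Cons j js)
    then obtain c where c: "foldr partial js ?e = (\<lambda>x. c * ?e x)" by blast
    show ?case
    proof (intro exI[of _ "c * (\<i> * complex_of_real (y \<bullet> axis j 1))"] ext)
      fix x
      show "foldr partial (j # js) ?e x = c * (\<i> * complex_of_real (y \<bullet> axis j 1)) * ?e x"
        by (simp add: c partial_eq[OF D])
    qed
  qed
  then show ?thesis
    unfolding smooth_def using D by (metis differentiable_def)
qed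

lemma periodic_exponential:
  "periodic (\<lambda>x::real^'n::finite. exp (\<i> * complex_of_real (rvec k \<bullet> x)))"
proof -
  have "exp (\<i> * complex_of_real (rvec k \<bullet> (x + (2 * pi) *\<^sub>R axis j 1)))
      = exp (\<i> * complex_of_real (rvec k \<bullet> x))" for j and x :: "real^'n"
    unfolding exp_eq
    by (intro exI[of _ "k $ j"]) (simp add: inner_add_right inner_axis rvec_def algebra_simps)
  then show ?thesis by (simp add: periodic_def)
qed

lift_definition texp :: "int ^ 'n::finite \<Rightarrow> 'n test_fun"
  is "\<lambda>k x. exp (\<i> * complex_of_real (rvec k \<bullet> x))"
  by (simp add: smooth_exponential periodic_exponential)

definition fourier_coeff :: "('n::finite test_fun \<Rightarrow> 'e) \<Rightarrow> int ^ 'n \<Rightarrow> 'e" where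
  "fourier_coeff u k = u (texp (- k))"


section \<open>Vector-valued integration\<close>

text \<open>Normalized Lebesgue measure on the fundamental cube. It makes no difference that \<open>lborel\<close> is not
  complete, because measurability of vector-valued functions is only required almost everywhere.\<close>

definition torus :: "(real ^ 'n::finite) measure" where
  "torus = uniform_measure lborel (cbox 0 (\<chi> j. 2 * pi))"

text \<open>The library's Bochner integral is restricted to second-countable value spaces. For arbitrary
  Banach spaces, Borel measurability in its definition has to be replaced by strong measurability.\<close>

definition strongly_measurable :: "'a measure \<Rightarrow> ('a \<Rightarrow> 'e::real_normed_vector) \<Rightarrow> bool" where
  "strongly_measurable M f \<longleftrightarrow>
     (\<exists>s. (\<forall>i. simple_function M (s i)) \<and> (AE x in M. (\<lambda>i::nat. s i x) \<longlonglongrightarrow> f x))"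

definition has_bochner_integral_strong ::
    "'a measure \<Rightarrow> ('a \<Rightarrow> 'e::real_normed_vector) \<Rightarrow> 'e \<Rightarrow> bool" where
  "has_bochner_integral_strong M f I \<longleftrightarrow> strongly_measurable M f \<and>
     (\<exists>s. (\<forall>i. Bochner_Integration.simple_bochner_integrable M (s i)) \<and>
          (\<lambda>i::nat. \<integral>\<^sup>+x. ennreal (norm (f x - s i x)) \<partial>M) \<longlonglongrightarrow> 0 \<and>
          (\<lambda>i. Bochner_Integration.simple_bochner_integral M (s i)) \<longlonglongrightarrow> I)"

text \<open>\<open>f\<close> is an integrable function on the torus, and \<open>u\<close> is the distribution identified with it
  (for \<open>\<phi> = 1\<close> the condition contains the integrability of \<open>f\<close>).\<close>

definition represents ::
    "(real ^ 'n::finite \<Rightarrow> 'e::complex_banach) \<Rightarrow> ('n test_fun \<Rightarrow> 'e) \<Rightarrow> bool" where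
  "represents f u \<longleftrightarrow> periodic f \<and>
     (\<forall>\<phi>. has_bochner_integral_strong torus (\<lambda>x. Rep_test_fun \<phi> x *\<^sub>C f x) (u \<phi>))"

definition epow :: "ennreal \<Rightarrow> real \<Rightarrow> ennreal" where
  "epow x r = (if x = \<infinity> then \<infinity> else ennreal (enn2real x powr r))"

text \<open>The \<open>L\<^sup>p\<close>-norm, with values in \<open>[0,\<infinity>]\<close>, of a \<open>[0,\<infinity>]\<close>-valued function. For the counting
  measure on \<open>nat\<close> this is the \<open>\<ell>\<^sup>p\<close>-norm.\<close>

definition Lp_enorm :: "'a measure \<Rightarrow> ennreal \<Rightarrow> ('a \<Rightarrow> ennreal) \<Rightarrow> ennreal" where
  "Lp_enorm M p g =
     (if p = \<infinity> then Inf {C. AE x in M. g x \<le> C}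
      else epow (\<integral>\<^sup>+x. epow (g x) (enn2real p) \<partial>M) (1 / enn2real p))"

text \<open>The \<open>L\<^sup>p\<close>-norm of a distribution: that of the function it is identified with (which is
  unique up to null sets), and \<open>\<infinity>\<close> if there is no such function.\<close>

definition Lp_distr_enorm :: "ennreal \<Rightarrow> ('n::finite test_fun \<Rightarrow> 'e::complex_banach) \<Rightarrow> ennreal" where
  "Lp_distr_enorm p u = (INF f\<in>{f. represents f u}. Lp_enorm torus p (\<lambda>x. ennreal (norm (f x))))"


section \<open>Toroidal pseudodifferential operators and symbol classes\<close>

definition fourier_coeff_test :: "'n::finite test_fun \<Rightarrow> int ^ 'n \<Rightarrow> complex" where
  "fourier_coeff_test \<phi> k = integral\<^sup>L torus (\<lambda>x. Rep_test_fun (texp (- k)) x * Rep_test_fun \<phi> x)"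

definition op_tor :: "(int ^ 'n::finite \<Rightarrow> 'e::complex_banach \<Rightarrow>\<^sub>L 'e) \<Rightarrow>
    ('n test_fun \<Rightarrow> 'e) \<Rightarrow> 'n test_fun \<Rightarrow> 'e" where
  "op_tor a u = (\<lambda>\<phi>. \<Sum>\<^sub>\<infinity>k. fourier_coeff_test \<phi> (- k) *\<^sub>C blinfun_apply (a k) (fourier_coeff u k))"

definition scalar_symbol ::
    "(real ^ 'n::finite \<Rightarrow> complex) \<Rightarrow> int ^ 'n \<Rightarrow> 'e::complex_banach \<Rightarrow>\<^sub>L 'e" where
  "scalar_symbol \<phi> k = \<phi> (rvec k) *\<^sub>C id_blinfun"

definition diff_op :: "'n::finite \<Rightarrow> (int ^ 'n \<Rightarrow> 'b::ab_group_add) \<Rightarrow> int ^ 'n \<Rightarrow> 'b" where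
  "diff_op j a = (\<lambda>k. a (k + axis j 1) - a k)"

definition jap :: "real ^ 'n::finite \<Rightarrow> real" where
  "jap x = sqrt (1 + (norm x)\<^sup>2)"

definition symbol_weight :: "real \<Rightarrow> (int ^ 'n::finite \<Rightarrow> 'e::complex_banach \<Rightarrow>\<^sub>L 'e) \<Rightarrow>
    nat ^ 'n \<Rightarrow> int ^ 'n \<Rightarrow> real" where
  "symbol_weight m a \<alpha> k =
     jap (rvec k) powr (real (mi_abs \<alpha>) - m) * norm (mi_power diff_op \<alpha> a k)"

text \<open>The space \<open>S\<^bsup>m,\<rho>\<^esup>\<close>. The type \<open>'e \<Rightarrow>\<^sub>L 'e\<close> consists of the bounded real-linear maps, hence
  the additional condition of complex linearity.\<close>

definition symbol_space ::
    "real \<Rightarrow> nat \<Rightarrow> (int ^ 'n::finite \<Rightarrow> 'e::complex_banach \<Rightarrow>\<^sub>L 'e) nspace" where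
  "symbol_space m \<rho> = \<lparr>
     carr = {a. (\<forall>k. clinear_on UNIV (blinfun_apply (a k))) \<and>
                (\<forall>\<alpha>\<in>mi_upto \<rho>. bdd_above (range (symbol_weight m a \<alpha>)))},
     nrm = (\<lambda>a. MAX \<alpha>\<in>mi_upto \<rho>. SUP k. symbol_weight m a \<alpha> k) \<rparr>"


section \<open>Besov spaces\<close>

definition schwartz :: "(real ^ 'n::finite \<Rightarrow> complex) \<Rightarrow> bool" where
  "schwartz f \<longleftrightarrow> smooth f \<and>
     (\<forall>\<alpha> N. \<exists>C. \<forall>x. (1 + norm x) ^ N * norm (mi_power partial \<alpha> f x) \<le> C)"

definition dyadic_decomposition :: "(nat \<Rightarrow> real ^ 'n::finite \<Rightarrow> complex) \<Rightarrow> bool" where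
  "dyadic_decomposition \<phi> \<longleftrightarrow>
     (\<forall>j. schwartz (\<phi> j)) \<and>
     closure {\<xi>. \<phi> 0 \<xi> \<noteq> 0} \<subseteq> {\<xi>. norm \<xi> \<le> 2} \<and>
     (\<forall>j\<ge>1. closure {\<xi>. \<phi> j \<xi> \<noteq> 0} \<subseteq> {\<xi>. 2 ^ (j - 1) \<le> norm \<xi> \<and> norm \<xi> \<le> 2 ^ (j + 1)}) \<and>
     (\<forall>\<xi>. (\<lambda>j. \<phi> j \<xi>) sums 1) \<and>
     (\<forall>\<alpha>. \<exists>c>0. \<forall>\<xi> j. norm (mi_power partial \<alpha> (\<phi> j) \<xi>) \<le> c * 2 powr (- real (j * mi_abs \<alpha>)))"

definition besov_enorm :: "(nat \<Rightarrow> real ^ 'n::finite \<Rightarrow> complex) \<Rightarrow> real \<Rightarrow> ennreal \<Rightarrow> ennreal \<Rightarrow>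
    ('n test_fun \<Rightarrow> 'e::complex_banach) \<Rightarrow> ennreal" where
  "besov_enorm \<phi> s p q u =
     Lp_enorm (count_space UNIV) q
       (\<lambda>j. ennreal (2 powr (real j * s)) * Lp_distr_enorm p (op_tor (scalar_symbol (\<phi> j)) u))"

definition besov :: "(nat \<Rightarrow> real ^ 'n::finite \<Rightarrow> complex) \<Rightarrow> real \<Rightarrow> ennreal \<Rightarrow> ennreal \<Rightarrow>
    ('n test_fun \<Rightarrow> 'e::complex_banach) nspace" where
  "besov \<phi> s p q = \<lparr>
     carr = {u \<in> distributions. besov_enorm \<phi> s p q u < \<infinity>},
     nrm = (\<lambda>u. enn2real (besov_enorm \<phi> s p q u)) \<rparr>"

end

theory Submission
  imports Defs
begin

text \<open>The proof cuts the symbol into its dyadic pieces \<open>b\<^sub>j = \<phi>\<^sub>j a\<close>, which live at the frequency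
  \<open>L = 2\<^sup>j\<close>. Only finitely many \<open>k\<close> occur in \<open>b\<^sub>j\<close>, so \<open>op[b\<^sub>j]\<close> is the convolution with the trigonometric
  polynomial \<open>K\<^sub>j = \<Sum>\<^sub>k e\<^sub>k b\<^sub>j(k)\<close>, whose values are operators on \<open>E\<close>. All that is needed is the bound
  \<open>C \<parallel>a\<parallel> L\<^sup>m\<close> for the \<open>L\<^sup>1\<close>-norm of \<open>K\<^sub>j\<close>. On a general Banach space there is no Plancherel theorem to get
  it, but crude pointwise bounds are enough. Counting frequencies gives \<open>\<parallel>K\<^sub>j\<parallel> \<le> C \<parallel>a\<parallel> L\<^sup>m L\<^sup>n\<close>.
  A multiplication of \<open>K\<^sub>j(z)\<close> with the \<open>N\<close>-th power of \<open>exp(- i z\<^sub>l) - 1\<close> replaces \<open>b\<^sub>j\<close> by its \<open>N\<close>-th difference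
  in the direction \<open>l\<close>, which by the symbol estimates and a discrete Leibniz rule is smaller by the
  factor \<open>L\<^bsup>-N\<^esup>\<close>. For \<open>N = n + 1\<close> both bounds together are integrable, uniformly in \<open>L\<close>
  (\<open>norm_trig_poly_le_kernel_majorant\<close>, \<open>nn_integral_kernel_majorant_le\<close>); this is where \<open>\<rho> \<ge> n + 1\<close> is used.

  Young's inequality, in the form of a Schur test, turns the kernel bound into an estimate of \<open>op[b\<^sub>j]\<close> on
  \<open>L\<^sup>p\<close> for all \<open>p\<close> at once (\<open>Lp_distr_enorm_multiplier_le\<close>). Since \<open>\<phi>\<^sub>j\<close> meets \<open>\<phi>\<^sub>l\<close> at most for
  \<open>\<bar>l - j\<bar> \<le> 2\<close>, the dyadic piece \<open>op[\<phi>\<^sub>j] op[a] u\<close> is the sum of the five terms \<open>op[b\<^sub>j] op[\<phi>\<^sub>l] u\<close>, and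
  another Schur test, for a banded matrix, sums these estimates in \<open>\<ell>\<^sup>q\<close> (\<open>op_tor_besov_estimate\<close>). The
  constant is linear in the bound of the symbol. As \<open>op[a] u\<close> is linear in \<open>a\<close> and in \<open>u\<close>, both
  continuity statements follow.

  The \<open>L\<^sup>p\<close>-norm of a distribution is an infimum over the functions that represent it, so the estimates
  have to hold for each of them. They do, since \<open>op[b\<^sub>j] v\<close> is represented by an explicit trigonometric polynomial, and the
  Fourier coefficients of \<open>v\<close> in it can be computed with any function that represents \<open>v\<close>. After norms have been
  taken under the integral sign, everything that is estimated is a scalar function, so that the
  strong Bochner integral enters only through its linearity and the bound of its norm.

  The remaining part concerns distributions. Fourier coefficients of test functions
  decay rapidly (\<open>norm_fourier_coeff_test_le\<close>), those of distributions grow at most polynomially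
  (\<open>poly_growth_fourier_coeff\<close>), and the functions \<open>e\<^sub>k\<close> are orthogonal. Hence \<open>op[a]\<close> maps distributions
  to distributions and multiplies their Fourier coefficients by \<open>a\<close>.\<close>


section \<open>Strongly measurable functions and the strong Bochner integral\<close>

lemma strongly_measurable_norm_AE:
  assumes "strongly_measurable M f"
  obtains F :: "'a \<Rightarrow> real" where "F \<in> borel_measurable M" "\<forall>x. 0 \<le> F x"
    "AE x in M. norm (f x) = F x"
proof -
  obtain s where s: "\<And>i::nat. simple_function M (s i)"
    and lim: "AE x in M. (\<lambda>i. s i x) \<longlonglongrightarrow> f x"
    using assms unfolding strongly_measurable_def by blast
  have [measurable]: "(\<lambda>x. norm (s i x)) \<in> borel_measurable M" for i
    by (intro borel_measurable_simple_function simple_function_compose1[OF s])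
  define F where "F = (\<lambda>x. max 0 (lim (\<lambda>i. norm (s i x))))"
  have "F \<in> borel_measurable M"
    unfolding F_def by measurable
  moreover have "AE x in M. norm (f x) = F x"
    using lim
  proof eventually_elim
    case (elim x)
    then have "lim (\<lambda>i. norm (s i x)) = norm (f x)"
      by (intro limI tendsto_norm)
    then show ?case by (simp add: F_def)
  qed
  ultimately show ?thesis using that[of F] by (simp add: F_def)
qed

lemma strongly_measurable_simple: "simple_function M s \<Longrightarrow> strongly_measurable M s"
  unfolding strongly_measurable_def by (intro exI[of _ "\<lambda>_. s"]) simp

lemma strongly_measurable_add:
  assumes "strongly_measurable M f" "strongly_measurable M g"
  shows "strongly_measurable M (\<lambda>x. f x + g x)"
proof -
  obtain s t where "\<And>i::nat. simple_function M (s i)" "AE x in M. (\<lambda>i. s i x) \<longlonglongrightarrow> f x"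
    and "\<And>i::nat. simple_function M (t i)" "AE x in M. (\<lambda>i. t i x) \<longlonglongrightarrow> g x"
    using assms unfolding strongly_measurable_def by blast
  then show ?thesis
    unfolding strongly_measurable_def
    by (intro exI[of _ "\<lambda>i x. s i x + t i x"] conjI allI)
      (auto intro: simple_function_compose2[where h = "(+)"] tendsto_add elim!: eventually_elim2)
qed

lemma strongly_measurable_linear:
  assumes "bounded_linear T" "strongly_measurable M f"
  shows "strongly_measurable M (\<lambda>x. T (f x))"
proof -
  obtain s where s: "\<And>i::nat. simple_function M (s i)" "AE x in M. (\<lambda>i. s i x) \<longlonglongrightarrow> f x"
    using assms unfolding strongly_measurable_def by blast
  then show ?thesis
    unfolding strongly_measurable_def
    by (intro exI[of _ "\<lambda>i x. T (s i x)"] conjI allI)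
      (auto intro: simple_function_compose1[where g = T] bounded_linear.tendsto[OF assms(1)]
        elim!: eventually_mono)
qed

lemma strongly_measurable_diff:
  assumes "strongly_measurable M f" "strongly_measurable M g"
  shows "strongly_measurable M (\<lambda>x. f x - g x)"
  using strongly_measurable_add[OF assms(1)
      strongly_measurable_linear[OF bounded_linear_minus[OF bounded_linear_ident] assms(2)]]
  by simp

text \<open>The upper integral used for the norms is subadditive only on measurable functions, and norms of
  strongly measurable functions are measurable only up to a null set.\<close>

lemma nn_integral_norm_triangle:
  assumes f: "strongly_measurable M f" and g: "strongly_measurable M g"
    and le: "\<And>x. norm (h x) \<le> norm (f x) + norm (g x)"
  shows "(\<integral>\<^sup>+x. ennreal (norm (h x)) \<partial>M)
    \<le> (\<integral>\<^sup>+x. ennreal (norm (f x)) \<partial>M) + (\<integral>\<^sup>+x. ennreal (norm (g x)) \<partial>M)"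
proof -
  obtain F where F [measurable]: "F \<in> borel_measurable M" and F0: "\<And>x. 0 \<le> F x"
    and FA: "AE x in M. norm (f x) = F x"
    using strongly_measurable_norm_AE[OF f] by blast
  obtain G where G [measurable]: "G \<in> borel_measurable M" and G0: "\<And>x. 0 \<le> G x"
    and GA: "AE x in M. norm (g x) = G x"
    using strongly_measurable_norm_AE[OF g] by blast
  have "(\<integral>\<^sup>+x. ennreal (norm (h x)) \<partial>M) \<le> (\<integral>\<^sup>+x. ennreal (F x) + ennreal (G x) \<partial>M)"
  proof (rule nn_integral_mono_AE)
    show "AE x in M. ennreal (norm (h x)) \<le> ennreal (F x) + ennreal (G x)"
      using FA GA
    proof eventually_elim
      case (elim x)
      then show ?case using le[of x] F0[of x] G0[of x]
        by (simp flip: ennreal_plus add: ennreal_leI)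
    qed
  qed
  also have "\<dots> = (\<integral>\<^sup>+x. ennreal (F x) \<partial>M) + (\<integral>\<^sup>+x. ennreal (G x) \<partial>M)"
    by (rule nn_integral_add) auto
  also have "(\<integral>\<^sup>+x. ennreal (F x) \<partial>M) = (\<integral>\<^sup>+x. ennreal (norm (f x)) \<partial>M)"
    by (rule nn_integral_cong_AE) (use FA in auto)
  also have "(\<integral>\<^sup>+x. ennreal (G x) \<partial>M) = (\<integral>\<^sup>+x. ennreal (norm (g x)) \<partial>M)"
    by (rule nn_integral_cong_AE) (use GA in auto)
  finally show ?thesis .
qed

lemma simple_bochner_integrable_simple_function:
  "Bochner_Integration.simple_bochner_integrable M s \<Longrightarrow> simple_function M s"
  by (auto elim: Bochner_Integration.simple_bochner_integrable.cases)

lemma has_bochner_integral_strong_strongly_measurable: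
  "has_bochner_integral_strong M f I \<Longrightarrow> strongly_measurable M f"
  by (simp add: has_bochner_integral_strong_def)

lemma has_bochner_integral_strong_norm_le:
  assumes "has_bochner_integral_strong M f I"
  shows "ennreal (norm I) \<le> (\<integral>\<^sup>+x. ennreal (norm (f x)) \<partial>M)"
proof -
  obtain s where f: "strongly_measurable M f"
    and s: "\<And>i::nat. Bochner_Integration.simple_bochner_integrable M (s i)"
    and lim0: "(\<lambda>i. \<integral>\<^sup>+x. ennreal (norm (f x - s i x)) \<partial>M) \<longlonglongrightarrow> 0"
    and lim: "(\<lambda>i. Bochner_Integration.simple_bochner_integral M (s i)) \<longlonglongrightarrow> I"
    using assms unfolding has_bochner_integral_strong_def by blast
  have sm: "strongly_measurable M (s i)" for i
    by (intro strongly_measurable_simple simple_bochner_integrable_simple_function s)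
  have "ennreal (norm (Bochner_Integration.simple_bochner_integral M (s i)))
      \<le> (\<integral>\<^sup>+x. ennreal (norm (f x)) \<partial>M) + (\<integral>\<^sup>+x. ennreal (norm (f x - s i x)) \<partial>M)" for i
  proof -
    have "Bochner_Integration.simple_bochner_integrable M (\<lambda>x. norm (s i x))"
      using simple_bochner_integrable_compose2[of "\<lambda>x y. norm x", OF _ s s] by simp
    then have "ennreal (norm (Bochner_Integration.simple_bochner_integral M (s i)))
        \<le> (\<integral>\<^sup>+x. ennreal (norm (s i x)) \<partial>M)"
      using simple_bochner_integral_norm_bound[OF s, of i]
      by (subst simple_bochner_integral_eq_nn_integral[symmetric]) (auto intro: ennreal_leI)
    also have "\<dots> \<le> (\<integral>\<^sup>+x. ennreal (norm (f x)) \<partial>M) + (\<integral>\<^sup>+x. ennreal (norm (f x - s i x)) \<partial>M)"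
      by (rule nn_integral_norm_triangle[OF f strongly_measurable_diff[OF f sm]])
        (metis norm_triangle_sub norm_minus_commute)
    finally show ?thesis .
  qed
  then have "ennreal (norm I) \<le> (\<integral>\<^sup>+x. ennreal (norm (f x)) \<partial>M) + 0"
    by (intro LIMSEQ_le[OF tendsto_ennrealI[OF tendsto_norm[OF lim]] tendsto_add[OF tendsto_const lim0]])
      auto
  then show ?thesis by simp
qed

lemma has_bochner_integral_strong_linear:
  assumes T: "bounded_linear T" and "has_bochner_integral_strong M f I"
  shows "has_bochner_integral_strong M (\<lambda>x. T (f x)) (T I)"
proof -
  interpret T: bounded_linear T by (rule T)
  obtain s where f: "strongly_measurable M f"
    and s: "\<And>i::nat. Bochner_Integration.simple_bochner_integrable M (s i)"
    and lim0: "(\<lambda>i. \<integral>\<^sup>+x. ennreal (norm (f x - s i x)) \<partial>M) \<longlonglongrightarrow> 0"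
    and lim: "(\<lambda>i. Bochner_Integration.simple_bochner_integral M (s i)) \<longlonglongrightarrow> I"
    using assms(2) unfolding has_bochner_integral_strong_def by blast
  obtain K where K: "K > 0" "\<And>x. norm (T x) \<le> norm x * K"
    using T.pos_bounded by blast
  have sm: "strongly_measurable M (\<lambda>x. f x - s i x)" for i
    by (intro strongly_measurable_diff f strongly_measurable_simple
        simple_bochner_integrable_simple_function s)
  have le: "(\<integral>\<^sup>+x. ennreal (norm (T (f x) - T (s i x))) \<partial>M)
      \<le> ennreal K * (\<integral>\<^sup>+x. ennreal (norm (f x - s i x)) \<partial>M)" for i
  proof -
    obtain F where F [measurable]: "F \<in> borel_measurable M" and F0: "\<And>x. 0 \<le> F x"
      and FA: "AE x in M. norm (f x - s i x) = F x"
      using strongly_measurable_norm_AE[OF sm] by blast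
    have "(\<integral>\<^sup>+x. ennreal (norm (T (f x) - T (s i x))) \<partial>M) \<le> (\<integral>\<^sup>+x. ennreal K * ennreal (F x) \<partial>M)"
    proof (rule nn_integral_mono_AE)
      show "AE x in M. ennreal (norm (T (f x) - T (s i x))) \<le> ennreal K * ennreal (F x)"
        using FA
      proof eventually_elim
        case (elim x)
        show ?case using K(2)[of "f x - s i x"] elim K(1) F0[of x]
          by (simp flip: ennreal_mult add: T.diff mult.commute ennreal_leI)
      qed
    qed
    also have "\<dots> = ennreal K * (\<integral>\<^sup>+x. ennreal (F x) \<partial>M)"
      by (rule nn_integral_cmult) auto
    also have "(\<integral>\<^sup>+x. ennreal (F x) \<partial>M) = (\<integral>\<^sup>+x. ennreal (norm (f x - s i x)) \<partial>M)"
      by (rule nn_integral_cong_AE) (use FA in auto)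
    finally show ?thesis .
  qed
  show ?thesis
    unfolding has_bochner_integral_strong_def
  proof (intro conjI exI[of _ "\<lambda>i x. T (s i x)"] allI)
    show "strongly_measurable M (\<lambda>x. T (f x))"
      by (rule strongly_measurable_linear[OF T f])
    show "Bochner_Integration.simple_bochner_integrable M (\<lambda>x. T (s i x))" for i
      using simple_bochner_integrable_compose2[of "\<lambda>x y. T x", OF _ s s] by (simp add: T.zero)
    have h: "(\<lambda>i. ennreal K * (\<integral>\<^sup>+x. ennreal (norm (f x - s i x)) \<partial>M)) \<longlonglongrightarrow> 0"
      using ennreal_tendsto_cmult[OF _ lim0, of "ennreal K"] by simp
    show "(\<lambda>i. \<integral>\<^sup>+ x. ennreal (norm (T (f x) - T (s i x))) \<partial>M) \<longlonglongrightarrow> 0"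
      by (rule tendsto_sandwich[OF _ _ tendsto_const h]) (simp_all add: le)
    show "(\<lambda>i. Bochner_Integration.simple_bochner_integral M (\<lambda>x. T (s i x))) \<longlonglongrightarrow> T I"
      using T.tendsto[OF lim]
      by (simp add: simple_bochner_integral_linear[OF T.linear_axioms s])
  qed
qed

lemma has_bochner_integral_strong_add:
  assumes "has_bochner_integral_strong M f I" "has_bochner_integral_strong M g J"
  shows "has_bochner_integral_strong M (\<lambda>x. f x + g x) (I + J)"
proof -
  obtain s where f: "strongly_measurable M f"
    and s: "\<And>i::nat. Bochner_Integration.simple_bochner_integrable M (s i)"
    and s0: "(\<lambda>i. \<integral>\<^sup>+x. ennreal (norm (f x - s i x)) \<partial>M) \<longlonglongrightarrow> 0"
    and sl: "(\<lambda>i. Bochner_Integration.simple_bochner_integral M (s i)) \<longlonglongrightarrow> I"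
    using assms(1) unfolding has_bochner_integral_strong_def by blast
  obtain t where g: "strongly_measurable M g"
    and t: "\<And>i::nat. Bochner_Integration.simple_bochner_integrable M (t i)"
    and t0: "(\<lambda>i. \<integral>\<^sup>+x. ennreal (norm (g x - t i x)) \<partial>M) \<longlonglongrightarrow> 0"
    and tl: "(\<lambda>i. Bochner_Integration.simple_bochner_integral M (t i)) \<longlonglongrightarrow> J"
    using assms(2) unfolding has_bochner_integral_strong_def by blast
  show ?thesis
    unfolding has_bochner_integral_strong_def
  proof (intro conjI exI[of _ "\<lambda>i x. s i x + t i x"] allI)
    show "strongly_measurable M (\<lambda>x. f x + g x)"
      by (rule strongly_measurable_add[OF f g])
    show "Bochner_Integration.simple_bochner_integrable M (\<lambda>x. s i x + t i x)" for i
      using simple_bochner_integrable_compose2[of "(+)", OF _ s t] by simp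
    have "(\<integral>\<^sup>+ x. ennreal (norm (f x + g x - (s i x + t i x))) \<partial>M)
       \<le> (\<integral>\<^sup>+x. ennreal (norm (f x - s i x)) \<partial>M) + (\<integral>\<^sup>+x. ennreal (norm (g x - t i x)) \<partial>M)" for i
      by (rule nn_integral_norm_triangle)
        (intro strongly_measurable_diff f g strongly_measurable_simple
          simple_bochner_integrable_simple_function s t norm_diff_triangle_ineq)+
    then show "(\<lambda>i. \<integral>\<^sup>+ x. ennreal (norm (f x + g x - (s i x + t i x))) \<partial>M) \<longlonglongrightarrow> 0"
      by (intro tendsto_sandwich[OF _ _ tendsto_const tendsto_add[OF s0 t0, unfolded add_0]]
        always_eventually allI zero_le)
    show "(\<lambda>i. Bochner_Integration.simple_bochner_integral M (\<lambda>x. s i x + t i x)) \<longlonglongrightarrow> I + J"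
      using tendsto_add[OF sl tl]
      by (simp add: simple_bochner_integral_add[OF s t])
  qed
qed

lemma has_bochner_integral_strong_zero: "has_bochner_integral_strong M (\<lambda>x. 0) 0"
  unfolding has_bochner_integral_strong_def
  by (intro conjI exI[of _ "\<lambda>i x. 0"])
    (auto intro!: strongly_measurable_simple Bochner_Integration.simple_bochner_integrable.intros
      simp: Bochner_Integration.simple_bochner_integral_def image_constant_conv)

lemma has_bochner_integral_strong_sum:
  assumes "finite A" "\<And>k. k \<in> A \<Longrightarrow> has_bochner_integral_strong M (f k) (I k)"
  shows "has_bochner_integral_strong M (\<lambda>x. \<Sum>k\<in>A. f k x) (\<Sum>k\<in>A. I k)"
  using assms by (induction A) (auto intro: has_bochner_integral_strong_zero has_bochner_integral_strong_add)

lemma has_bochner_integral_imp_strong: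
  assumes "has_bochner_integral M f I"
  shows "has_bochner_integral_strong M f I"
proof -
  from assms have f: "f \<in> borel_measurable M"
    and ex: "\<exists>s. (\<forall>i. Bochner_Integration.simple_bochner_integrable M (s i)) \<and>
      (\<lambda>i::nat. \<integral>\<^sup>+x. ennreal (norm (f x - s i x)) \<partial>M) \<longlonglongrightarrow> 0 \<and>
      (\<lambda>i. Bochner_Integration.simple_bochner_integral M (s i)) \<longlonglongrightarrow> I"
    unfolding has_bochner_integral.simps by blast+
  obtain t where t: "\<And>i::nat. simple_function M (t i)"
    and tl: "\<And>x. x \<in> space M \<Longrightarrow> (\<lambda>i. t i x) \<longlonglongrightarrow> f x"
    using borel_measurable_implies_sequence_metric[OF f, of 0] by blast
  have "strongly_measurable M f"
    unfolding strongly_measurable_def by (intro exI[of _ t] conjI allI t AE_I2 tl)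
  then show ?thesis
    unfolding has_bochner_integral_strong_def using ex by simp
qed

section \<open>Lebesgue norms of nonnegative functions\<close>

lemma epow_ennreal: "0 \<le> x \<Longrightarrow> epow (ennreal x) r = ennreal (x powr r)"
  by (simp add: epow_def)

lemma epow_top [simp]: "epow top r = top"
  by (simp add: epow_def)

lemma epow_0 [simp]: "epow 0 r = 0"
  by (simp add: epow_def)

lemma epow_mono: "0 \<le> r \<Longrightarrow> x \<le> y \<Longrightarrow> epow x r \<le> epow y r"
  by (auto simp: epow_def top_unique less_top intro!: ennreal_leI powr_mono2 enn2real_mono)

lemma epow_epow:
  assumes "0 < r" shows "epow (epow x r) (1 / r) = x"
  using assms by (cases x) (simp_all add: epow_ennreal powr_powr)

lemma epow_epow':
  assumes "0 < r" shows "epow (epow x (1 / r)) r = x"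
  using assms by (cases x) (simp_all add: epow_ennreal powr_powr)

lemma epow_le_iff:
  assumes "0 < r" shows "epow x (1 / r) \<le> y \<longleftrightarrow> x \<le> epow y r"
  using assms epow_mono[of r "epow x (1 / r)" y] epow_mono[of "1 / r" x "epow y r"]
  by (auto simp: epow_epow epow_epow')

lemma epow_mult: "0 < r \<Longrightarrow> epow (x * y) r = epow x r * epow y r"
  by (cases x; cases y) (auto simp: epow_ennreal powr_mult ennreal_mult_top ennreal_top_mult 
      simp flip: ennreal_mult)

lemma epow_add_le:
  assumes "0 < r" shows "epow (x + y) r \<le> ennreal (2 powr r) * (epow x r + epow y r)"
proof -
  have "x + y \<le> 2 * max x y"
    unfolding mult_2 by (intro add_mono) auto
  then have "epow (x + y) r \<le> epow (ennreal 2 * max x y) r"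
    using assms by (intro epow_mono) auto
  also have "\<dots> = ennreal (2 powr r) * epow (max x y) r"
    using assms epow_ennreal[of 2 r] by (simp add: epow_mult)
  also have "\<dots> \<le> ennreal (2 powr r) * (epow x r + epow y r)"
    by (intro mult_left_mono) (auto simp: max_def add_increasing add_increasing2)
  finally show ?thesis .
qed

lemma borel_measurable_epow [measurable]: "(\<lambda>x. epow x r) \<in> borel_measurable borel"
  unfolding epow_def by measurable

lemma one_le_enn2real: "1 \<le> p \<Longrightarrow> p \<noteq> \<infinity> \<Longrightarrow> 1 \<le> enn2real p" for p :: ennreal
  by (cases p) auto

lemma Lp_enorm_le_iff:
  assumes "1 \<le> p" "p \<noteq> \<infinity>"
  shows "Lp_enorm M p g \<le> C \<longleftrightarrow> (\<integral>\<^sup>+x. epow (g x) (enn2real p) \<partial>M) \<le> epow C (enn2real p)"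
  using assms one_le_enn2real[OF assms] by (simp add: Lp_enorm_def epow_le_iff)

lemma nn_integral_epow:
  assumes "1 \<le> p" "p \<noteq> \<infinity>"
  shows "(\<integral>\<^sup>+x. epow (g x) (enn2real p) \<partial>M) = epow (Lp_enorm M p g) (enn2real p)"
  using assms one_le_enn2real[OF assms] by (simp add: Lp_enorm_def epow_epow')

text \<open>Essential suprema and \<open>L\<^sup>p\<close>-norms of distributions are infima; this rule carries estimates over to them.\<close>

lemma le_cmult_Inf_ennreal:
  fixes X :: ennreal
  assumes "0 < B" and "\<And>C. C \<in> S \<Longrightarrow> X \<le> ennreal B * C"
  shows "X \<le> ennreal B * Inf S"
proof -
  have B: "ennreal B * (ennreal (inverse B) * Y) = Y" "ennreal (inverse B) * (ennreal B * Y) = Y" for Y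
    using assms(1) by (simp_all flip: mult.assoc ennreal_mult)
  have "ennreal (inverse B) * X \<le> Inf S"
    using mult_left_mono[OF assms(2), of _ "ennreal (inverse B)"] by (intro Inf_greatest) (simp add: B)
  from mult_left_mono[OF this, of "ennreal B"] show ?thesis by (simp add: B)
qed

lemma Lp_enorm_mono_AE:
  assumes "AE x in M. g x \<le> h x"
  shows "Lp_enorm M p g \<le> Lp_enorm M p h"
proof (cases "p = \<infinity>")
  case True
  have "AE x in M. g x \<le> C" if "AE x in M. h x \<le> C" for C
    using assms that by eventually_elim (rule order_trans)
  then have "{C. AE x in M. h x \<le> C} \<subseteq> {C. AE x in M. g x \<le> C}" by blast
  then show ?thesis
    by (simp add: Lp_enorm_def True Inf_superset_mono)
next
  case False
  then show ?thesis
    using assms by (auto simp: Lp_enorm_def elim!: eventually_mono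
        intro!: epow_mono nn_integral_mono_AE)
qed

lemma Lp_enorm_zero: "1 \<le> p \<Longrightarrow> Lp_enorm M p (\<lambda>x. 0) = 0"
  by (auto simp: Lp_enorm_def bot_ennreal intro!: Inf_eqI)

text \<open>The essential supremum is an essential upper bound, because it is the limit of a sequence of
  such bounds.\<close>

lemma AE_le_Lp_enorm_infinity: "AE x in M. g x \<le> Lp_enorm M \<infinity> g"
proof -
  define S where "S = {C. AE x in M. g x \<le> C}"
  have "S \<noteq> {}" by (auto simp: S_def intro!: exI[of _ top])
  then obtain f :: "nat \<Rightarrow> ennreal" where f: "range f \<subseteq> S" "Inf S = (INF i. f i)"
    by (metis ennreal_Inf_countable_INF)
  have "AE x in M. \<forall>i. g x \<le> f i"
    using f(1) by (subst AE_all_countable) (auto simp: S_def)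
  then have "AE x in M. g x \<le> Inf S"
    by eventually_elim (simp add: f(2) le_INF_iff)
  then show ?thesis by (simp add: Lp_enorm_def S_def)
qed

lemma Lp_enorm_infinity_le: "AE x in M. g x \<le> C \<Longrightarrow> Lp_enorm M \<infinity> g \<le> C"
  by (auto simp: Lp_enorm_def intro: Inf_lower)

text \<open>A constant in the triangle inequality is harmless, because it is applied to a bounded number of
  terms only. It comes from \<open>(x + y)\<^sup>r \<le> 2\<^sup>r (x\<^sup>r + y\<^sup>r)\<close>.\<close>

lemma Lp_enorm_add_le:
  assumes "1 \<le> p" and [measurable]: "g \<in> borel_measurable M" "h \<in> borel_measurable M"
  shows "Lp_enorm M p (\<lambda>x. g x + h x) \<le> 4 * (Lp_enorm M p g + Lp_enorm M p h)"
proof (cases "p = \<infinity>")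
  case True
  have "AE x in M. g x + h x \<le> 4 * (Lp_enorm M p g + Lp_enorm M p h)"
    using AE_le_Lp_enorm_infinity[of g M] AE_le_Lp_enorm_infinity[of h M]
  proof eventually_elim
    case (elim x)
    then have "g x + h x \<le> 1 * (Lp_enorm M p g + Lp_enorm M p h)"
      by (simp add: True add_mono)
    also have "\<dots> \<le> 4 * (Lp_enorm M p g + Lp_enorm M p h)"
      by (intro mult_right_mono) auto
    finally show ?case .
  qed
  then show ?thesis unfolding True by (rule Lp_enorm_infinity_le)
next
  case False
  define r where "r = enn2real p"
  have r: "1 \<le> r" using assms(1) False by (simp add: r_def one_le_enn2real)
  let ?m = "Lp_enorm M p g + Lp_enorm M p h"
  have "(\<integral>\<^sup>+x. epow (g x + h x) r \<partial>M) \<le> (\<integral>\<^sup>+x. ennreal (2 powr r) * (epow (g x) r + epow (h x) r) \<partial>M)"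
    using r by (intro nn_integral_mono epow_add_le) auto
  also have "\<dots> = ennreal (2 powr r) * ((\<integral>\<^sup>+x. epow (g x) r \<partial>M) + (\<integral>\<^sup>+x. epow (h x) r \<partial>M))"
    by (simp add: nn_integral_cmult nn_integral_add)
  also have "\<dots> = ennreal (2 powr r) * (epow (Lp_enorm M p g) r + epow (Lp_enorm M p h) r)"
    using assms(1) False by (simp add: r_def nn_integral_epow)
  also have "\<dots> \<le> ennreal (2 powr r) * (epow ?m r + epow ?m r)"
    using r by (intro mult_left_mono add_mono epow_mono) auto
  also have "\<dots> = ennreal (2 powr r * 2) * epow ?m r"
    by (simp add: mult_2[symmetric] ennreal_mult mult.assoc)
  also have "\<dots> \<le> ennreal (2 powr r * 2 powr r) * epow ?m r"
    using powr_mono[of 1 r 2] r by (intro mult_right_mono ennreal_leI) auto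
  also have "\<dots> = epow (ennreal 4 * ?m) r"
    using r epow_ennreal[of 4 r] powr_mult[of 2 2 r] by (simp add: epow_mult del: distrib_left_numeral)
  finally show ?thesis
    using assms(1) False by (subst Lp_enorm_le_iff) (auto simp: r_def)
qed

lemma Lp_enorm_cmult_le:
  assumes "1 \<le> p" and [measurable]: "g \<in> borel_measurable M" and "0 \<le> c"
  shows "Lp_enorm M p (\<lambda>x. ennreal c * g x) \<le> ennreal c * Lp_enorm M p g"
proof (cases "p = \<infinity>")
  case True
  have "AE x in M. ennreal c * g x \<le> ennreal c * Lp_enorm M \<infinity> g"
    using AE_le_Lp_enorm_infinity[of g M] by eventually_elim (auto intro: mult_left_mono)
  then show ?thesis unfolding True by (rule Lp_enorm_infinity_le)
next
  case False
  show ?thesis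
    using assms False one_le_enn2real[of p]
    by (subst Lp_enorm_le_iff) (auto simp: epow_mult nn_integral_cmult nn_integral_epow)
qed

text \<open>The tangent line at \<open>c\<close> to the convex function \<open>x \<mapsto> x\<^sup>r\<close> lies below its graph.\<close>

lemma epow_tangent:
  assumes "1 \<le> r" "0 < c"
  shows "ennreal (r * c powr (r - 1)) * x \<le> epow x r + ennreal ((r - 1) * c powr r)"
proof (cases x)
  case (real f)
  have "r * c powr (r - 1) * f \<le> f powr r + (r - 1) * c powr r"
  proof (cases "f = 0")
    case False
    then have "f > 0" using real by simp
    have "(f powr r) powr (1 / r) * (c powr r) powr (1 - 1 / r)
        \<le> (1 / r) * f powr r + (1 - 1 / r) * c powr r"
      using assms \<open>f > 0\<close> by (intro Youngs_inequality_0) (auto simp: field_simps)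
    moreover have "r * (1 - 1 / r) = r - 1"
      using assms by (simp add: field_simps)
    ultimately have "f * c powr (r - 1) \<le> (1 / r) * f powr r + (1 - 1 / r) * c powr r"
      using assms \<open>f > 0\<close> by (simp add: powr_powr)
    then have "r * (f * c powr (r - 1)) \<le> r * ((1 / r) * f powr r + (1 - 1 / r) * c powr r)"
      using assms by (intro mult_left_mono) auto
    also have "\<dots> = f powr r + (r * (1 - 1 / r)) * c powr r"
      using assms by (simp add: distrib_left)
    finally show ?thesis
      unfolding \<open>r * (1 - 1 / r) = r - 1\<close> by (simp add: mult_ac)
  qed (use assms in simp)
  then show ?thesis
    using real assms by (simp add: epow_ennreal flip: ennreal_mult ennreal_plus)
qed (simp add: epow_def)

text \<open>Jensen's inequality for a kernel of mass at most \<open>B\<close>: the tangent line inequality is integrated,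
  with the tangent at the mean value.\<close>

lemma epow_nn_integral_le:
  fixes \<kappa> F :: "'a \<Rightarrow> ennreal"
  assumes r: "1 \<le> r" and B: "0 < B"
    and [measurable]: "\<kappa> \<in> borel_measurable M" "F \<in> borel_measurable M"
    and mass: "(\<integral>\<^sup>+x. \<kappa> x \<partial>M) \<le> ennreal B"
  shows "epow (\<integral>\<^sup>+x. \<kappa> x * F x \<partial>M) r \<le> ennreal (B powr (r - 1)) * (\<integral>\<^sup>+x. \<kappa> x * epow (F x) r \<partial>M)"
proof (cases "(\<integral>\<^sup>+x. \<kappa> x * epow (F x) r \<partial>M)")
  case top
  then show ?thesis using B by (simp add: ennreal_mult_top)
next
  case (real J)
  have "(\<integral>\<^sup>+x. \<kappa> x * F x \<partial>M) \<le> (\<integral>\<^sup>+x. \<kappa> x * 1 + \<kappa> x * epow (F x) r \<partial>M)"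
  proof (rule nn_integral_mono)
    fix x
    have "F x \<le> 1 + epow (F x) r"
    proof (cases "F x \<le> 1")
      case True
      then show ?thesis by (simp add: add_increasing2)
    next
      case F: False
      have "F x \<le> epow (F x) r"
      proof (cases "F x")
        case (real f)
        then have "f powr 1 \<le> f powr r" using r F by (intro powr_mono) auto
        then show ?thesis using real F by (auto simp: epow_ennreal intro!: ennreal_leI)
      qed simp
      then show ?thesis by (simp add: add_increasing)
    qed
    then show "\<kappa> x * F x \<le> \<kappa> x * 1 + \<kappa> x * epow (F x) r"
      unfolding distrib_left[symmetric] by (rule mult_left_mono) simp
  qed
  also have "\<dots> = (\<integral>\<^sup>+x. \<kappa> x \<partial>M) + ennreal J"
    by (simp add: nn_integral_add real)
  also have "\<dots> < \<infinity>" using mass by (auto simp: less_top[symmetric] top_unique)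
  finally obtain I where I: "0 \<le> I" "(\<integral>\<^sup>+x. \<kappa> x * F x \<partial>M) = ennreal I"
    by (cases "\<integral>\<^sup>+x. \<kappa> x * F x \<partial>M") auto
  show ?thesis
  proof (cases "I = 0")
    case False
    \<comment> \<open>the mean value of \<open>F\<close>, if \<open>\<kappa>\<close> has the mass \<open>B\<close>\<close>
    define c where "c = I / B"
    have c: "0 < c" using I(1) B False by (simp add: c_def)
    have "ennreal (r * c powr (r - 1)) * ennreal I = (\<integral>\<^sup>+x. \<kappa> x * (ennreal (r * c powr (r - 1)) * F x) \<partial>M)"
      unfolding I(2)[symmetric]
      by (subst nn_integral_cmult[symmetric]) (auto intro!: nn_integral_cong simp: mult_ac)
    also have "\<dots> \<le> (\<integral>\<^sup>+x. \<kappa> x * (epow (F x) r + ennreal ((r - 1) * c powr r)) \<partial>M)"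
      by (intro nn_integral_mono mult_left_mono epow_tangent r c) auto
    also have "\<dots> = ennreal J + (\<integral>\<^sup>+x. \<kappa> x \<partial>M) * ennreal ((r - 1) * c powr r)"
      by (simp add: distrib_left nn_integral_add nn_integral_multc real)
    also have "\<dots> \<le> ennreal J + ennreal B * ennreal ((r - 1) * c powr r)"
      by (intro add_left_mono mult_right_mono mass) auto
    finally have "r * c powr (r - 1) * I \<le> J + B * ((r - 1) * c powr r)"
      using r I(1) real(1) B by (simp flip: ennreal_mult ennreal_plus)
    moreover have "c powr (r - 1) * I = B * c powr r"
      using c B by (simp add: powr_diff c_def field_simps)
    then have "r * c powr (r - 1) * I = r * (B * c powr r)"
      by (simp add: mult.assoc)
    moreover have "B * ((r - 1) * c powr r) = r * (B * c powr r) - B * c powr r"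
      by (simp add: algebra_simps)
    ultimately have "B * c powr r \<le> J" by linarith
    have "I powr r = (B * c) powr r" using B by (simp add: c_def)
    also have "\<dots> = B powr (r - 1) * (B * c powr r)"
      using B c by (simp add: powr_mult powr_diff)
    also have "\<dots> \<le> B powr (r - 1) * J"
      by (intro mult_left_mono) (use \<open>B * c powr r \<le> J\<close> in auto)
    finally show ?thesis
      using I real(1) by (simp add: real epow_ennreal flip: ennreal_mult)
  qed (simp add: I)
qed

text \<open>Jensen's inequality for the kernels \<open>k(x, \<cdot>)\<close> and Tonelli's theorem. Convolutions on the torus and
  banded matrices on \<open>\<ell>\<^sup>q\<close> are both special cases.\<close>

lemma Schur_test:
  fixes k :: "'a \<times> 'a \<Rightarrow> ennreal" and F :: "'a \<Rightarrow> ennreal"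
  assumes M: "sigma_finite_measure M" and p: "1 \<le> p" and B: "0 < B"
    and k [measurable]: "k \<in> borel_measurable (M \<Otimes>\<^sub>M M)" and [measurable]: "F \<in> borel_measurable M"
    and mass1: "AE x in M. (\<integral>\<^sup>+y. k (x, y) \<partial>M) \<le> ennreal B"
    and mass2: "AE y in M. (\<integral>\<^sup>+x. k (x, y) \<partial>M) \<le> ennreal B"
  shows "Lp_enorm M p (\<lambda>x. \<integral>\<^sup>+y. k (x, y) * F y \<partial>M) \<le> ennreal B * Lp_enorm M p F"
proof (cases "p = \<infinity>")
  case True
  have "AE x in M. (\<integral>\<^sup>+y. k (x, y) * F y \<partial>M) \<le> ennreal B * Lp_enorm M \<infinity> F"
    using mass1 AE_space
  proof eventually_elim
    case (elim x)
    have "(\<integral>\<^sup>+y. k (x, y) * F y \<partial>M) \<le> (\<integral>\<^sup>+y. k (x, y) * Lp_enorm M \<infinity> F \<partial>M)"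
      using AE_le_Lp_enorm_infinity[of F M]
      by (intro nn_integral_mono_AE) (auto elim!: eventually_mono intro: mult_left_mono)
    also have "\<dots> = (\<integral>\<^sup>+y. k (x, y) \<partial>M) * Lp_enorm M \<infinity> F"
      using elim(2) by (intro nn_integral_multc) auto
    finally show ?case
      by (rule order_trans) (intro mult_right_mono elim(1), simp)
  qed
  then show ?thesis unfolding True by (rule Lp_enorm_infinity_le)
next
  case False
  interpret sigma_finite_measure M by (rule M)
  interpret P: pair_sigma_finite M M ..
  define r where "r = enn2real p"
  have r: "1 \<le> r" using p False by (simp add: r_def one_le_enn2real)
  have "(\<integral>\<^sup>+x. epow (\<integral>\<^sup>+y. k (x, y) * F y \<partial>M) r \<partial>M)
      \<le> (\<integral>\<^sup>+x. ennreal (B powr (r - 1)) * (\<integral>\<^sup>+y. k (x, y) * epow (F y) r \<partial>M) \<partial>M)"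
  proof (rule nn_integral_mono_AE)
    show "AE x in M. epow (\<integral>\<^sup>+y. k (x, y) * F y \<partial>M) r
        \<le> ennreal (B powr (r - 1)) * (\<integral>\<^sup>+y. k (x, y) * epow (F y) r \<partial>M)"
      using mass1 AE_space
      by eventually_elim (intro epow_nn_integral_le r B, auto)
  qed
  also have "\<dots> = ennreal (B powr (r - 1)) * (\<integral>\<^sup>+x. (\<integral>\<^sup>+y. k (x, y) * epow (F y) r \<partial>M) \<partial>M)"
    by (rule nn_integral_cmult) measurable
  also have "(\<integral>\<^sup>+x. (\<integral>\<^sup>+y. k (x, y) * epow (F y) r \<partial>M) \<partial>M) = (\<integral>\<^sup>+y. (\<integral>\<^sup>+x. k (x, y) * epow (F y) r \<partial>M) \<partial>M)"
    by (rule P.Fubini'[symmetric]) measurable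
  also have "\<dots> = (\<integral>\<^sup>+y. (\<integral>\<^sup>+x. k (x, y) \<partial>M) * epow (F y) r \<partial>M)"
    by (intro nn_integral_cong nn_integral_multc) measurable
  also have "\<dots> \<le> (\<integral>\<^sup>+y. ennreal B * epow (F y) r \<partial>M)"
    using mass2 by (intro nn_integral_mono_AE) (auto elim!: eventually_mono intro: mult_right_mono)
  also have "\<dots> = ennreal B * epow (Lp_enorm M p F) r"
    using p False by (simp add: nn_integral_cmult nn_integral_epow r_def)
  also have "ennreal (B powr (r - 1)) * (ennreal B * epow (Lp_enorm M p F) r) = epow (ennreal B * Lp_enorm M p F) r"
    using r B by (simp add: epow_mult epow_ennreal powr_diff flip: mult.assoc ennreal_mult)
  finally show ?thesis
    using p False by (subst Lp_enorm_le_iff) (auto simp: r_def mult_left_mono)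
qed

text \<open>A sequence that is dominated by the sums of another one over windows of bounded length: this
  is the Schur test for a banded matrix.\<close>

lemma Lp_enorm_window_le:
  fixes x y :: "nat \<Rightarrow> ennreal"
  assumes "1 \<le> q" "0 < C" and le: "\<And>j. y j \<le> ennreal C * (\<Sum>l\<in>{j-2..j+2}. x l)"
  shows "Lp_enorm (count_space UNIV) q y \<le> ennreal (5 * C) * Lp_enorm (count_space UNIV) q x"
proof -
  define k :: "nat \<times> nat \<Rightarrow> ennreal" where
    "k = (\<lambda>(j, l). if l \<in> {j-2..j+2} then ennreal C else 0)"
  have card: "card {i - 2..i + 2} \<le> 5" for i :: nat by simp
  have sum_k: "(\<integral>\<^sup>+l. k (j, l) * z l \<partial>count_space UNIV) = ennreal C * (\<Sum>l\<in>{j-2..j+2}. z l)" for j z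
  proof -
    have "(\<integral>\<^sup>+l. k (j, l) * z l \<partial>count_space UNIV) = (\<Sum>l\<in>{j-2..j+2}. k (j, l) * z l)"
      by (intro nn_integral_count_space'[symmetric, THEN sym]) (auto simp: k_def)
    also have "\<dots> = (\<Sum>l\<in>{j-2..j+2}. ennreal C * z l)"
      by (intro sum.cong) (auto simp: k_def)
    finally show ?thesis by (simp only: sum_distrib_left)
  qed
  have k_sym: "k (j, l) = k (l, j)" for j l by (auto simp: k_def)
  have mass: "(\<integral>\<^sup>+l. k (j, l) \<partial>count_space UNIV) \<le> ennreal (5 * C)" for j
  proof -
    have "(\<integral>\<^sup>+l. k (j, l) \<partial>count_space UNIV) = ennreal C * (\<Sum>l\<in>{j-2..j+2}. 1)"
      using sum_k[of j "\<lambda>_. 1"] by simp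
    also have "\<dots> = ennreal C * of_nat (card {j-2..j+2})" by simp
    also have "\<dots> \<le> ennreal C * of_nat 5"
      by (intro mult_left_mono of_nat_mono card) auto
    also have "\<dots> = ennreal (5 * C)"
      using assms(2) by (simp add: ennreal_mult mult.commute)
    finally show ?thesis .
  qed
  have "Lp_enorm (count_space UNIV) q y
      \<le> Lp_enorm (count_space UNIV) q (\<lambda>j. \<integral>\<^sup>+l. k (j, l) * x l \<partial>count_space UNIV)"
    by (intro Lp_enorm_mono_AE AE_I2) (simp only: sum_k le)
  also have "\<dots> \<le> ennreal (5 * C) * Lp_enorm (count_space UNIV) q x"
    using assms mass mass[unfolded k_sym]
    by (intro Schur_test sigma_finite_measure_count_space)
      (auto simp: pair_measure_countable)
  finally show ?thesis .
qed

section \<open>Complex scalar multiplication\<close>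

lemma scaleC_zero_left [simp]: "0 *\<^sub>C x = 0"
  using scaleC_add_left[of 0 0 x] by simp

lemma scaleC_zero_right [simp]: "c *\<^sub>C 0 = 0"
  using scaleC_add_right[of c 0 0] by simp

lemma scaleC_minus_left [simp]: "(- c) *\<^sub>C x = - (c *\<^sub>C x)"
  using scaleC_add_left[of c "- c" x] by (simp add: eq_neg_iff_add_eq_0 add.commute)

lemma scaleC_minus_right [simp]: "c *\<^sub>C (- x) = - (c *\<^sub>C x)"
  using scaleC_add_right[of c x "- x"] by (simp add: eq_neg_iff_add_eq_0 add.commute)

lemma scaleC_diff_left: "(c - d) *\<^sub>C x = c *\<^sub>C x - d *\<^sub>C x"
  using scaleC_add_left[of c "- d" x] by simp

lemma scaleC_diff_right: "c *\<^sub>C (x - y) = c *\<^sub>C x - c *\<^sub>C y"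
  using scaleC_add_right[of c x "- y"] by simp

lemma scaleC_sum_right: "c *\<^sub>C (\<Sum>k\<in>A. f k) = (\<Sum>k\<in>A. c *\<^sub>C f k)"
  by (induction A rule: infinite_finite_induct) (simp_all add: scaleC_add_right)

lemma scaleC_sum_left: "(\<Sum>k\<in>A. f k) *\<^sub>C x = (\<Sum>k\<in>A. f k *\<^sub>C x)"
  by (induction A rule: infinite_finite_induct) (simp_all add: scaleC_add_left)

lemma bounded_linear_scaleC_left: "bounded_linear (\<lambda>c. c *\<^sub>C (x::'a::complex_normed_vector))"
proof (rule bounded_linear_intro[where K = "norm x"])
  show "(c + d) *\<^sub>C x = c *\<^sub>C x + d *\<^sub>C x" for c d by (rule scaleC_add_left)
  show "(r *\<^sub>R c) *\<^sub>C x = r *\<^sub>R (c *\<^sub>C x)" for r c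
    by (simp add: scaleR_scaleC scaleC_scaleC scaleC_complex_def)
  show "norm (c *\<^sub>C x) \<le> norm c * norm x" for c by (simp add: norm_scaleC)
qed

lemma clinear_onD_add: "clinear_on X T \<Longrightarrow> x \<in> X \<Longrightarrow> y \<in> X \<Longrightarrow> T (x + y) = T x + T y"
  and clinear_onD_scaleC: "clinear_on X T \<Longrightarrow> x \<in> X \<Longrightarrow> T (c *\<^sub>C x) = c *\<^sub>C T x"
  by (simp_all add: clinear_on_def)

instance blinfun :: (real_normed_vector, complex_normed_vector) complex_normed_vector
proof
  fix r and c and T :: "'a \<Rightarrow>\<^sub>L 'b"
  show "r *\<^sub>R T = complex_of_real r *\<^sub>C T"
    by transfer (simp add: fun_eq_iff scaleR_scaleC)
  have *: "norm (c *\<^sub>C T) \<le> cmod c * norm T" for c and T :: "'a \<Rightarrow>\<^sub>L 'b"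
  proof (rule norm_blinfun_bound)
    show "norm (blinfun_apply (c *\<^sub>C T) x) \<le> cmod c * norm T * norm x" for x
      using norm_blinfun[of T x]
      by (simp add: scaleC_blinfun.rep_eq norm_scaleC mult.assoc mult_left_mono)
  qed simp
  show "norm (c *\<^sub>C T) = cmod c * norm T"
  proof (cases "c = 0")
    case False
    have "norm T = norm (inverse c *\<^sub>C c *\<^sub>C T)"
      using False by (simp add: scaleC_scaleC scaleC_one)
    also have "\<dots> \<le> inverse (cmod c) * norm (c *\<^sub>C T)"
      using *[of "inverse c" "c *\<^sub>C T"] by (simp add: norm_inverse)
    finally have "cmod c * norm T \<le> norm (c *\<^sub>C T)"
      using False by (simp add: field_simps)
    then show ?thesis using *[of c T] by simp
  qed simp
qed


section \<open>Finite differences\<close>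

definition shift_diff :: "'a::ab_group_add \<Rightarrow> ('a \<Rightarrow> 'b::ab_group_add) \<Rightarrow> 'a \<Rightarrow> 'b" where
  "shift_diff h f = (\<lambda>x. f (x + h) - f x)"

lemma diff_op_eq_shift_diff: "diff_op j = shift_diff (axis j 1)"
  by (simp add: diff_op_def shift_diff_def fun_eq_iff)

lemma funpow_Suc_apply: "(D ^^ Suc N) f = (D ^^ N) (D f)"
  by (simp add: funpow_Suc_right del: funpow.simps)

lemma shift_diff_funpow_eq_0:
  assumes "\<And>i. i \<le> N \<Longrightarrow> f (((\<lambda>y. y + h) ^^ i) x) = 0"
  shows "(shift_diff h ^^ N) f x = 0"
  using assms
proof (induction N arbitrary: f)
  case (Suc N)
  have "(shift_diff h ^^ N) (shift_diff h f) x = 0"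
  proof (rule Suc.IH)
    fix i assume "i \<le> N"
    then show "shift_diff h f (((\<lambda>y. y + h) ^^ i) x) = 0"
      using Suc.prems[of i] Suc.prems[of "Suc i"] by (simp add: shift_diff_def)
  qed
  then show ?case by (simp only: funpow_Suc_apply)
qed simp

lemma shift_diff_funpow_shift:
  "(shift_diff h ^^ N) (\<lambda>x. f (x + c)) = (\<lambda>x. (shift_diff h ^^ N) f (x + c))"
  by (induction N) (simp_all add: shift_diff_def fun_eq_iff add_ac)

lemma shift_diff_funpow_add:
  "(shift_diff h ^^ N) (\<lambda>x. f x + g x) = (\<lambda>x. (shift_diff h ^^ N) f x + (shift_diff h ^^ N) g x)"
  by (induction N) (simp_all add: shift_diff_def fun_eq_iff)

text \<open>A Leibniz rule for bounds that scale like \<open>t\<^sup>i\<close>. In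
  \<open>\<Delta>(fg)(y) = f(y + h) \<Delta>g(y) + \<Delta>f(y) g(y)\<close> all shifts fall on the factor \<open>f\<close>, so that bounds
  for the differences of \<open>g\<close> are used at the point \<open>x\<close> only.\<close>

lemma norm_shift_diff_scaleC_le:
  fixes f :: "'a::ab_group_add \<Rightarrow> complex" and g :: "'a \<Rightarrow> 'b::complex_normed_vector"
  assumes "\<And>i y. i \<le> N \<Longrightarrow> norm ((shift_diff h ^^ i) f y) \<le> A * t ^ i"
    and "\<And>i. i \<le> N \<Longrightarrow> norm ((shift_diff h ^^ i) g x) \<le> B * t ^ i"
    and "0 \<le> A"
  shows "norm ((shift_diff h ^^ N) (\<lambda>y. f y *\<^sub>C g y) x) \<le> A * B * (2 * t) ^ N"
  using assms
proof (induction N arbitrary: f g A B)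
  case 0
  have "norm (f x *\<^sub>C g x) \<le> A * B"
    using "0.prems"(1)[of 0 x] "0.prems"(2)[of 0] "0.prems"(3)
    by (simp add: norm_scaleC mult_mono)
  then show ?case by simp
next
  case (Suc N)
  have t: "0 \<le> A * t"
    using order_trans[OF norm_ge_zero Suc.prems(1)[of 1 x]] by simp
  have split: "shift_diff h (\<lambda>y. f y *\<^sub>C g y)
      = (\<lambda>y. f (y + h) *\<^sub>C shift_diff h g y + shift_diff h f y *\<^sub>C g y)"
    by (simp add: shift_diff_def fun_eq_iff scaleC_diff_left scaleC_diff_right)
  have "norm ((shift_diff h ^^ N) (\<lambda>y. f (y + h) *\<^sub>C shift_diff h g y) x) \<le> A * (B * t) * (2 * t) ^ N"
  proof (rule Suc.IH)
    show "norm ((shift_diff h ^^ i) (\<lambda>y. f (y + h)) y) \<le> A * t ^ i" if "i \<le> N" for i y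
      using Suc.prems(1)[of i "y + h"] that by (simp add: shift_diff_funpow_shift)
    show "norm ((shift_diff h ^^ i) (shift_diff h g) x) \<le> B * t * t ^ i" if "i \<le> N" for i
      using Suc.prems(2)[of "Suc i"] that
      by (simp only: funpow_Suc_apply) (simp add: mult_ac)
  qed (rule Suc.prems)
  moreover have "norm ((shift_diff h ^^ N) (\<lambda>y. shift_diff h f y *\<^sub>C g y) x) \<le> (A * t) * B * (2 * t) ^ N"
  proof (rule Suc.IH)
    show "norm ((shift_diff h ^^ i) (shift_diff h f) y) \<le> A * t * t ^ i" if "i \<le> N" for i y
      using Suc.prems(1)[of "Suc i" y] that
      by (simp only: funpow_Suc_apply) (simp add: mult_ac)
  qed (use Suc.prems t in auto)
  ultimately have "norm ((shift_diff h ^^ Suc N) (\<lambda>y. f y *\<^sub>C g y) x)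
      \<le> A * (B * t) * (2 * t) ^ N + (A * t) * B * (2 * t) ^ N"
    unfolding funpow_Suc_apply split shift_diff_funpow_add by (rule norm_triangle_mono)
  then show ?case by (simp add: algebra_simps)
qed

lemma partial_shift_diff:
  assumes "\<And>x. f differentiable at x"
  shows "partial l (shift_diff h f) = shift_diff h (partial l f)"
proof
  fix x
  obtain f' where f: "(f has_derivative f') (at x)"
    using assms unfolding differentiable_def by blast
  obtain g' where g: "(f has_derivative g') (at (x + h))"
    using assms unfolding differentiable_def by blast
  have "((\<lambda>y. y + h) has_derivative (\<lambda>y. y)) (at x)"
    by (auto intro!: derivative_eq_intros)
  from has_derivative_compose[OF this g]
  have "(shift_diff h f has_derivative (\<lambda>y. g' y - f' y)) (at x)"
    unfolding shift_diff_def using has_derivative_diff[OF _ f] by blast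
  then show "partial l (shift_diff h f) x = shift_diff h (partial l f) x"
    using partial_eq f g by (metis (no_types, lifting) shift_diff_def)
qed

lemma differentiable_shift_diff:
  assumes "\<And>x. f differentiable at x"
  shows "shift_diff h f differentiable at x"
proof -
  obtain g' where g: "(f has_derivative g') (at (x + h))"
    using assms unfolding differentiable_def by blast
  have "((\<lambda>y. y + h) has_derivative (\<lambda>y. y)) (at x)"
    by (auto intro!: derivative_eq_intros)
  from has_derivative_compose[OF this g] have "(\<lambda>x. f (x + h)) differentiable at x"
    by (auto simp: differentiable_def)
  then show ?thesis
    unfolding shift_diff_def using assms by (intro differentiable_diff)
qed

lemma partial_funpow_shift_diff:
  assumes "\<And>i x. i < N \<Longrightarrow> (partial l ^^ i) f differentiable at x"
  shows "(partial l ^^ N) (shift_diff h f) = shift_diff h ((partial l ^^ N) f)"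
  using assms by (induction N) (simp_all add: partial_shift_diff)

lemma norm_shift_diff_le_partial:
  fixes f :: "real ^ 'n::finite \<Rightarrow> 'b::real_normed_vector"
  assumes f: "\<And>x. f differentiable at x" and B: "\<And>x. norm (partial l f x) \<le> B" and t: "0 \<le> t"
  shows "norm (shift_diff (t *\<^sub>R axis l 1) f x) \<le> t * B"
proof -
  have "((\<lambda>s. f (x + s *\<^sub>R axis l 1)) has_derivative (\<lambda>u. u *\<^sub>R partial l f (x + s *\<^sub>R axis l 1)))
      (at s within {0..t})" for s
  proof -
    obtain f' where f': "(f has_derivative f') (at (x + s *\<^sub>R axis l 1))"
      using f unfolding differentiable_def by blast
    have "((\<lambda>s. x + s *\<^sub>R axis l 1) has_derivative (\<lambda>u. u *\<^sub>R axis l 1)) (at s within {0..t})"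
      by (auto intro!: derivative_eq_intros)
    from has_derivative_compose[OF this f'] show ?thesis
      using has_derivative_linear[OF f'] by (simp add: partial_eq[OF f'] linear_cmul)
  qed
  then have "norm (f (x + t *\<^sub>R axis l 1) - f (x + 0 *\<^sub>R axis l 1)) \<le> B * norm (t - 0)"
  proof (rule differentiable_bound[rotated])
    show "onorm (\<lambda>u. u *\<^sub>R partial l f (x + s *\<^sub>R axis l 1)) \<le> B" for s
      using B[of "x + s *\<^sub>R axis l 1"] 
      by (intro onorm_le) (simp add: mult.commute[of B] mult_left_mono)
  qed (use t in auto)
  then show ?thesis
    using t by (simp add: shift_diff_def mult.commute)
qed

text \<open>Differences with step \<open>t\<close> behave like \<open>t\<close> times a derivative, to all orders.\<close>

lemma norm_shift_diff_funpow_le_partial: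
  fixes f :: "real ^ 'n::finite \<Rightarrow> 'b::real_normed_vector"
  assumes "\<And>i x. i < N \<Longrightarrow> (partial l ^^ i) f differentiable at x"
    and "\<And>x. norm ((partial l ^^ N) f x) \<le> B" and "0 \<le> t"
  shows "norm ((shift_diff (t *\<^sub>R axis l 1) ^^ N) f x) \<le> t ^ N * B"
  using assms
proof (induction N arbitrary: f B)
  case (Suc N)
  let ?h = "t *\<^sub>R axis l 1 :: real ^ 'n"
  have eq: "(partial l ^^ i) (shift_diff ?h f) = shift_diff ?h ((partial l ^^ i) f)" if "i \<le> N" for i
    using that Suc.prems(1) by (intro partial_funpow_shift_diff) auto
  have "norm ((shift_diff ?h ^^ N) (shift_diff ?h f) x) \<le> t ^ N * (t * B)"
  proof (rule Suc.IH)
    show "(partial l ^^ i) (shift_diff ?h f) differentiable at x" if "i < N" for i x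
      using that Suc.prems(1) by (subst eq) (auto intro!: differentiable_shift_diff)
    show "norm ((partial l ^^ N) (shift_diff ?h f) x) \<le> t * B" for x
      using Suc.prems by (subst eq) (auto intro!: norm_shift_diff_le_partial)
  qed (rule Suc.prems)
  then show ?case
    by (simp only: funpow_Suc_apply) (simp add: mult_ac)
qed simp

lemma smooth_partial_funpow: "smooth f \<Longrightarrow> (partial l ^^ i) f differentiable at x"
proof -
  have "foldr partial (replicate i l) f = (partial l ^^ i) f"
    by (induction i) simp_all
  then show "smooth f \<Longrightarrow> (partial l ^^ i) f differentiable at x"
    unfolding smooth_def by metis
qed

lemma mi_power_axis: "mi_power D (axis l N) = D l ^^ N"
proof -
  have "distinct js \<Longrightarrow> foldr (\<lambda>j. D j ^^ (axis l N $ j)) js = (if l \<in> set js then D l ^^ N else id)" for js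
    by (induction js) (auto simp: axis_def fun_eq_iff)
  then show ?thesis by (simp add: mi_power_def coords)
qed

lemma mi_abs_axis: "mi_abs (axis l N) = N"
  by (simp add: mi_abs_def axis_def if_distrib cong: if_cong)

lemma jap_ge_1: "1 \<le> jap x"
  by (simp add: jap_def)

lemma jap_pos: "0 < jap x"
  using jap_ge_1[of x] by linarith

lemma norm_le_jap: "norm x \<le> jap x"
  by (simp add: jap_def real_le_rsqrt)

lemma jap_le: "jap x \<le> 1 + norm x"
  unfolding jap_def by (rule real_le_lsqrt) (auto simp: power2_eq_square algebra_simps)

text \<open>A crude form of Peetre's inequality.\<close>

lemma jap_add_le: "jap (x + y) \<le> 2 * jap x * (1 + norm y)"
proof -
  have "jap (x + y) \<le> 1 + (norm x + norm y)"
    using jap_le[of "x + y"] norm_triangle_ineq[of x y] by linarith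
  also have "\<dots> \<le> jap x + jap x + jap x * norm y"
    using jap_ge_1[of x] norm_le_jap[of x] mult_right_mono[OF jap_ge_1[of x], of "norm y"] by simp
  also have "\<dots> \<le> 2 * jap x * (1 + norm y)"
    using jap_pos[of x] by (simp add: algebra_simps)
  finally show ?thesis .
qed

section \<open>Integration over the torus\<close>

definition cube :: "(real ^ 'n::finite) set" where
  "cube = cbox 0 (\<chi> j. 2 * pi)"

lemma mem_cube: "x \<in> cube \<longleftrightarrow> (\<forall>j. 0 \<le> x $ j \<and> x $ j \<le> 2 * pi)"
  by (simp add: cube_def mem_box_cart)

lemma emeasure_cube: "emeasure lborel (cube :: (real ^ 'n::finite) set) = ennreal ((2 * pi) ^ CARD('n))"
proof -
  have "emeasure lborel (cube :: (real ^ 'n) set) = (\<Prod>b\<in>Basis. ((\<chi> j. 2 * pi) - 0) \<bullet> (b :: real ^ 'n))"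
    unfolding cube_def by (rule emeasure_lborel_cbox) (auto simp: Basis_vec_def inner_axis)
  also have "\<dots> = (\<Prod>b\<in>(Basis :: (real ^ 'n) set). 2 * pi)"
    by (intro arg_cong[where f = ennreal] prod.cong) (auto simp: Basis_vec_def inner_axis)
  finally show ?thesis by simp
qed

lemma torus_eq_density:
  "(torus :: (real ^ 'n::finite) measure)
    = density lborel (\<lambda>x. ennreal (indicator cube x / (2 * pi) ^ CARD('n)))"
  unfolding torus_def uniform_measure_def cube_def[symmetric] emeasure_cube
  by (intro arg_cong[where f = "density lborel"] ext)
    (simp add: divide_ennreal ennreal_indicator[symmetric] split: split_indicator)

lemma space_torus [simp]: "space torus = UNIV"
  by (simp add: torus_eq_density)

lemma sets_torus [simp, measurable_cong]: "sets torus = sets borel"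
  by (simp add: torus_eq_density)

lemma emeasure_torus: "emeasure (torus :: (real ^ 'n::finite) measure) UNIV = 1"
proof -
  have "emeasure (torus :: (real ^ 'n) measure) UNIV = emeasure lborel (cube :: (real ^ 'n) set) / emeasure lborel (cube :: (real ^ 'n) set)"
    unfolding torus_def cube_def[symmetric] by (subst emeasure_uniform_measure) (auto simp: cube_def)
  then show ?thesis by (simp add: emeasure_cube divide_ennreal)
qed

lemma finite_measure_torus: "finite_measure torus"
  by standard (simp add: emeasure_torus)

lemma measure_torus: "measure torus UNIV = 1"
  by (simp add: measure_def emeasure_torus)

lemma AE_torus_cube: "AE x in torus. x \<in> cube"
  unfolding torus_def cube_def by (rule AE_uniform_measureI) auto

text \<open>The normalizing factor \<open>(2\<pi>)\<^sup>-\<^sup>n\<close> is at most \<open>1\<close> and is dropped from estimates.\<close>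

lemma nn_integral_torus_le:
  assumes [measurable]: "f \<in> borel_measurable borel"
  shows "(\<integral>\<^sup>+x. f x \<partial>torus) \<le> (\<integral>\<^sup>+x. f x * indicator cube x \<partial>(lborel :: (real ^ 'n::finite) measure))"
proof -
  have pi: "1 \<le> (2 * pi) ^ CARD('n)"
    using pi_ge_two by (intro one_le_power) simp
  have "(\<integral>\<^sup>+x. f x \<partial>torus) = (\<integral>\<^sup>+x. ennreal (indicator cube x / (2 * pi) ^ CARD('n)) * f x \<partial>lborel)"
    unfolding torus_eq_density by (rule nn_integral_density) (auto simp: cube_def)
  also have "\<dots> \<le> (\<integral>\<^sup>+x. f x * indicator cube x \<partial>lborel)"
  proof (rule nn_integral_mono)
    fix x :: "real ^ 'n"
    have "indicator cube x / (2 * pi) ^ CARD('n) \<le> (indicator cube x :: real)"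
      using pi by (auto simp: divide_le_eq split: split_indicator)
    from mult_right_mono[OF ennreal_leI[OF this], of "f x"]
    show "ennreal (indicator cube x / (2 * pi) ^ CARD('n)) * f x \<le> f x * indicator cube x"
      by (simp add: ennreal_indicator mult.commute)
  qed
  finally show ?thesis .
qed

lemma integral_torus:
  fixes f :: "real ^ 'n::finite \<Rightarrow> 'b::{banach, second_countable_topology}"
  assumes [measurable]: "f \<in> borel_measurable borel"
  shows "integral\<^sup>L torus f = (1 / (2 * pi) ^ CARD('n)) *\<^sub>R (\<integral>x. indicator cube x *\<^sub>R f x \<partial>lborel)"
proof -
  have "integral\<^sup>L torus f = (\<integral>x. (indicator cube x / (2 * pi) ^ CARD('n)) *\<^sub>R f x \<partial>lborel)"
    unfolding torus_eq_density by (rule integral_density) (auto simp: cube_def)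
  also have "\<dots> = (\<integral>x. (1 / (2 * pi) ^ CARD('n)) *\<^sub>R (indicator cube x *\<^sub>R f x) \<partial>lborel)"
    by (intro Bochner_Integration.integral_cong) auto
  finally show ?thesis by (simp only: integral_scaleR_right)
qed

lemma integrable_torus:
  fixes f :: "real ^ 'n::finite \<Rightarrow> 'b::{banach, second_countable_topology}"
  assumes "continuous_on UNIV f"
  shows "integrable torus f"
proof -
  have "compact (f ` cube)"
    unfolding cube_def by (intro compact_continuous_image continuous_on_subset[OF assms]) auto
  then obtain B where "\<And>x. x \<in> cube \<Longrightarrow> norm (f x) \<le> B"
    by (metis bounded_iff compact_imp_bounded imageI)
  then show ?thesis
    using AE_torus_cube borel_measurable_continuous_onI[OF assms]
    by (intro finite_measure.integrable_const_bound[OF finite_measure_torus, of f B])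
      (auto elim: eventually_mono)
qed

lemma norm_integral_torus_le:
  fixes f :: "real ^ 'n::finite \<Rightarrow> 'b::{banach, second_countable_topology}"
  assumes "continuous_on UNIV f" "\<And>x. norm (f x) \<le> B"
  shows "norm (integral\<^sup>L torus f) \<le> B"
proof -
  have "norm (integral\<^sup>L torus f) \<le> (\<integral>x. norm (f x) \<partial>torus)"
    by (rule integral_norm_bound)
  also have "\<dots> \<le> (\<integral>x. B \<partial>(torus :: (real ^ 'n) measure))"
    using assms by (intro integral_mono integrable_torus continuous_intros) auto
  finally show ?thesis by (simp add: measure_torus)
qed

lemma periodic_shift_int:
  assumes "periodic f"
  shows "f (x + (2 * pi * real_of_int i) *\<^sub>R axis j 1) = f x"
proof (induction i rule: int_induct[where k = 0])
  case (step1 i)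
  have "f (x + (2 * pi * real_of_int (i + 1)) *\<^sub>R axis j 1)
      = f ((x + (2 * pi * real_of_int i) *\<^sub>R axis j 1) + (2 * pi) *\<^sub>R axis j 1)"
    by (simp add: algebra_simps)
  then show ?case using assms step1 by (simp only: periodic_def)
next
  case (step2 i)
  have "f (x + (2 * pi * real_of_int (i - 1)) *\<^sub>R axis j 1)
      = f ((x + (2 * pi * real_of_int (i - 1)) *\<^sub>R axis j 1) + (2 * pi) *\<^sub>R axis j 1)"
    using assms by (simp only: periodic_def)
  then show ?case using step2 by (simp add: algebra_simps)
qed simp

lemma periodic_cube:
  assumes "periodic f"
  shows "\<exists>y\<in>cube. f y = f x"
proof -
  have "\<exists>y. f y = f x \<and> (\<forall>j\<in>J. 0 \<le> y $ j \<and> y $ j \<le> 2 * pi)" if "finite J" for J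
    using that
  proof (induction J)
    case (insert i J)
    then obtain y where y: "f y = f x" "\<forall>j\<in>J. 0 \<le> y $ j \<and> y $ j \<le> 2 * pi" by blast
    define z where "z = y + (2 * pi * real_of_int (- \<lfloor>y $ i / (2 * pi)\<rfloor>)) *\<^sub>R axis i 1"
    have "f z = f x" unfolding z_def periodic_shift_int[OF assms] by (rule y(1))
    moreover have "0 \<le> z $ i" "z $ i \<le> 2 * pi"
      using floor_divide_lower[of "2 * pi" "y $ i"] floor_divide_upper[of "2 * pi" "y $ i"]
      by (simp_all add: z_def algebra_simps)
    moreover have "z $ j = y $ j" if "j \<in> J" for j
      using that insert.hyps by (auto simp: z_def axis_def)
    ultimately show ?case using y(2) by (intro exI[of _ z]) auto
  qed auto
  from this[of UNIV] show ?thesis by (auto simp: mem_cube)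
qed

text \<open>Bounds the derivatives of test functions, so that the suprema in \<open>test_seminorm\<close> are genuine.\<close>

lemma periodic_bounded:
  fixes f :: "real ^ 'n::finite \<Rightarrow> 'b::real_normed_vector"
  assumes "periodic f" "continuous_on UNIV f"
  shows "bdd_above (range (\<lambda>x. norm (f x)))"
proof -
  have "compact (f ` cube)"
    unfolding cube_def by (intro compact_continuous_image continuous_on_subset[OF assms(2)]) auto
  then obtain B where "\<And>x. x \<in> cube \<Longrightarrow> norm (f x) \<le> B"
    by (metis bounded_iff compact_imp_bounded imageI)
  then show ?thesis
    using periodic_cube[OF assms(1)] by (intro bdd_aboveI[of _ B]) (metis imageE)
qed

lemma periodic_partial_funpow: "periodic f \<Longrightarrow> periodic ((partial l ^^ i) f)"
proof (induction i)
  case (Suc i)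
  let ?g = "(partial l ^^ i) f"
  have "?g (x + (2 * pi) *\<^sub>R axis j 1 + t *\<^sub>R axis l 1) = ?g (x + t *\<^sub>R axis l 1)" for x j t
  proof -
    have "x + (2 * pi) *\<^sub>R axis j 1 + t *\<^sub>R axis l 1 = (x + t *\<^sub>R axis l 1) + (2 * pi) *\<^sub>R axis j 1"
      by (simp add: algebra_simps)
    moreover have "periodic ?g" using Suc by simp
    ultimately show ?thesis by (simp only: periodic_def)
  qed
  then have "periodic (partial l ?g)" by (simp add: periodic_def partial_def)
  then show ?case by simp
qed simp

lemma continuous_on_differentiable: "(\<And>x. f differentiable at x) \<Longrightarrow> continuous_on UNIV f"
  by (simp add: continuous_on_eq_continuous_at differentiable_imp_continuous_within)

lemma lborel_integral_shift:
  fixes f :: "'a::euclidean_space \<Rightarrow> 'b::{banach, second_countable_topology}"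
  assumes [measurable]: "f \<in> borel_measurable borel"
  shows "(\<integral>x. f (x + c) \<partial>lborel) = (\<integral>x. f x \<partial>lborel)"
proof -
  have "(\<integral>x. f x \<partial>lborel) = (\<integral>x. f x \<partial>(distr lborel borel ((+) c)))"
    by (simp only: lborel_distr_plus)
  also have "\<dots> = (\<integral>x. f (c + x) \<partial>lborel)"
    by (rule integral_distr) auto
  finally show ?thesis by (simp add: add.commute)
qed

text \<open>Translating the fundamental cube along a coordinate direction moves a slab out of it on one
  side and in on the other side; periodicity identifies the two slabs.\<close>

lemma integral_torus_shift:
  fixes f :: "real ^ 'n::finite \<Rightarrow> complex"
  assumes f: "continuous_on UNIV f" "periodic f" and t: "0 \<le> t" "t \<le> 2 * pi"
  shows "(\<integral>x. f (x + t *\<^sub>R axis l 1) \<partial>torus) = integral\<^sup>L torus f"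
proof -
  note [measurable] = borel_measurable_continuous_onI[OF f(1)]
  define S :: "real \<Rightarrow> real \<Rightarrow> (real ^ 'n) set" where
    "S = (\<lambda>a b. {x. (\<forall>j. j \<noteq> l \<longrightarrow> 0 \<le> x $ j \<and> x $ j \<le> 2 * pi) \<and> a \<le> x $ l \<and> x $ l < b})"
  have S [measurable]: "S a b \<in> sets borel" for a b unfolding S_def by measurable
  let ?I = "\<lambda>a b g. \<integral>x. indicator (S a b) x *\<^sub>R (g x :: complex) \<partial>lborel"
  have int: "integrable lborel (\<lambda>x. indicator (S a b) x *\<^sub>R f x)" for a b
  proof -
    let ?C = "cbox (\<chi> j. if j = l then a else 0) (\<chi> j. if j = l then b else 2 * pi) :: (real ^ 'n) set"
    have "set_integrable lborel ?C f"
      unfolding set_integrable_def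
      by (intro borel_integrable_compact compact_cbox continuous_on_subset[OF f(1)]) auto
    moreover have "S a b \<subseteq> ?C"
      by (auto simp: S_def mem_box_cart)
    ultimately show ?thesis
      using set_integrable_subset[of lborel ?C f "S a b"] by (simp add: set_integrable_def)
  qed
  have shift: "?I a b (\<lambda>x. f (x + c *\<^sub>R axis l 1)) = ?I (a + c) (b + c) f" for a b c
  proof -
    have "indicator (S a b) x = (indicator (S (a + c) (b + c)) (x + c *\<^sub>R axis l 1) :: real)" for x
      by (simp add: indicator_def S_def axis_def)
    then show ?thesis
      using lborel_integral_shift[of "\<lambda>x. indicator (S (a + c) (b + c)) x *\<^sub>R f x" "c *\<^sub>R axis l 1"]
      by simp
  qed
  have split: "?I a c f = ?I a b f + ?I b c f" if "a \<le> b" "b \<le> c" for a b c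
    using that by (subst Bochner_Integration.integral_add[symmetric, OF int int])
      (auto intro!: Bochner_Integration.integral_cong simp: S_def split: split_indicator)
  have cube: "(\<integral>x. indicator cube x *\<^sub>R g x \<partial>lborel) = ?I 0 (2 * pi) g"
    if [measurable]: "g \<in> borel_measurable borel" for g :: "real ^ 'n \<Rightarrow> complex"
  proof (rule integral_cong_AE)
    have "{x :: real ^ 'n. x $ l = 2 * pi} \<in> null_sets lborel"
      using negligible_standard_hyperplane[of "axis l 1 :: real ^ 'n" "2 * pi"]
      by (subst null_sets_completion_iff[symmetric])
        (auto simp: negligible_iff_null_sets inner_axis Basis_vec_def)
    then have "AE x in lborel. x \<notin> {x :: real ^ 'n. x $ l = 2 * pi}"
      by (rule AE_not_in)
    then show "AE x in lborel. indicator cube x *\<^sub>R g x = indicator (S 0 (2 * pi)) x *\<^sub>R g x"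
      by eventually_elim (auto simp: S_def mem_cube order.order_iff_strict split: split_indicator)
  qed (auto simp: cube_def)
  have "?I 0 (2 * pi) (\<lambda>x. f (x + t *\<^sub>R axis l 1)) = ?I t (2 * pi) f + ?I (2 * pi) (2 * pi + t) f"
    using shift[of 0 "2 * pi" t] split[of t "2 * pi" "2 * pi + t"] t by simp
  also have "?I (2 * pi) (2 * pi + t) f = ?I 0 t (\<lambda>x. f (x + (2 * pi) *\<^sub>R axis l 1))"
    using shift[of 0 t "2 * pi"] by (simp add: add.commute)
  also have "\<dots> = ?I 0 t f"
    using f(2) by (simp add: periodic_def)
  finally have "?I 0 (2 * pi) (\<lambda>x. f (x + t *\<^sub>R axis l 1)) = ?I 0 (2 * pi) f"
    using split[of 0 t "2 * pi"] t by simp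
  then show ?thesis
    by (simp add: integral_torus cube)
qed

section \<open>Fourier coefficients\<close>

abbreviation echar :: "int ^ 'n::finite \<Rightarrow> real ^ 'n \<Rightarrow> complex" where
  "echar k \<equiv> Rep_test_fun (texp k)"

lemma rvec_add: "rvec (k + l) = rvec k + rvec l"
  and rvec_minus: "rvec (- k) = - rvec k"
  and rvec_zero [simp]: "rvec 0 = 0"
  and rvec_axis: "rvec (axis j i) = real_of_int i *\<^sub>R axis j 1"
  by (simp_all add: rvec_def vec_eq_iff axis_def)

lemma echar_eq: "echar k x = exp (\<i> * complex_of_real (rvec k \<bullet> x))"
  by (simp add: texp.rep_eq)

lemma norm_echar [simp]: "norm (echar k x) = 1"
  by (simp add: echar_eq)

lemma echar_zero [simp]: "echar 0 x = 1"
  by (simp add: echar_eq)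

lemma echar_add: "echar (k + l) x = echar k x * echar l x"
  by (simp add: echar_eq rvec_add inner_add_left algebra_simps exp_add)

lemma echar_add_right: "echar k (x + y) = echar k x * echar k y"
  by (simp add: echar_eq inner_add_right algebra_simps exp_add)

lemma echar_uminus_right: "echar k (- x) = echar (- k) x"
  by (simp add: echar_eq rvec_minus)

lemma echar_diff_right: "echar k (x - y) = echar k x * echar (- k) y"
  using echar_add_right[of k x "- y"] by (simp add: echar_uminus_right)

lemma smooth_test_fun: "smooth (Rep_test_fun \<phi>)"
  and periodic_test_fun: "periodic (Rep_test_fun \<phi>)"
  using Rep_test_fun[of \<phi>] by auto

lemma continuous_on_test_fun [continuous_intros]: "continuous_on A (Rep_test_fun \<phi>)"
  using smooth_partial_funpow[OF smooth_test_fun, of 0]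
  by (intro continuous_on_subset[OF continuous_on_differentiable]) auto

lemma echar_half_period:
  assumes "k $ l \<noteq> 0"
  shows "echar k (x + (pi / \<bar>real_of_int (k $ l)\<bar>) *\<^sub>R axis l 1) = - echar k x"
proof -
  let ?y = "(pi / \<bar>real_of_int (k $ l)\<bar>) *\<^sub>R axis l 1 :: real ^ 'a"
  have "rvec k \<bullet> ?y = real_of_int (k $ l) * (pi / \<bar>real_of_int (k $ l)\<bar>)"
    by (simp add: inner_axis rvec_def)
  also have "\<dots> = (if k $ l > 0 then pi else - pi)"
    using assms by simp
  finally have "echar k ?y = -1"
    by (simp add: echar_eq exp_minus)
  then show ?thesis by (simp add: echar_add_right)
qed

lemma half_period_bounds:
  assumes "k $ l \<noteq> 0"
  shows "0 \<le> pi / \<bar>real_of_int (k $ l)\<bar>" "pi / \<bar>real_of_int (k $ l)\<bar> \<le> 2 * pi"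
proof -
  have "1 \<le> \<bar>real_of_int (k $ l)\<bar>" using assms by linarith
  then show "pi / \<bar>real_of_int (k $ l)\<bar> \<le> 2 * pi"
    using pi_gt_zero by (subst divide_le_eq) (auto simp: mult_le_cancel_left1 intro: order_trans[of _ "2 * 1"])
qed simp

text \<open>Orthogonality: for \<open>k \<noteq> l\<close> a translation changes the sign of the integral of \<open>e\<^bsub>k-l\<^esub>\<close>, but it
  also preserves it.\<close>

lemma fourier_coeff_test_texp: "fourier_coeff_test (texp k) l = (if k = l then 1 else 0)"
proof -
  have eq: "fourier_coeff_test (texp k) l = integral\<^sup>L torus (echar (k - l))"
    unfolding fourier_coeff_test_def
    by (intro Bochner_Integration.integral_cong) (simp_all add: echar_add[symmetric] add.commute)
  show ?thesis
  proof (cases "k = l")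
    case True
    moreover have "echar (0 :: int ^ 'a) = (\<lambda>x. 1)" by (simp add: fun_eq_iff)
    ultimately show ?thesis unfolding eq by (simp add: measure_torus)
  next
    case False
    then obtain j where j: "(k - l) $ j \<noteq> 0"
      by (metis eq_iff_diff_eq_0 vec_eq_iff zero_index)
    have "integral\<^sup>L torus (echar (k - l)) = - integral\<^sup>L torus (echar (k - l))"
      using integral_torus_shift[OF continuous_on_test_fun periodic_test_fun half_period_bounds[OF j], of "texp (k - l)" j]
      unfolding echar_half_period[OF j] by simp
    then show ?thesis using False by (simp add: eq)
  qed
qed

lemma integrable_echar_mult:
  "continuous_on UNIV f \<Longrightarrow> integrable torus (\<lambda>x. echar k x * f x)"
  by (intro integrable_torus continuous_intros)

lemma fourier_coeff_test_add:
  "fourier_coeff_test (\<phi> + \<psi>) k = fourier_coeff_test \<phi> k + fourier_coeff_test \<psi> k"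
  unfolding fourier_coeff_test_def
  by (subst Bochner_Integration.integral_add[symmetric])
    (auto simp: integrable_echar_mult continuous_on_test_fun plus_test_fun.rep_eq distrib_left)

lemma fourier_coeff_test_scaleC: "fourier_coeff_test (c *\<^sub>C \<phi>) k = c * fourier_coeff_test \<phi> k"
proof -
  have "(\<lambda>x. echar (- k) x * Rep_test_fun (c *\<^sub>C \<phi>) x) = (\<lambda>x. c * (echar (- k) x * Rep_test_fun \<phi> x))"
    by (simp add: scaleC_test_fun.rep_eq fun_eq_iff)
  then show ?thesis by (simp add: fourier_coeff_test_def)
qed

lemma periodic_shift_diff: "periodic f \<Longrightarrow> periodic (shift_diff h f)"
  by (simp add: periodic_def shift_diff_def) (metis add.assoc add.commute)

lemma continuous_on_shift_diff: "continuous_on UNIV f \<Longrightarrow> continuous_on UNIV (shift_diff h f)"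
  for h :: "real ^ 'n::finite" and f :: "real ^ 'n \<Rightarrow> 'b::real_normed_vector"
  unfolding shift_diff_def
  by (intro continuous_on_diff continuous_on_compose2[of UNIV f UNIV "\<lambda>x. x + h"] continuous_intros) auto

text \<open>Instead of integrating by parts, \<open>f\<close> is replaced by its differences with step half a period:
  each one multiplies the Fourier coefficient by \<open>-2\<close>.\<close>

lemma integral_echar_shift_diff:
  fixes f :: "real ^ 'n::finite \<Rightarrow> complex"
  assumes "continuous_on UNIV f" "periodic f" "k $ l \<noteq> 0"
  shows "(\<integral>x. echar k x * (shift_diff ((pi / \<bar>real_of_int (k $ l)\<bar>) *\<^sub>R axis l 1) ^^ N) f x \<partial>torus)
    = (-2) ^ N * (\<integral>x. echar k x * f x \<partial>torus)"
  using assms(1,2)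
proof (induction N arbitrary: f)
  case (Suc N)
  let ?h = "(pi / \<bar>real_of_int (k $ l)\<bar>) *\<^sub>R axis l 1 :: real ^ 'n"
  have cont: "continuous_on UNIV (\<lambda>x. echar k x * f x)"
    using Suc.prems by (intro continuous_intros)
  have contS: "continuous_on UNIV (\<lambda>x. echar k x * shift_diff ?h f x)"
    using Suc.prems by (intro continuous_intros continuous_on_shift_diff)
  have "(\<integral>x. echar k x * f x \<partial>torus) = (\<integral>x. echar k (x + ?h) * f (x + ?h) \<partial>torus)"
  proof (rule integral_torus_shift[symmetric, where f = "\<lambda>x. echar k x * f x"])
    show "periodic (\<lambda>x. echar k x * f x)"
      using Suc.prems(2) periodic_test_fun[of "texp k"] by (simp add: periodic_def)
  qed (use cont half_period_bounds[OF assms(3)] in auto)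
  also have "\<dots> = (\<integral>x. - (echar k x * shift_diff ?h f x + echar k x * f x) \<partial>torus)"
    unfolding echar_half_period[OF assms(3)]
    by (intro Bochner_Integration.integral_cong) (auto simp: shift_diff_def algebra_simps)
  also have "\<dots> = - (\<integral>x. echar k x * shift_diff ?h f x \<partial>torus) - (\<integral>x. echar k x * f x \<partial>torus)"
    using integrable_torus[OF cont] integrable_torus[OF contS] by simp
  finally have "(\<integral>x. echar k x * shift_diff ?h f x \<partial>torus) = -2 * (\<integral>x. echar k x * f x \<partial>torus)"
    by (simp add: algebra_simps eq_neg_iff_add_eq_0)
  then show ?case
    using Suc.IH[of "shift_diff ?h f"] Suc.prems
    by (simp only: funpow_Suc_apply) (simp add: continuous_on_shift_diff periodic_shift_diff)
qed simp

lemma norm_partial_le_test_seminorm: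
  "norm ((partial l ^^ N) (Rep_test_fun \<phi>) x) \<le> test_seminorm N \<phi>"
proof -
  have "bdd_above (range (\<lambda>x. norm ((partial l ^^ N) (Rep_test_fun \<phi>) x)))"
    by (intro periodic_bounded periodic_partial_funpow periodic_test_fun continuous_on_differentiable
        smooth_partial_funpow smooth_test_fun)
  then have "norm ((partial l ^^ N) (Rep_test_fun \<phi>) x) \<le> (SUP x. norm (mi_power partial (axis l N) (Rep_test_fun \<phi>) x))"
    unfolding mi_power_axis by (intro cSUP_upper) auto
  also have "\<dots> \<le> test_seminorm N \<phi>"
    unfolding test_seminorm_def
    by (intro Max_ge imageI finite_imageI finite_mi_upto) (simp add: mi_upto_def mi_abs_axis)
  finally show ?thesis .
qed

text \<open>Differences are taken in a direction \<open>l\<close> where \<open>\<bar>k\<^sub>l\<bar>\<close> is maximal, hence comparable to \<open>\<langle>k\<rangle>\<close>. With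
  the step \<open>\<pi> / \<bar>k\<^sub>l\<bar>\<close> each of them gains one power of \<open>\<langle>k\<rangle>\<close>.\<close>

lemma norm_fourier_coeff_test_le:
  fixes \<phi> :: "'n::finite test_fun"
  shows "norm (fourier_coeff_test \<phi> k) \<le> (2 * (1 + real CARD('n)) / jap (rvec k)) ^ N * test_seminorm N \<phi>"
proof -
  have S0: "0 \<le> test_seminorm N \<phi>"
    using norm_partial_le_test_seminorm order_trans norm_ge_zero by blast
  obtain l where l: "\<And>j. \<bar>k $ j\<bar> \<le> \<bar>k $ l\<bar>"
  proof -
    have "Max (range (\<lambda>j. \<bar>k $ j\<bar>)) \<in> range (\<lambda>j. \<bar>k $ j\<bar>)" by (intro Max_in) auto
    then obtain l where "Max (range (\<lambda>j. \<bar>k $ j\<bar>)) = \<bar>k $ l\<bar>" by blast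
    then have "\<bar>k $ j\<bar> \<le> \<bar>k $ l\<bar>" for j by (metis Max_ge finite finite_imageI rangeI)
    then show ?thesis using that by blast
  qed
  show ?thesis
  proof (cases "k $ l = 0")
    case True
    then have "k = 0" using l by (simp add: vec_eq_iff)
    have "norm (fourier_coeff_test \<phi> k) \<le> test_seminorm 0 \<phi>"
      unfolding fourier_coeff_test_def
      using norm_partial_le_test_seminorm[where N = 0 and \<phi> = \<phi>]
      by (intro norm_integral_torus_le continuous_intros) (simp add: norm_mult)
    also have "\<dots> \<le> 1 * test_seminorm N \<phi>" by (simp add: test_seminorm_mono)
    also have "\<dots> \<le> (2 * (1 + real CARD('n)) / jap (rvec k)) ^ N * test_seminorm N \<phi>"
      using S0 by (intro mult_right_mono one_le_power) (auto simp: \<open>k = 0\<close> jap_def)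
    finally show ?thesis .
  next
    case False
    define t where "t = pi / \<bar>real_of_int (k $ l)\<bar>"
    have "jap (rvec k) \<le> 1 + (\<Sum>j\<in>UNIV. \<bar>rvec k $ j\<bar>)"
      using jap_le[of "rvec k"] norm_le_l1_cart[of "rvec k"] by linarith
    also have "\<dots> \<le> 1 + (\<Sum>j\<in>(UNIV :: 'n set). \<bar>real_of_int (k $ l)\<bar>)"
      using l by (intro add_left_mono sum_mono) (metis of_int_abs of_int_le_iff rvec_def vec_lambda_beta)
    also have "\<dots> \<le> (1 + real CARD('n)) * \<bar>real_of_int (k $ l)\<bar>"
      using False by (simp add: algebra_simps)
    finally have jap: "jap (rvec k) \<le> (1 + real CARD('n)) * \<bar>real_of_int (k $ l)\<bar>" .
    have t: "0 \<le> t" "t \<le> 2 * pi"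
      unfolding t_def using half_period_bounds[OF False] by auto
    have "norm ((-2) ^ N * fourier_coeff_test \<phi> k)
      = norm (\<integral>x. echar (- k) x * (shift_diff (t *\<^sub>R axis l 1) ^^ N) (Rep_test_fun \<phi>) x \<partial>torus)"
      using integral_echar_shift_diff[OF continuous_on_test_fun periodic_test_fun, of "- k" l N \<phi>] False
      by (simp add: t_def fourier_coeff_test_def)
    also have "\<dots> \<le> t ^ N * test_seminorm N \<phi>"
    proof (rule norm_integral_torus_le)
      have "continuous_on UNIV ((shift_diff (t *\<^sub>R axis l 1) ^^ N) (Rep_test_fun \<phi>))"
        by (induction N) (simp_all add: continuous_on_shift_diff continuous_on_test_fun)
      then show "continuous_on UNIV (\<lambda>x. echar (- k) x * (shift_diff (t *\<^sub>R axis l 1) ^^ N) (Rep_test_fun \<phi>) x)"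
        by (intro continuous_intros)
      show "norm (echar (- k) x * (shift_diff (t *\<^sub>R axis l 1) ^^ N) (Rep_test_fun \<phi>) x) \<le> t ^ N * test_seminorm N \<phi>" for x
      proof -
        have "norm ((shift_diff (t *\<^sub>R axis l 1) ^^ N) (Rep_test_fun \<phi>) x) \<le> t ^ N * test_seminorm N \<phi>"
          by (intro norm_shift_diff_funpow_le_partial smooth_partial_funpow smooth_test_fun
              norm_partial_le_test_seminorm t(1))
        then show ?thesis by (simp add: norm_mult)
      qed
    qed
    finally have "norm (fourier_coeff_test \<phi> k) \<le> (t / 2) ^ N * test_seminorm N \<phi>"
      by (simp add: norm_mult norm_power power_divide field_simps)
    also have "\<dots> \<le> (2 * (1 + real CARD('n)) / jap (rvec k)) ^ N * test_seminorm N \<phi>"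
    proof (intro mult_right_mono power_mono S0)
      have "t / 2 \<le> 2 / \<bar>real_of_int (k $ l)\<bar>"
        using pi_less_4 False by (simp add: t_def field_simps)
      also have "\<dots> \<le> 2 * (1 + real CARD('n)) / jap (rvec k)"
        using jap jap_pos[of "rvec k"] False by (simp add: field_simps)
      finally show "t / 2 \<le> 2 * (1 + real CARD('n)) / jap (rvec k)" .
    qed (use t in auto)
    finally show ?thesis .
  qed
qed

text \<open>Measures the growth in \<open>k\<close> of the functions on which a distribution is evaluated to obtain its
  Fourier coefficients.\<close>

lemma test_seminorm_texp_le:
  fixes k :: "int ^ 'n::finite"
  shows "test_seminorm N (c *\<^sub>C texp k) \<le> norm c * jap (rvec k) ^ N"
proof -
  have partial_echar: "partial j (\<lambda>x. c * echar k x) = (\<lambda>x. (c * (\<i> * complex_of_real (rvec k $ j))) * echar k x)" for c j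
  proof
    fix x
    have "((\<lambda>x. \<i> * complex_of_real (rvec k \<bullet> x)) has_derivative (\<lambda>h. \<i> * complex_of_real (rvec k \<bullet> h))) (at x)"
      by (intro bounded_linear.has_derivative[OF bounded_linear_mult_right]
          bounded_linear.has_derivative[OF bounded_linear_of_real]
          bounded_linear_imp_has_derivative bounded_linear_inner_right)
    from bounded_linear.has_derivative[OF bounded_linear_mult_right[of c]
        has_derivative_compose[OF this DERIV_exp[unfolded has_field_derivative_def]]]
    have "((\<lambda>x. c * echar k x) has_derivative (\<lambda>h. c * (echar k x * (\<i> * complex_of_real (rvec k \<bullet> h))))) (at x)"
      by (simp add: echar_eq[abs_def])
    from partial_eq[OF this, of j]
    show "partial j (\<lambda>x. c * echar k x) x = (c * (\<i> * complex_of_real (rvec k $ j))) * echar k x"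
      by (simp add: inner_axis mult_ac)
  qed
  have step: "\<exists>c'. (partial j ^^ a) (\<lambda>x. c * echar k x) = (\<lambda>x. c' * echar k x) \<and> norm c' \<le> norm c * jap (rvec k) ^ a" for j a c
  proof (induction a)
    case (Suc a)
    then obtain c' where c': "(partial j ^^ a) (\<lambda>x. c * echar k x) = (\<lambda>x. c' * echar k x)" "norm c' \<le> norm c * jap (rvec k) ^ a"
      by blast
    have "norm (c' * (\<i> * complex_of_real (rvec k $ j))) = norm c' * \<bar>rvec k $ j\<bar>"
      by (simp add: norm_mult)
    also have "\<dots> \<le> (norm c * jap (rvec k) ^ a) * jap (rvec k)"
      using component_le_norm_cart[of "rvec k" j] norm_le_jap[of "rvec k"] jap_pos[of "rvec k"]
      by (intro mult_mono c') auto
    finally show ?case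
      by (intro exI[of _ "c' * (\<i> * complex_of_real (rvec k $ j))"]) (simp add: c' partial_echar mult_ac)
  qed auto
  have fold: "\<exists>c'. foldr (\<lambda>j. partial j ^^ (\<alpha> $ j)) js (\<lambda>x. c * echar k x) = (\<lambda>x. c' * echar k x)
      \<and> norm c' \<le> norm c * jap (rvec k) ^ sum_list (map (\<lambda>j. \<alpha> $ j) js)" for js and \<alpha> :: "nat ^ 'n"
  proof (induction js)
    case (Cons j js)
    then obtain c' where c': "foldr (\<lambda>j. partial j ^^ (\<alpha> $ j)) js (\<lambda>x. c * echar k x) = (\<lambda>x. c' * echar k x)"
      "norm c' \<le> norm c * jap (rvec k) ^ sum_list (map (\<lambda>j. \<alpha> $ j) js)" by blast
    obtain d where d: "(partial j ^^ (\<alpha> $ j)) (\<lambda>x. c' * echar k x) = (\<lambda>x. d * echar k x)"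
      "norm d \<le> norm c' * jap (rvec k) ^ (\<alpha> $ j)" using step by blast
    have "norm d \<le> (norm c * jap (rvec k) ^ sum_list (map (\<lambda>j. \<alpha> $ j) js)) * jap (rvec k) ^ (\<alpha> $ j)"
      using d(2) c'(2) jap_pos[of "rvec k"] by (meson mult_right_mono order_trans zero_le_power less_imp_le)
    then show ?case
      by (intro exI[of _ d]) (simp add: c' d power_add mult_ac)
  qed auto
  have "norm (mi_power partial \<alpha> (Rep_test_fun (c *\<^sub>C texp k)) x) \<le> norm c * jap (rvec k) ^ N"
    if "\<alpha> \<in> mi_upto N" for \<alpha> :: "nat ^ 'n" and x
  proof -
    have rep: "Rep_test_fun (c *\<^sub>C texp k) = (\<lambda>x. c * echar k x)"
      by (simp add: scaleC_test_fun.rep_eq fun_eq_iff)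
    obtain c' where c': "mi_power partial \<alpha> (Rep_test_fun (c *\<^sub>C texp k)) = (\<lambda>x. c' * echar k x)"
      "norm c' \<le> norm c * jap (rvec k) ^ sum_list (map (\<lambda>j. \<alpha> $ j) coords)"
      unfolding mi_power_def rep using fold by blast
    have "sum_list (map (\<lambda>j. \<alpha> $ j) coords) = mi_abs \<alpha>"
      unfolding mi_abs_def using coords by (metis sum_list_distinct_conv_sum_set)
    also have "\<dots> \<le> N" using that by (simp add: mi_upto_def)
    finally have "jap (rvec k) ^ sum_list (map (\<lambda>j. \<alpha> $ j) coords) \<le> jap (rvec k) ^ N"
      using jap_ge_1 by (rule power_increasing)
    then have "norm c' \<le> norm c * jap (rvec k) ^ N"
      using c'(2) by (meson mult_left_mono norm_ge_zero order_trans)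
    then show ?thesis by (simp add: c' norm_mult)
  qed
  then show ?thesis
    unfolding test_seminorm_def using zero_in_mi_upto
    by (subst Max_le_iff) (auto simp: finite_mi_upto intro!: cSUP_least)
qed

section \<open>Fourier series of polynomially growing coefficients\<close>

definition poly_growth :: "(int ^ 'n::finite \<Rightarrow> 'b::real_normed_vector) \<Rightarrow> bool" where
  "poly_growth c \<longleftrightarrow> (\<exists>C N. \<forall>k. norm (c k) \<le> C * jap (rvec k) ^ N)"

lemma poly_growthI: "(\<And>k. norm (c k) \<le> C * jap (rvec k) ^ N) \<Longrightarrow> poly_growth c"
  unfolding poly_growth_def by blast

lemma poly_growthE:
  assumes "poly_growth c"
  obtains C N where "0 \<le> C" "\<And>k. norm (c k) \<le> C * jap (rvec k) ^ N"
proof -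
  obtain C N where *: "\<And>k. norm (c k) \<le> C * jap (rvec k) ^ N"
    using assms unfolding poly_growth_def by blast
  have "0 \<le> C"
    using order_trans[OF norm_ge_zero *[of 0]] by (simp add: jap_def)
  from this * show ?thesis by (rule that)
qed

lemma poly_growth_add:
  assumes "poly_growth c" "poly_growth d"
  shows "poly_growth (\<lambda>k. c k + d k)"
proof -
  obtain C N where C: "0 \<le> C" "\<And>k. norm (c k) \<le> C * jap (rvec k) ^ N" by (rule poly_growthE[OF assms(1)]) blast
  obtain D M where D: "0 \<le> D" "\<And>k. norm (d k) \<le> D * jap (rvec k) ^ M" by (rule poly_growthE[OF assms(2)]) blast
  have "norm (c k + d k) \<le> (C + D) * jap (rvec k) ^ (max N M)" for k
  proof -
    have "norm (c k + d k) \<le> C * jap (rvec k) ^ N + D * jap (rvec k) ^ M"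
      by (intro norm_triangle_mono C D)
    also have "\<dots> \<le> C * jap (rvec k) ^ (max N M) + D * jap (rvec k) ^ (max N M)"
      by (intro add_mono mult_left_mono power_increasing C D jap_ge_1) auto
    finally show ?thesis by (simp add: algebra_simps)
  qed
  then show ?thesis by (rule poly_growthI)
qed

lemma poly_growth_mult:
  assumes "poly_growth c" "poly_growth d" and le: "\<And>k. norm (e k) \<le> norm (c k) * norm (d k)"
  shows "poly_growth e"
proof -
  obtain C N where C: "0 \<le> C" "\<And>k. norm (c k) \<le> C * jap (rvec k) ^ N" by (rule poly_growthE[OF assms(1)]) blast
  obtain D M where D: "0 \<le> D" "\<And>k. norm (d k) \<le> D * jap (rvec k) ^ M" by (rule poly_growthE[OF assms(2)]) blast
  have "norm (e k) \<le> (C * D) * jap (rvec k) ^ (N + M)" for k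
  proof -
    have "norm (e k) \<le> (C * jap (rvec k) ^ N) * (D * jap (rvec k) ^ M)"
      using jap_pos[of "rvec k"] C(1) by (intro order_trans[OF le] mult_mono C D) auto
    then show ?thesis by (simp add: power_add algebra_simps)
  qed
  then show ?thesis by (rule poly_growthI)
qed

lemma poly_growth_const: "poly_growth (\<lambda>k. x)"
  by (rule poly_growthI[of _ "norm x" 0]) simp

lemma poly_growth_finite_support:
  assumes "finite A" "\<And>k. k \<notin> A \<Longrightarrow> c k = 0"
  shows "poly_growth c"
proof (rule poly_growthI[of _ "\<Sum>k\<in>A. norm (c k)" 0])
  show "norm (c k) \<le> (\<Sum>k\<in>A. norm (c k)) * jap (rvec k) ^ 0" for k
    using assms member_le_sum[of k A "\<lambda>k. norm (c k)"]
    by (cases "k \<in> A") (auto intro: sum_nonneg)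
qed

text \<open>The term \<open>4 / (R + 1)\<close> carries the induction: the two summands \<open>1 / (1 + (R + 1)\<^sup>2)\<close> of a step
  are at most \<open>4 / (R + 1) - 4 / (R + 2)\<close>.\<close>

lemma sum_inverse_one_plus_square_le:
  "(\<Sum>i\<in>{- int R..int R}. inverse (1 + (real_of_int i)\<^sup>2)) \<le> 5 - 4 / (real R + 1)"
proof (induction R)
  case (Suc R)
  have "{- int (Suc R)..int (Suc R)} = insert (- int (Suc R)) (insert (int (Suc R)) {- int R..int R})"
    by auto
  then have "(\<Sum>i\<in>{- int (Suc R)..int (Suc R)}. inverse (1 + (real_of_int i)\<^sup>2))
    = 2 * inverse (1 + (real R + 1)\<^sup>2) + (\<Sum>i\<in>{- int R..int R}. inverse (1 + (real_of_int i)\<^sup>2))"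
    by (simp add: power2_eq_square algebra_simps)
  also have "\<dots> \<le> 2 * inverse (1 + (real R + 1)\<^sup>2) + (5 - 4 / (real R + 1))"
    using Suc by simp
  also have "2 * inverse (1 + (real R + 1)\<^sup>2) \<le> 4 / (real R + 1) - 4 / (real R + 2)"
  proof -
    have "4 / (real R + 1) - 4 / (real R + 2) = 4 / ((real R + 1) * (real R + 2))"
      by (simp add: field_simps)
    moreover have "2 * inverse (1 + (real R + 1)\<^sup>2) \<le> 4 / ((real R + 1) * (real R + 2))"
      by (simp add: divide_simps power2_eq_square) (simp add: algebra_simps)
    ultimately show ?thesis by simp
  qed
  finally show ?case by (simp add: add.commute)
qed simp

text \<open>By \<open>\<langle>k\<rangle>\<^sup>2\<^sup>n \<ge> \<Prod>\<^sub>j (1 + k\<^sub>j\<^sup>2)\<close> the sum is dominated by a product of sums of one variable.\<close>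

lemma summable_jap:
  "(\<lambda>k :: int ^ 'n::finite. inverse (jap (rvec k) ^ (2 * CARD('n)))) summable_on UNIV"
proof (rule nonneg_bdd_above_summable_on)
  show "bdd_above (sum (\<lambda>k :: int ^ 'n. inverse (jap (rvec k) ^ (2 * CARD('n)))) ` {F. F \<subseteq> UNIV \<and> finite F})"
  proof (rule bdd_aboveI2)
    fix F :: "(int ^ 'n) set" assume "F \<in> {F. F \<subseteq> UNIV \<and> finite F}"
    then have F: "finite F" by simp
    let ?h = "\<lambda>i. inverse (1 + (real_of_int i)\<^sup>2)"
    define R where "R = (\<Sum>k\<in>F. \<Sum>j\<in>UNIV. nat \<bar>k $ j\<bar>)"
    have R: "k $ j \<in> {- int R..int R}" if "k \<in> F" for k j
    proof -
      have "nat \<bar>k $ j\<bar> \<le> (\<Sum>j\<in>UNIV. nat \<bar>k $ j\<bar>)"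
        by (rule member_le_sum) auto
      also have "\<dots> \<le> R"
        unfolding R_def by (rule member_le_sum[OF that, where f = "\<lambda>k. \<Sum>j\<in>UNIV. nat \<bar>k $ j\<bar>"]) (auto simp: F)
      finally show ?thesis by auto
    qed
    have "(\<Sum>k\<in>F. inverse (jap (rvec k) ^ (2 * CARD('n)))) \<le> (\<Sum>k\<in>F. \<Prod>j\<in>UNIV. ?h (k $ j))"
    proof (rule sum_mono)
      fix k :: "int ^ 'n"
      have "(\<Prod>j\<in>UNIV. 1 + (real_of_int (k $ j))\<^sup>2) \<le> (\<Prod>j\<in>(UNIV :: 'n set). (jap (rvec k))\<^sup>2)"
      proof (rule prod_mono)
        fix j
        have "\<bar>rvec k $ j\<bar> \<le> norm (rvec k)" by (rule component_le_norm_cart)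
        then have "(rvec k $ j)\<^sup>2 \<le> (norm (rvec k))\<^sup>2"
          by (metis norm_ge_zero power2_abs power_mono abs_ge_zero)
        then show "0 \<le> 1 + (real_of_int (k $ j))\<^sup>2 \<and> 1 + (real_of_int (k $ j))\<^sup>2 \<le> (jap (rvec k))\<^sup>2"
          by (simp add: jap_def rvec_def)
      qed
      then have "inverse (\<Prod>j\<in>(UNIV :: 'n set). (jap (rvec k))\<^sup>2) \<le> inverse (\<Prod>j\<in>UNIV. 1 + (real_of_int (k $ j))\<^sup>2)"
        by (intro le_imp_inverse_le prod_pos) (auto intro: add_pos_nonneg)
      then show "inverse (jap (rvec k) ^ (2 * CARD('n))) \<le> (\<Prod>j\<in>UNIV. ?h (k $ j))"
        by (simp add: power_mult prod_inversef[symmetric, unfolded comp_def])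
    qed
    also have "\<dots> = (\<Sum>g\<in>vec_nth ` F. \<Prod>j\<in>UNIV. ?h (g j))"
      by (subst sum.reindex) (auto simp: inj_on_def vec_nth_inject)
    also have "\<dots> \<le> (\<Sum>g\<in>PiE (UNIV :: 'n set) (\<lambda>_. {- int R..int R}). \<Prod>j\<in>UNIV. ?h (g j))"
      by (rule sum_mono2) (use R in \<open>auto intro!: finite_PiE prod_nonneg\<close>)
    also have "\<dots> = (\<Prod>j\<in>(UNIV :: 'n set). \<Sum>i\<in>{- int R..int R}. ?h i)"
      by (rule prod_sum_PiE[symmetric]) auto
    also have "\<dots> \<le> (\<Prod>j\<in>(UNIV :: 'n set). 5)"
      using sum_inverse_one_plus_square_le[of R]
      by (intro prod_mono conjI sum_nonneg) (auto intro: order_trans)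
    finally show "(\<Sum>k\<in>F. inverse (jap (rvec k) ^ (2 * CARD('n)))) \<le> 5 ^ CARD('n)" by simp
  qed
qed (simp add: jap_pos less_imp_le)

text \<open>All operators considered here act on Fourier coefficients. This is the distribution with prescribed
  coefficients \<open>c\<close>, the common form of their values.\<close>

definition fourier_series :: "(int ^ 'n::finite \<Rightarrow> 'e::complex_banach) \<Rightarrow> 'n test_fun \<Rightarrow> 'e" where
  "fourier_series c \<phi> = (\<Sum>\<^sub>\<infinity>k. fourier_coeff_test \<phi> (- k) *\<^sub>C c k)"

lemma op_tor_eq_fourier_series:
  "op_tor a u = fourier_series (\<lambda>k. blinfun_apply (a k) (fourier_coeff u k))"
  by (simp add: op_tor_def fourier_series_def fun_eq_iff)

lemma jap_rvec_minus: "jap (rvec (- k)) = jap (rvec k)"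
  by (simp add: jap_def rvec_minus)

text \<open>One power counting gives both the convergence of the series and the continuity of its sum.\<close>

lemma fourier_series_bound:
  fixes c :: "int ^ 'n::finite \<Rightarrow> 'e::complex_banach"
  assumes "poly_growth c"
  obtains C N where "0 \<le> C"
    "\<And>\<phi>. (\<lambda>k. norm (fourier_coeff_test \<phi> (- k) *\<^sub>C c k)) summable_on UNIV"
    "\<And>\<phi>. norm (fourier_series c \<phi>) \<le> C * test_seminorm N \<phi>"
proof -
  obtain C N where C: "0 \<le> C" "\<And>k. norm (c k) \<le> C * jap (rvec k) ^ N" by (rule poly_growthE[OF assms]) blast
  define M where "M = N + 2 * CARD('n)"
  define A where "A = 2 * (1 + real CARD('n))"
  define w where "w = (\<lambda>k :: int ^ 'n. inverse (jap (rvec k) ^ (2 * CARD('n))))"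
  have w: "w summable_on UNIV" unfolding w_def by (rule summable_jap)
  have le: "norm (fourier_coeff_test \<phi> (- k) *\<^sub>C c k) \<le> (A ^ M * C * test_seminorm M \<phi>) * w k" for k \<phi>
  proof -
    have S0: "0 \<le> test_seminorm M \<phi>"
      using norm_partial_le_test_seminorm order_trans norm_ge_zero by blast
    have "norm (fourier_coeff_test \<phi> (- k) *\<^sub>C c k) \<le> ((A / jap (rvec k)) ^ M * test_seminorm M \<phi>) * (C * jap (rvec k) ^ N)"
      unfolding norm_scaleC using norm_fourier_coeff_test_le[of \<phi> "- k" M] C S0 jap_pos[of "rvec k"]
      by (intro mult_mono) (auto simp: jap_rvec_minus A_def)
    also have "\<dots> = (A ^ M * C * test_seminorm M \<phi>) * w k"
      using jap_pos[of "rvec k"] by (simp add: M_def w_def power_add power_divide field_simps)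
    finally show ?thesis .
  qed
  have summable: "(\<lambda>k. norm (fourier_coeff_test \<phi> (- k) *\<^sub>C c k)) summable_on UNIV" for \<phi>
  proof (rule Infinite_Sum.abs_summable_on_comparison_test)
    show "(\<lambda>k. norm ((A ^ M * C * test_seminorm M \<phi>) * w k)) summable_on UNIV"
      using summable_on_cmult_right[OF w] by (subst summable_on_iff_abs_summable_on_real[symmetric])
    show "norm (fourier_coeff_test \<phi> (- k) *\<^sub>C c k) \<le> norm ((A ^ M * C * test_seminorm M \<phi>) * w k)" for k
      using le[of \<phi> k] by simp
  qed
  have "norm (fourier_series c \<phi>) \<le> (A ^ M * C * infsum w UNIV) * test_seminorm M \<phi>" for \<phi>
  proof -
    have "norm (fourier_series c \<phi>) \<le> infsum (\<lambda>k. norm (fourier_coeff_test \<phi> (- k) *\<^sub>C c k)) UNIV"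
      unfolding fourier_series_def by (rule norm_infsum_bound[OF summable])
    also have "\<dots> \<le> infsum (\<lambda>k. (A ^ M * C * test_seminorm M \<phi>) * w k) UNIV"
      by (rule infsum_mono[OF summable summable_on_cmult_right[OF w] le])
    also have "\<dots> = (A ^ M * C * infsum w UNIV) * test_seminorm M \<phi>"
      unfolding infsum_cmult_right' by (simp add: mult_ac)
    finally show ?thesis .
  qed
  moreover have "0 \<le> A ^ M * C * infsum w UNIV"
    using C by (auto simp: A_def w_def jap_pos less_imp_le intro!: mult_nonneg_nonneg infsum_nonneg)
  ultimately show ?thesis
    by (intro that[of "A ^ M * C * infsum w UNIV" M] summable)
qed

lemma fourier_series_summable:
  fixes c :: "int ^ 'n::finite \<Rightarrow> 'e::complex_banach"
  shows "poly_growth c \<Longrightarrow> (\<lambda>k. fourier_coeff_test \<phi> (- k) *\<^sub>C c k) summable_on UNIV"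
  by (rule fourier_series_bound[of c], assumption) (rule abs_summable_summable)

lemma fourier_series_add:
  assumes "poly_growth c" "poly_growth d"
  shows "fourier_series (\<lambda>k. c k + d k) = fourier_series c + fourier_series d"
  unfolding fun_eq_iff plus_fun_def fourier_series_def scaleC_add_right
  by (intro allI infsum_add fourier_series_summable assms)

lemma fourier_series_scaleC:
  assumes "poly_growth c"
  shows "fourier_series (\<lambda>k. z *\<^sub>C c k) = z *\<^sub>C fourier_series c"
proof
  fix \<phi>
  have "(\<Sum>\<^sub>\<infinity>k. z *\<^sub>C (fourier_coeff_test \<phi> (- k) *\<^sub>C c k)) = z *\<^sub>C (\<Sum>\<^sub>\<infinity>k. fourier_coeff_test \<phi> (- k) *\<^sub>C c k)"
    by (intro infsumI has_sum_bounded_linear[OF bounded_linear_scaleC] has_sum_infsum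
        fourier_series_summable assms)
  then show "fourier_series (\<lambda>k. z *\<^sub>C c k) \<phi> = (z *\<^sub>C fourier_series c) \<phi>"
    by (simp add: fourier_series_def scaleC_fun_def scaleC_scaleC mult.commute)
qed

lemma fourier_series_finite:
  assumes "finite A" "\<And>k. k \<notin> A \<Longrightarrow> c k = 0"
  shows "fourier_series c \<phi> = (\<Sum>k\<in>A. fourier_coeff_test \<phi> (- k) *\<^sub>C c k)"
proof -
  have "fourier_series c \<phi> = (\<Sum>\<^sub>\<infinity>k\<in>A. fourier_coeff_test \<phi> (- k) *\<^sub>C c k)"
    unfolding fourier_series_def using assms(2) by (intro infsum_cong_neutral) auto
  then show ?thesis using assms(1) by simp
qed

lemma fourier_coeff_fourier_series: "fourier_coeff (fourier_series c) k = c k"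
proof -
  have "fourier_coeff (fourier_series c) k = (\<Sum>\<^sub>\<infinity>l. fourier_coeff_test (texp (- k)) (- l) *\<^sub>C c l)"
    by (simp add: fourier_coeff_def fourier_series_def)
  also have "\<dots> = (\<Sum>\<^sub>\<infinity>l\<in>{k}. c l)"
    by (intro infsum_cong_neutral) (auto simp: fourier_coeff_test_texp scaleC_one)
  finally show ?thesis by simp
qed

lemma distributionsI:
  assumes "clinear_on UNIV u" and bound: "\<And>\<phi>. norm (u \<phi>) \<le> C * test_seminorm N \<phi>" and "0 \<le> C"
  shows "u \<in> distributions"
proof -
  have diff: "u (\<psi> - \<phi>) = u \<psi> - u \<phi>" for \<psi> \<phi>
  proof -
    have "u ((\<psi> - \<phi>) + \<phi>) = u (\<psi> - \<phi>) + u \<phi>"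
      by (rule clinear_onD_add[OF assms(1)]) auto
    then show ?thesis by simp
  qed
  have "open (u -` V)" if "open V" for V
    unfolding open_test_fun_def
  proof
    fix \<phi> assume "\<phi> \<in> u -` V"
    then obtain e where e: "e > 0" "\<And>y. dist y (u \<phi>) < e \<Longrightarrow> y \<in> V"
      using \<open>open V\<close> by (metis open_dist vimage_eq)
    have "\<psi> \<in> u -` V" if "test_seminorm N (\<psi> - \<phi>) < e / (C + 1)" for \<psi>
    proof -
      have "norm (u (\<psi> - \<phi>)) \<le> C * (e / (C + 1))"
        using that assms(3) by (intro order_trans[OF bound] mult_left_mono) auto
      also have "\<dots> < e" using e assms(3) by (simp add: field_simps)
      finally show ?thesis using e by (simp add: diff dist_norm)
    qed
    then show "\<exists>N. \<exists>\<epsilon>>0. \<forall>\<psi>. test_seminorm N (\<psi> - \<phi>) < \<epsilon> \<longrightarrow> \<psi> \<in> u -` V"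
      using e assms(3) by (intro exI[of _ N] exI[of _ "e / (C + 1)"]) auto
  qed
  then show ?thesis
    using assms(1) by (simp add: distributions_def continuous_on_open_vimage)
qed

lemma fourier_series_distribution:
  assumes "poly_growth c"
  shows "fourier_series c \<in> distributions"
proof -
  obtain C N where "0 \<le> C" "\<And>\<phi>. norm (fourier_series c \<phi>) \<le> C * test_seminorm N \<phi>"
    by (rule fourier_series_bound[OF assms]) blast
  moreover have "clinear_on UNIV (fourier_series c)"
    unfolding clinear_on_def
  proof (intro conjI ballI allI)
    show "fourier_series c (\<phi> + \<psi>) = fourier_series c \<phi> + fourier_series c \<psi>" for \<phi> \<psi>
      unfolding fourier_series_def fourier_coeff_test_add scaleC_add_left
      by (intro infsum_add fourier_series_summable assms)
    show "fourier_series c (z *\<^sub>C \<phi>) = z *\<^sub>C fourier_series c \<phi>" for \<phi> z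
      unfolding fourier_series_def fourier_coeff_test_scaleC scaleC_scaleC[symmetric]
      by (intro infsumI has_sum_bounded_linear[OF bounded_linear_scaleC] has_sum_infsum
        fourier_series_summable assms)
  qed
  ultimately show ?thesis using distributionsI by blast
qed

text \<open>A distribution is bounded on some ball of a seminorm of order \<open>N\<close>, and multiplication by a constant of
  order \<open>\<langle>k\<rangle>\<^sup>-\<^sup>N\<close> moves \<open>e\<^sub>-\<^sub>k\<close> into this ball.\<close>

lemma poly_growth_fourier_coeff:
  assumes u: "u \<in> distributions"
  shows "poly_growth (fourier_coeff u)"
proof -
  have lin: "clinear_on UNIV u" and cont: "continuous_on UNIV u"
    using u by (auto simp: distributions_def)
  have u0: "u 0 = 0"
    using clinear_onD_scaleC[OF lin, of 0 0] by simp
  have "open (u -` ball 0 1)"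
    using cont by (simp add: continuous_on_open_vimage)
  moreover have "0 \<in> u -` ball 0 1" by (simp add: u0)
  ultimately obtain N e where e: "e > 0" "\<And>\<psi>. test_seminorm N (\<psi> - 0) < e \<Longrightarrow> \<psi> \<in> u -` ball 0 1"
    unfolding open_test_fun_def by blast
  have "norm (fourier_coeff u k) \<le> (2 / e) * jap (rvec k) ^ N" for k
  proof -
    define c where "c = e / (2 * jap (rvec k) ^ N)"
    have J: "0 < jap (rvec k) ^ N" by (simp add: jap_pos)
    then have c: "0 < c" using e by (simp add: c_def)
    have "test_seminorm N (complex_of_real c *\<^sub>C texp (- k)) \<le> c * jap (rvec k) ^ N"
      using test_seminorm_texp_le[of N "complex_of_real c" "- k"] c by (simp add: jap_rvec_minus)
    also have "\<dots> < e" using J e by (simp add: c_def)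
    finally have "norm (u (complex_of_real c *\<^sub>C texp (- k))) < 1"
      using e(2)[of "complex_of_real c *\<^sub>C texp (- k)"] by (simp add: minus_test_fun.rep_eq)
    then have "c * norm (fourier_coeff u k) < 1"
      using clinear_onD_scaleC[OF lin, of "texp (- k)" "complex_of_real c"] c
      by (simp add: fourier_coeff_def norm_scaleC)
    then show ?thesis
      using J e c unfolding c_def by (simp add: field_simps)
  qed
  then show ?thesis by (rule poly_growthI)
qed

section \<open>Trigonometric polynomials and their kernels\<close>

text \<open>With the support as the index set, no finite set of frequencies has to be carried along when the
  coefficients change.\<close>

definition trig_poly :: "(int ^ 'n::finite \<Rightarrow> 'b::complex_normed_vector) \<Rightarrow> real ^ 'n \<Rightarrow> 'b" where
  "trig_poly c x = (\<Sum>k\<in>{k. c k \<noteq> 0}. echar k x *\<^sub>C c k)"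

lemma trig_poly_eq_sum:
  assumes "finite A" "\<And>k. k \<notin> A \<Longrightarrow> c k = 0"
  shows "trig_poly c x = (\<Sum>k\<in>A. echar k x *\<^sub>C c k)"
  unfolding trig_poly_def using assms by (intro sum.mono_neutral_left) auto

lemma finite_support_subset:
  "finite A \<Longrightarrow> (\<And>k. k \<notin> A \<Longrightarrow> c k = 0) \<Longrightarrow> finite {k. c k \<noteq> 0}"
  by (erule rev_finite_subset) auto

lemma norm_trig_poly_le:
  assumes "finite A" "\<And>k. k \<notin> A \<Longrightarrow> c k = 0" "\<And>k. norm (c k) \<le> B"
  shows "norm (trig_poly c x) \<le> real (card A) * B"
proof -
  have "norm (\<Sum>k\<in>A. echar k x *\<^sub>C c k) \<le> real (card A) * B"
    using assms(3) by (intro sum_norm_bound) (simp add: norm_scaleC)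
  then show ?thesis using trig_poly_eq_sum[of A c x] assms(1,2) by simp
qed

text \<open>Summation by parts: a difference of the coefficients in the direction \<open>l\<close> is a multiplication of
  the polynomial with \<open>exp(- i x\<^sub>l) - 1\<close>.\<close>

lemma trig_poly_shift_diff:
  assumes "finite {k. c k \<noteq> 0}"
  shows "trig_poly (shift_diff (axis l 1) c) x = (echar (axis l (-1)) x - 1) *\<^sub>C trig_poly c x"
proof -
  let ?S = "{k. c k \<noteq> 0}" and ?e = "axis l 1 :: int ^ 'a"
  define A where "A = ?S \<union> (\<lambda>k. k - ?e) ` ?S"
  have A: "finite A" using assms by (simp add: A_def)
  have shift: "k \<in> (\<lambda>k. k - ?e) ` ?S \<longleftrightarrow> c (k + ?e) \<noteq> 0" for k
    by (auto simp: image_iff intro!: exI[of _ "k + ?e"])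
  have "trig_poly (shift_diff ?e c) x = (\<Sum>k\<in>A. echar k x *\<^sub>C shift_diff ?e c k)"
    by (rule trig_poly_eq_sum[OF A]) (auto simp: A_def shift shift_diff_def)
  also have "\<dots> = (\<Sum>k\<in>A. echar k x *\<^sub>C c (k + ?e)) - (\<Sum>k\<in>A. echar k x *\<^sub>C c k)"
    by (simp add: shift_diff_def scaleC_diff_right sum_subtractf)
  also have "(\<Sum>k\<in>A. echar k x *\<^sub>C c k) = trig_poly c x"
    by (rule trig_poly_eq_sum[OF A, symmetric]) (auto simp: A_def)
  also have "(\<Sum>k\<in>A. echar k x *\<^sub>C c (k + ?e)) = (\<Sum>k\<in>(\<lambda>k. k - ?e) ` ?S. echar k x *\<^sub>C c (k + ?e))"
    using A by (intro sum.mono_neutral_right) (auto simp: A_def shift)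
  also have "\<dots> = (\<Sum>k\<in>?S. echar (k - ?e) x *\<^sub>C c k)"
    by (subst sum.reindex) (auto simp: inj_on_def)
  also have "\<dots> = (\<Sum>k\<in>?S. echar (axis l (-1)) x *\<^sub>C echar k x *\<^sub>C c k)"
  proof (intro sum.cong refl)
    fix k
    have "k - ?e = axis l (-1) + k" by (simp add: vec_eq_iff axis_def)
    then have "echar (k - ?e) x = echar (axis l (-1)) x * echar k x"
      by (simp only: echar_add)
    then show "echar (k - ?e) x *\<^sub>C c k = echar (axis l (-1)) x *\<^sub>C echar k x *\<^sub>C c k"
      by (simp add: scaleC_scaleC)
  qed
  also have "\<dots> = echar (axis l (-1)) x *\<^sub>C trig_poly c x"
    by (simp add: trig_poly_def scaleC_sum_right)
  finally show ?thesis by (simp add: scaleC_diff_left scaleC_one)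
qed

lemma finite_support_shift_diff:
  assumes "finite {k. c k \<noteq> 0}"
  shows "finite {k. shift_diff h c k \<noteq> 0}"
proof -
  have "{k. shift_diff h c k \<noteq> 0} \<subseteq> {k. c k \<noteq> 0} \<union> (\<lambda>k. k - h) ` {k. c k \<noteq> 0}"
  proof
    fix k assume "k \<in> {k. shift_diff h c k \<noteq> 0}"
    then have "c k \<noteq> 0 \<or> c (k + h) \<noteq> 0" by (auto simp: shift_diff_def)
    then show "k \<in> {k. c k \<noteq> 0} \<union> (\<lambda>k. k - h) ` {k. c k \<noteq> 0}"
      by (auto simp: image_iff intro!: exI[of _ "k + h"])
  qed
  then show ?thesis using assms by (meson finite_UnI finite_imageI finite_subset)
qed

lemma norm_trig_poly_shift_diff_funpow:
  assumes "finite {k. c k \<noteq> 0}"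
  shows "norm (trig_poly ((shift_diff (axis l 1) ^^ N) c) x)
    = cmod (echar (axis l (-1)) x - 1) ^ N * norm (trig_poly c x)"
  using assms
proof (induction N arbitrary: c)
  case (Suc N)
  have "norm (trig_poly ((shift_diff (axis l 1) ^^ N) (shift_diff (axis l 1) c)) x)
      = cmod (echar (axis l (-1)) x - 1) ^ N * norm (trig_poly (shift_diff (axis l 1) c) x)"
    by (intro Suc.IH finite_support_shift_diff Suc.prems)
  then show ?case
    by (simp only: funpow_Suc_apply) (simp add: trig_poly_shift_diff Suc.prems norm_scaleC)
qed simp

definition int_box :: "nat \<Rightarrow> (int ^ 'n::finite) set" where
  "int_box R = {k. \<forall>j. \<bar>k $ j\<bar> \<le> int R}"

lemma int_box: "finite (int_box R :: (int ^ 'n::finite) set)"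
    "card (int_box R :: (int ^ 'n::finite) set) \<le> (2 * R + 1) ^ CARD('n)"
proof -
  let ?P = "PiE (UNIV :: 'n set) (\<lambda>_. {- int R..int R})"
  have sub: "(int_box R :: (int ^ 'n) set) \<subseteq> vec_lambda ` ?P"
  proof
    fix k :: "int ^ 'n" assume k: "k \<in> int_box R"
    have "k $ j \<in> {- int R..int R}" for j
      using k[unfolded int_box_def, simplified, rule_format, of j] by auto
    then have "vec_nth k \<in> ?P" by auto
    then show "k \<in> vec_lambda ` ?P" by (metis imageI vec_nth_inverse)
  qed
  have fin: "finite ?P" by (intro finite_PiE) auto
  show "finite (int_box R :: (int ^ 'n) set)" using sub fin by (meson finite_imageI finite_subset)
  have "card (int_box R :: (int ^ 'n) set) \<le> card ?P"
    using card_mono[OF _ sub] card_image_le[OF fin, of vec_lambda] fin by simp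
  also have "\<dots> = (2 * R + 1) ^ CARD('n)"
    by (simp add: card_PiE nat_add_distrib nat_mult_distrib)
  finally show "card (int_box R :: (int ^ 'n) set) \<le> (2 * R + 1) ^ CARD('n)" .
qed

lemma sin_ge_quarter:
  assumes "0 \<le> u" "u \<le> pi / 2"
  shows "u / 4 \<le> sin u"
proof (cases "u \<le> pi / 3")
  case True
  have "sin 0 - 0 / 4 \<le> sin u - u / 4"
  proof (rule DERIV_nonneg_imp_nondecreasing[OF assms(1)])
    fix x assume x: "0 \<le> x" "x \<le> u"
    have "cos (pi / 3) \<le> cos x"
      using x True by (intro cos_monotone_0_pi_le) auto
    then have "0 \<le> cos x - 1 / 4" by (simp add: cos_60)
    then show "\<exists>y. DERIV (\<lambda>x. sin x - x / 4) x :> y \<and> 0 \<le> y"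
      by (intro exI[of _ "cos x - 1 / 4"]) (auto intro!: derivative_eq_intros)
  qed
  then show ?thesis by simp
next
  case False
  have "u / 4 \<le> 1 / 2" using assms(2) pi_less_4 by simp
  also have "\<dots> \<le> sqrt 3 / 2" by simp
  also have "\<dots> \<le> sin u"
    unfolding sin_60[symmetric] using False assms by (intro sin_monotone_2pi_le) auto
  finally show ?thesis .
qed

text \<open>Differences of points of the cube fill \<open>[-2\<pi>, 2\<pi>]\<^sup>n\<close>, and in \<open>[-2\<pi>, 2\<pi>]\<close> the function \<open>exp(- i t) - 1\<close>
  has the three zeros \<open>a\<close>.\<close>

lemma cmod_echar_axis_ge:
  assumes "\<bar>x $ l\<bar> \<le> 2 * pi"
  shows "\<exists>a\<in>{- 2 * pi, 0, 2 * pi}. \<bar>x $ l - a\<bar> / 4 \<le> cmod (echar (axis l (-1)) x - 1)"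
proof -
  define t where "t = x $ l"
  have eq: "cmod (echar (axis l (-1)) x - 1) = 2 * \<bar>sin (t / 2)\<bar>"
  proof -
    have "rvec (axis l (-1)) \<bullet> x = - t"
      unfolding rvec_axis by (simp add: inner_axis' t_def)
    then show ?thesis
      using dist_exp_i_1[of "- t"] by (simp add: echar_eq)
  qed
  have near: "\<bar>s\<bar> / 4 \<le> 2 * \<bar>sin (s / 2)\<bar>" if "\<bar>s\<bar> \<le> pi" for s
    using sin_ge_quarter[of "\<bar>s\<bar> / 2"] that by (auto simp: abs_if split: if_splits)
  consider "\<bar>t\<bar> \<le> pi" | "\<bar>t - 2 * pi\<bar> \<le> pi" | "\<bar>t + 2 * pi\<bar> \<le> pi"
    using assms unfolding t_def by linarith
  then show ?thesis
  proof cases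
    case 1
    then show ?thesis using near[of t] by (auto simp: eq t_def)
  next
    case 2
    have "\<bar>sin ((t - 2 * pi) / 2)\<bar> = \<bar>sin (t / 2)\<bar>"
      by (simp add: diff_divide_distrib sin_diff)
    then show ?thesis using near[OF 2] by (auto simp: eq t_def)
  next
    case 3
    have "\<bar>sin ((t + 2 * pi) / 2)\<bar> = \<bar>sin (t / 2)\<bar>"
      by (simp add: add_divide_distrib)
    then show ?thesis using near[OF 3] by (auto simp: eq t_def)
  qed
qed

text \<open>The majorant of the kernels at frequency \<open>L\<close> is a product of functions of one variable, each
  concentrated at the scale \<open>1 / L\<close> around the multiples of \<open>2\<pi>\<close> in \<open>[-2\<pi>, 2\<pi>]\<close>. The exponent
  \<open>1 + 1/n = (n + 1)/n\<close> spreads the decay of order \<open>n + 1\<close> evenly over the \<open>n\<close> coordinates and leaves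
  each factor integrable. The factor \<open>L\<^sup>n\<close> makes the integral independent of \<open>L\<close>.\<close>

definition decay1 :: "nat \<Rightarrow> real \<Rightarrow> real \<Rightarrow> real" where
  "decay1 n L t = (\<Sum>a\<in>{- 2 * pi, 0, 2 * pi}. (1 + L * \<bar>t - a\<bar>) powr (- (1 + 1 / real n)))"

definition kernel_majorant :: "real \<Rightarrow> real ^ 'n::finite \<Rightarrow> real" where
  "kernel_majorant L z = L ^ CARD('n) * (\<Prod>l\<in>UNIV. decay1 CARD('n) L (z $ l))"

lemma decay1_nonneg: "0 \<le> decay1 n L t"
  unfolding decay1_def by (intro sum_nonneg) auto

lemma kernel_majorant_nonneg: "0 \<le> L \<Longrightarrow> 0 \<le> kernel_majorant L z"
  unfolding kernel_majorant_def by (intro mult_nonneg_nonneg prod_nonneg) (auto simp: decay1_nonneg)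

lemma borel_measurable_decay1 [measurable]: "decay1 n L \<in> borel_measurable borel"
  unfolding decay1_def[abs_def] by measurable

lemma borel_measurable_kernel_majorant [measurable]: "kernel_majorant L \<in> borel_measurable borel"
  unfolding kernel_majorant_def[abs_def] by measurable

lemma nn_integral_powr_half_line:
  assumes "0 < n"
  shows "(\<integral>\<^sup>+t. ennreal ((1 + t) powr (- (1 + 1 / real n))) * indicator {0..} t \<partial>lborel) = ennreal (real n)"
proof -
  let ?F = "\<lambda>t. - real n * (1 + t) powr (- (1 / real n))"
  have "(\<integral>\<^sup>+t. ennreal ((1 + t) powr (- (1 + 1 / real n))) * indicator {0..} t \<partial>lborel) = ennreal (0 - ?F 0)"
  proof (rule nn_integral_FTC_atLeast[where F = ?F])
    fix t :: real assume t: "0 \<le> t"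
    have "- (1 / real n) - 1 = - (1 + 1 / real n)" by simp
    moreover have "DERIV (\<lambda>t. 1 + t) t :> 1" by (auto intro!: derivative_eq_intros)
    from DERIV_cmult[OF DERIV_fun_powr[OF this, of "- (1 / real n)"], of "- real n"]
    have "DERIV ?F t :> (1 + t) powr (- (1 / real n) - 1)"
      using t assms by simp
    ultimately show "DERIV ?F t :> (1 + t) powr (- (1 + 1 / real n))" by (simp only:)
  next
    have "((\<lambda>t. (1 + t) powr (- (1 / real n))) \<longlongrightarrow> 0) at_top"
      using assms by (intro tendsto_neg_powr filterlim_tendsto_add_at_top[OF tendsto_const] filterlim_ident) auto
    from tendsto_mult_right_zero[OF this, of "- real n"]
    show "(?F \<longlongrightarrow> 0) at_top" .
  qed auto
  then show ?thesis by simp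
qed

lemma nn_integral_powr_line_le:
  assumes "0 < n" "0 < L"
  shows "(\<integral>\<^sup>+t. ennreal ((1 + L * \<bar>t - a\<bar>) powr (- (1 + 1 / real n))) \<partial>lborel) \<le> ennreal (2 * real n / L)"
proof -
  let ?r = "- (1 + 1 / real n)"
  define g where "g = (\<lambda>t. ennreal ((1 + t) powr ?r) * indicator {0..} t)"
  have [measurable]: "g \<in> borel_measurable borel" unfolding g_def by measurable
  have g: "(\<integral>\<^sup>+t. g t \<partial>lborel) = ennreal (real n)"
    unfolding g_def by (rule nn_integral_powr_half_line[OF assms(1)])
  have g': "(\<integral>\<^sup>+t. g (- t) \<partial>lborel) = ennreal (real n)"
    using nn_integral_real_affine[of g "-1" 0] g by simp
  have "(\<integral>\<^sup>+t. ennreal ((1 + \<bar>t\<bar>) powr ?r) \<partial>lborel) \<le> (\<integral>\<^sup>+t. g t + g (- t) \<partial>lborel)"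
    by (intro nn_integral_mono) (auto simp: g_def abs_if)
  also have "\<dots> = ennreal (real n) + ennreal (real n)"
    by (subst nn_integral_add) (auto simp: g g')
  also have "\<dots> = ennreal (2 * real n)"
    by (simp flip: ennreal_plus)
  finally have le: "(\<integral>\<^sup>+t. ennreal ((1 + \<bar>t\<bar>) powr ?r) \<partial>lborel) \<le> ennreal (2 * real n)" .
  have "(\<integral>\<^sup>+t. ennreal ((1 + \<bar>t\<bar>) powr ?r) \<partial>lborel)
      = ennreal L * (\<integral>\<^sup>+t. ennreal ((1 + \<bar>- L * a + L * t\<bar>) powr ?r) \<partial>lborel)"
    using nn_integral_real_affine[of "\<lambda>t. ennreal ((1 + \<bar>t\<bar>) powr ?r)" L "- L * a"] assms(2) by simp
  also have "(\<lambda>t. ennreal ((1 + \<bar>- L * a + L * t\<bar>) powr ?r)) = (\<lambda>t. ennreal ((1 + L * \<bar>t - a\<bar>) powr ?r))"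
  proof
    fix t
    have "\<bar>- L * a + L * t\<bar> = \<bar>L * (t - a)\<bar>" by (simp add: algebra_simps)
    then show "ennreal ((1 + \<bar>- L * a + L * t\<bar>) powr ?r) = ennreal ((1 + L * \<bar>t - a\<bar>) powr ?r)"
      using assms(2) by (simp add: abs_mult)
  qed
  finally have "ennreal L * (\<integral>\<^sup>+t. ennreal ((1 + L * \<bar>t - a\<bar>) powr ?r) \<partial>lborel) \<le> ennreal (2 * real n)"
    using le by simp
  from mult_left_mono[OF this, of "ennreal (1 / L)"] show ?thesis
    using assms by (simp flip: mult.assoc ennreal_mult)
qed

lemma nn_integral_decay1_le:
  assumes "0 < n" "0 < L"
  shows "(\<integral>\<^sup>+t. ennreal (decay1 n L t) \<partial>lborel) \<le> ennreal (6 * real n / L)"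
proof -
  have "(\<integral>\<^sup>+t. ennreal (decay1 n L t) \<partial>lborel)
    = (\<Sum>a\<in>{- 2 * pi, 0, 2 * pi}. \<integral>\<^sup>+t. ennreal ((1 + L * \<bar>t - a\<bar>) powr (- (1 + 1 / real n))) \<partial>lborel)"
    unfolding decay1_def by (subst nn_integral_sum[symmetric]) (auto simp: sum_ennreal)
  also have "\<dots> \<le> (\<Sum>a\<in>{- 2 * pi, 0, 2 * pi}. ennreal (2 * real n / L))"
    by (intro sum_mono nn_integral_powr_line_le assms)
  also have "\<dots> = ennreal (\<Sum>a\<in>{- 2 * pi, 0, 2 * pi}. 2 * real n / L)"
    using assms by (intro sum_ennreal) auto
  also have "(\<Sum>a\<in>{- 2 * pi, 0, 2 * pi}. 2 * real n / L) = 6 * real n / L"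
  proof -
    have "card {- 2 * pi, 0, 2 * pi} = 3" using pi_gt_zero by (simp add: card_insert_if)
    then show ?thesis by (simp only: sum_constant)
  qed
  finally show ?thesis .
qed

lemma nn_integral_kernel_majorant_le:
  assumes "0 < L"
  shows "(\<integral>\<^sup>+z. ennreal (kernel_majorant L (z :: real ^ 'n::finite)) \<partial>lborel) \<le> ennreal ((6 * real CARD('n)) ^ CARD('n))"
proof -
  let ?n = "CARD('n)"
  have basis: "(\<Prod>b\<in>(Basis :: (real ^ 'n) set). h b) = (\<Prod>l\<in>(UNIV :: 'n set). h (axis l 1))" for h :: "real ^ 'n \<Rightarrow> ennreal"
  proof -
    have bs: "(Basis :: (real ^ 'n) set) = range (\<lambda>l :: 'n. axis l 1)" by (auto simp: Basis_vec_def)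
    have "inj (\<lambda>l :: 'n. axis l (1 :: real))" by (auto simp: inj_on_def axis_eq_axis)
    from prod.reindex[OF this, of h] show ?thesis by (simp add: bs)
  qed
  have eq: "ennreal (kernel_majorant L z) = ennreal (L ^ ?n) * (\<Prod>b\<in>Basis. ennreal (decay1 ?n L (z \<bullet> b)))" for z :: "real ^ 'n"
    unfolding kernel_majorant_def basis using assms
    by (subst ennreal_mult) (auto simp: prod_ennreal decay1_nonneg inner_axis intro!: prod_nonneg)
  have "(\<integral>\<^sup>+z. ennreal (kernel_majorant L (z :: real ^ 'n)) \<partial>lborel)
      = ennreal (L ^ ?n) * (\<Prod>b\<in>(Basis :: (real ^ 'n) set). \<integral>\<^sup>+t. ennreal (decay1 ?n L t) \<partial>lborel)"
  proof -
    have "(\<integral>\<^sup>+z. (\<Prod>b\<in>Basis. ennreal (decay1 ?n L ((z :: real ^ 'n) \<bullet> b))) \<partial>lborel)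
        = (\<Prod>b\<in>(Basis :: (real ^ 'n) set). \<integral>\<^sup>+t. ennreal (decay1 ?n L t) \<partial>lborel)"
      by (rule nn_integral_lborel_prod) auto
    moreover have "(\<lambda>z :: real ^ 'n. \<Prod>b\<in>Basis. ennreal (decay1 ?n L (z \<bullet> b))) \<in> borel_measurable lborel"
      by (intro borel_measurable_prod_ennreal) measurable
    from nn_integral_cmult[OF this, of "ennreal (L ^ ?n)"]
    have "(\<integral>\<^sup>+z. ennreal (kernel_majorant L (z :: real ^ 'n)) \<partial>lborel)
      = ennreal (L ^ ?n) * (\<integral>\<^sup>+z. (\<Prod>b\<in>Basis. ennreal (decay1 ?n L ((z :: real ^ 'n) \<bullet> b))) \<partial>lborel)"
      unfolding eq .
    ultimately show ?thesis by (rule trans[OF _ arg_cong, rotated])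
  qed
  also have "\<dots> \<le> ennreal (L ^ ?n) * (\<Prod>b\<in>(Basis :: (real ^ 'n) set). ennreal (6 * real ?n / L))"
    by (intro mult_left_mono prod_mono_ennreal nn_integral_decay1_le assms) auto
  also have "\<dots> = ennreal (L ^ ?n * (6 * real ?n / L) ^ ?n)"
    using assms by (simp add: ennreal_mult ennreal_power)
  also have "L ^ ?n * (6 * real ?n / L) ^ ?n = (6 * real ?n) ^ ?n"
    using assms by (simp add: power_divide)
  finally show ?thesis .
qed

lemma nn_integral_lborel_reflect:
  fixes f :: "'a::euclidean_space \<Rightarrow> ennreal"
  assumes [measurable]: "f \<in> borel_measurable borel"
  shows "(\<integral>\<^sup>+y. f (x - y) \<partial>lborel) = (\<integral>\<^sup>+y. f y \<partial>lborel)"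
    and "(\<integral>\<^sup>+y. f (y - x) \<partial>lborel) = (\<integral>\<^sup>+y. f y \<partial>lborel)"
proof -
  have "(\<integral>\<^sup>+y. f y \<partial>lborel) = (\<integral>\<^sup>+y. f y \<partial>(distr lborel borel (\<lambda>y. x + (-1) *\<^sub>R y)))"
    by (subst (1) lborel_affine[of "-1" x]) (simp_all add: density_1)
  also have "\<dots> = (\<integral>\<^sup>+y. f (x - y) \<partial>lborel)"
    by (subst nn_integral_distr) auto
  finally show "(\<integral>\<^sup>+y. f (x - y) \<partial>lborel) = (\<integral>\<^sup>+y. f y \<partial>lborel)" by simp
  have "(\<integral>\<^sup>+y. f y \<partial>lborel) = (\<integral>\<^sup>+y. f y \<partial>(distr lborel borel ((+) (- x))))"
    by (simp only: lborel_distr_plus)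
  also have "\<dots> = (\<integral>\<^sup>+y. f (y - x) \<partial>lborel)"
    by (subst nn_integral_distr) auto
  finally show "(\<integral>\<^sup>+y. f (y - x) \<partial>lborel) = (\<integral>\<^sup>+y. f y \<partial>lborel)" by simp
qed

text \<open>Young's inequality for the convolution with the majorant. The majorant is not periodic, but its
  integral over \<open>\<real>\<^sup>n\<close> bounds the integrals over all translates and reflections of the cube.\<close>

lemma Lp_enorm_convolution_le:
  fixes F :: "real ^ 'n::finite \<Rightarrow> ennreal"
  assumes "1 \<le> p" "0 < L" "0 < A" and [measurable]: "F \<in> borel_measurable borel"
  shows "Lp_enorm torus p (\<lambda>x. \<integral>\<^sup>+y. ennreal (A * kernel_majorant L (x - y)) * F y \<partial>torus)
    \<le> ennreal (A * (6 * real CARD('n)) ^ CARD('n)) * Lp_enorm torus p F"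
proof -
  let ?M = "(6 * real CARD('n)) ^ CARD('n)"
  let ?k = "\<lambda>(x, y). ennreal (A * kernel_majorant L (x - y :: real ^ 'n))"
  have split: "ennreal (A * kernel_majorant L z) = ennreal A * ennreal (kernel_majorant L z)" for z :: "real ^ 'n"
    using assms by (intro ennreal_mult kernel_majorant_nonneg) auto
  have mass: "(\<integral>\<^sup>+y. ennreal (A * kernel_majorant L (h y)) \<partial>torus) \<le> ennreal (A * ?M)"
    if [measurable]: "h \<in> borel_measurable borel"
      and h: "(\<integral>\<^sup>+y. ennreal (kernel_majorant L (h y)) \<partial>lborel) = (\<integral>\<^sup>+y. ennreal (kernel_majorant L (y :: real ^ 'n)) \<partial>lborel)"
    for h :: "real ^ 'n \<Rightarrow> real ^ 'n"
  proof -
    have "(\<integral>\<^sup>+y. ennreal (A * kernel_majorant L (h y)) \<partial>torus)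
        \<le> (\<integral>\<^sup>+y. ennreal (A * kernel_majorant L (h y)) * indicator cube y \<partial>lborel)"
      by (rule nn_integral_torus_le) measurable
    also have "\<dots> \<le> (\<integral>\<^sup>+y. ennreal A * ennreal (kernel_majorant L (h y)) \<partial>lborel)"
      unfolding split by (intro nn_integral_mono) (auto split: split_indicator)
    also have "\<dots> = ennreal A * (\<integral>\<^sup>+y. ennreal (kernel_majorant L (y :: real ^ 'n)) \<partial>lborel)"
      by (subst nn_integral_cmult) (auto simp: h)
    also have "\<dots> \<le> ennreal A * ennreal ?M"
      by (intro mult_left_mono nn_integral_kernel_majorant_le assms) auto
    finally show ?thesis using assms by (simp add: ennreal_mult)
  qed
  have "Lp_enorm torus p (\<lambda>x. \<integral>\<^sup>+y. ?k (x, y) * F y \<partial>torus) \<le> ennreal (A * ?M) * Lp_enorm torus p F"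
  proof (rule Schur_test)
    show "sigma_finite_measure (torus :: (real ^ 'n) measure)"
      using finite_measure_torus by (rule finite_measure.axioms)
    show "?k \<in> borel_measurable (torus \<Otimes>\<^sub>M torus)" by measurable
    have "(\<integral>\<^sup>+y. ennreal (A * kernel_majorant L (x - y)) \<partial>torus) \<le> ennreal (A * ?M)" for x :: "real ^ 'n"
      by (rule mass[OF _ nn_integral_lborel_reflect(1)]) measurable
    then show "AE x in torus. (\<integral>\<^sup>+y. ?k (x, y) \<partial>torus) \<le> ennreal (A * ?M)"
      by (intro AE_I2) (simp only: prod.case)
    have "(\<integral>\<^sup>+x. ennreal (A * kernel_majorant L (x - y)) \<partial>torus) \<le> ennreal (A * ?M)" for y :: "real ^ 'n"
      by (rule mass[OF _ nn_integral_lborel_reflect(2)]) measurable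
    then show "AE y in torus. (\<integral>\<^sup>+x. ?k (x, y) \<partial>torus) \<le> ennreal (A * ?M)"
      by (intro AE_I2) (simp only: prod.case)
  qed (use assms in auto)
  then show ?thesis by simp
qed

text \<open>The kernel of a symbol at frequency \<open>L\<close> that satisfies the estimates of orders \<open>0\<close> and
  \<open>N = n + 1\<close>. The first bounds the kernel by a multiple of \<open>L\<^sup>n\<close>, the second by the same multiple of
  \<open>L\<^sup>n \<tau>\<^sub>l\<^bsup>-N\<^esup>\<close>, where \<open>\<tau>\<^sub>l = L \<bar>exp(- i z\<^sub>l) - 1\<bar>\<close>. With the largest \<open>\<tau>\<^sub>l\<close>, called \<open>m\<close>, both say that it is of order
  \<open>L\<^sup>n (1 + m)\<^bsup>-N\<^esup>\<close>, and \<open>(1 + m)\<^sup>N\<close> is at least the product of all \<open>(1 + \<tau>\<^sub>l)\<^bsup>N/n\<^esup>\<close>.\<close>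

lemma norm_trig_poly_le_kernel_majorant:
  fixes c :: "int ^ 'n::finite \<Rightarrow> 'b::complex_normed_vector" and j :: nat
  defines "N \<equiv> CARD('n) + 1" and "L \<equiv> 2 ^ j :: real"
  assumes supp: "\<And>k. 2 * L < norm (rvec k) \<Longrightarrow> c k = 0"
    and B0: "\<And>k. norm (c k) \<le> B"
    and BN: "\<And>k l. norm ((shift_diff (axis l 1) ^^ N) c k) \<le> B / L ^ N"
    and z: "\<And>l. \<bar>z $ l\<bar> \<le> 2 * pi"
  shows "norm (trig_poly c z) \<le> (2 ^ N * 16 ^ CARD('n) * real (5 + 2 * N) ^ CARD('n)) * B * kernel_majorant L z"
proof -
  let ?n = "CARD('n)"
  \<comment> \<open>a difference of order \<open>N\<close> enlarges the support by at most \<open>N\<close> in each coordinate\<close>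
  define R where "R = 2 * 2 ^ j + N"
  define r where "r = 1 + 1 / real ?n"
  have r: "0 \<le> r" "r \<le> 2" by (simp_all add: r_def divide_le_eq_1)
  define P where "P = norm (trig_poly c z)"
  define Q where "Q = real (5 + 2 * N) ^ ?n * L ^ ?n * B"
  define \<tau> where "\<tau> = (\<lambda>l. L * cmod (echar (axis l (-1)) z - 1))"
  have L: "1 \<le> L" by (simp add: L_def)
  have B: "0 \<le> B" using B0 norm_ge_zero order_trans by blast
  have zero: "c k = 0" if k: "k \<notin> int_box (2 * 2 ^ j)" for k
  proof (rule supp)
    obtain l where "int (2 * 2 ^ j) < \<bar>k $ l\<bar>" using k by (auto simp: int_box_def not_le)
    then have "real_of_int (int (2 * 2 ^ j)) < \<bar>rvec k $ l\<bar>"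
      by (simp only: rvec_def vec_lambda_beta of_int_abs[symmetric] of_int_less_iff)
    also have "\<dots> \<le> norm (rvec k)" by (rule component_le_norm_cart)
    finally show "2 * L < norm (rvec k)" by (simp add: L_def)
  qed
  have fin: "finite {k. c k \<noteq> 0}"
    using int_box(1)[of "2 * 2 ^ j"] zero by (rule finite_support_subset)
  have zeroN: "(shift_diff (axis l 1) ^^ N) c k = 0" if k: "k \<notin> int_box R" for k l
  proof (rule shift_diff_funpow_eq_0)
    fix i assume i: "i \<le> N"
    have shift: "((\<lambda>y. y + axis l 1) ^^ i) k = k + axis l (int i)"
      by (induction i) (auto simp: vec_eq_iff axis_def)
    obtain l' where l': "int R < \<bar>k $ l'\<bar>" using k by (auto simp: int_box_def not_le)
    have "int (2 * 2 ^ j) < \<bar>(k + axis l (int i)) $ l'\<bar>"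
      using l' i by (auto simp: R_def axis_def)
    then have "k + axis l (int i) \<notin> int_box (2 * 2 ^ j)" by (auto simp: int_box_def not_le)
    then show "c (((\<lambda>y. y + axis l 1) ^^ i) k) = 0" unfolding shift by (rule zero)
  qed
  have card: "real (card (int_box R :: (int ^ 'n) set)) \<le> real (5 + 2 * N) ^ ?n * L ^ ?n"
  proof -
    have "card (int_box R :: (int ^ 'n) set) \<le> ((5 + 2 * N) * 2 ^ j) ^ ?n"
    proof (rule order_trans[OF int_box(2)])
      obtain q :: nat where q: "2 ^ j = Suc q" using not0_implies_Suc[of "2 ^ j :: nat"] by auto
      have "2 * R + 1 \<le> (5 + 2 * N) * 2 ^ j"
        unfolding R_def q by simp
      then show "(2 * R + 1) ^ ?n \<le> ((5 + 2 * N) * 2 ^ j) ^ ?n"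
        by (rule power_mono) simp
    qed
    then have "real (card (int_box R :: (int ^ 'n) set)) \<le> real (((5 + 2 * N) * 2 ^ j) ^ ?n)"
      by (simp only: of_nat_le_iff)
    then show ?thesis by (simp add: L_def power_mult_distrib)
  qed
  have sub: "c k = 0" if "k \<notin> int_box R" for k
    using that by (intro zero) (auto simp: int_box_def R_def intro: order_trans)
  have P0: "0 \<le> P" by (simp add: P_def)
  have PQ: "P \<le> Q"
  proof -
    have "P \<le> real (card (int_box R :: (int ^ 'n) set)) * B"
      unfolding P_def by (rule norm_trig_poly_le[OF int_box(1) sub B0])
    also have "\<dots> \<le> Q" unfolding Q_def by (intro mult_right_mono card B)
    finally show ?thesis .
  qed
  have PQN: "P * \<tau> l ^ N \<le> Q" for l
  proof -
    have "cmod (echar (axis l (-1)) z - 1) ^ N * P \<le> real (card (int_box R :: (int ^ 'n) set)) * (B / L ^ N)"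
      unfolding P_def norm_trig_poly_shift_diff_funpow[OF fin, symmetric]
      by (rule norm_trig_poly_le[OF int_box(1) zeroN BN])
    also have "\<dots> \<le> real (5 + 2 * N) ^ ?n * L ^ ?n * (B / L ^ N)"
      using B L by (intro mult_right_mono card) auto
    finally have "L ^ N * (cmod (echar (axis l (-1)) z - 1) ^ N * P) \<le> L ^ N * (real (5 + 2 * N) ^ ?n * L ^ ?n * (B / L ^ N))"
      using L by (intro mult_left_mono) auto
    then show ?thesis
      using L by (simp add: Q_def \<tau>_def power_mult_distrib mult_ac)
  qed
  have Q0: "0 \<le> Q" using P0 PQ by simp
  define m where "m = Max (range \<tau>)"
  have m: "\<tau> l \<le> m" for l by (simp add: m_def)
  have \<tau>0: "0 \<le> \<tau> l" for l using L by (simp add: \<tau>_def)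
  have m0: "0 \<le> m" using m \<tau>0 order_trans by blast
  have "P * (1 + m) ^ N \<le> 2 ^ N * Q"
  proof (cases "m \<le> 1")
    case True
    then have "(1 + m) ^ N \<le> 2 ^ N" using m0 by (intro power_mono) auto
    then have "P * (1 + m) ^ N \<le> Q * 2 ^ N" using PQ P0 Q0 m0 by (intro mult_mono) auto
    then show ?thesis by (simp add: mult.commute)
  next
    case False
    have "m \<in> range \<tau>" unfolding m_def by (intro Max_in) auto
    then obtain l where l: "m = \<tau> l" by blast
    have "(1 + m) ^ N \<le> (2 * m) ^ N" using False m0 by (intro power_mono) auto
    then have "P * (1 + m) ^ N \<le> P * (2 * m) ^ N" using P0 by (intro mult_left_mono)
    also have "\<dots> = 2 ^ N * (P * \<tau> l ^ N)" by (simp add: l power_mult_distrib)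
    also have "\<dots> \<le> 2 ^ N * Q" by (intro mult_left_mono PQN) auto
    finally show ?thesis .
  qed
  moreover have "(\<Prod>l\<in>UNIV. (1 + \<tau> l) powr r) \<le> (1 + m) ^ N"
  proof -
    have "(\<Prod>l\<in>UNIV. (1 + \<tau> l) powr r) \<le> (\<Prod>l\<in>(UNIV :: 'n set). (1 + m) powr r)"
      using m \<tau>0 by (intro prod_mono conjI powr_mono2) (auto simp: r_def)
    also have "\<dots> = ((1 + m) powr r) powr real ?n"
      using m0 by (simp add: powr_realpow)
    also have "\<dots> = (1 + m) powr real N"
    proof -
      have "r * real ?n = real N" by (simp add: r_def N_def distrib_right)
      then show ?thesis by (simp only: powr_powr)
    qed
    also have "\<dots> = (1 + m) ^ N"
      using m0 by (intro powr_realpow) auto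
    finally show ?thesis .
  qed
  ultimately have le: "P * (\<Prod>l\<in>UNIV. (1 + \<tau> l) powr r) \<le> 2 ^ N * Q"
    using mult_left_mono P0 order_trans by blast
  have "P \<le> 2 ^ N * Q * (\<Prod>l\<in>UNIV. (1 + \<tau> l) powr (- r))"
  proof -
    have pos: "0 < (\<Prod>l\<in>UNIV. (1 + \<tau> l) powr r)"
      using \<tau>0 by (intro prod_pos) (auto intro: add_pos_nonneg simp: less_eq_real_def add_nonneg_eq_0_iff)
    have "(\<Prod>l\<in>UNIV. (1 + \<tau> l) powr (- r)) = inverse (\<Prod>l\<in>UNIV. (1 + \<tau> l) powr r)"
      by (simp add: powr_minus prod_inversef[symmetric, unfolded comp_def])
    then show ?thesis
      using le pos by (simp add: field_simps)
  qed
  also have "\<dots> \<le> 2 ^ N * Q * (\<Prod>l\<in>UNIV. 16 * decay1 ?n L (z $ l))"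
  proof (intro mult_left_mono prod_mono conjI)
    fix l
    obtain a where a: "a \<in> {- 2 * pi, 0, 2 * pi}" "\<bar>z $ l - a\<bar> / 4 \<le> cmod (echar (axis l (-1)) z - 1)"
      using cmod_echar_axis_ge[OF z] by blast
    have "L * (\<bar>z $ l - a\<bar> / 4) \<le> \<tau> l"
      unfolding \<tau>_def using a(2) L by (intro mult_left_mono) auto
    then have le: "(1 + L * \<bar>z $ l - a\<bar>) / 4 \<le> 1 + \<tau> l" by simp
    have pos: "0 < 1 + L * \<bar>z $ l - a\<bar>" using L by (intro add_pos_nonneg) auto
    have "(1 + \<tau> l) powr (- r) \<le> ((1 + L * \<bar>z $ l - a\<bar>) / 4) powr (- r)"
      using le pos r by (intro powr_mono2') auto
    also have "\<dots> = 4 powr r * (1 + L * \<bar>z $ l - a\<bar>) powr (- r)"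
      using pos by (simp add: powr_divide powr_minus field_simps)
    also have "\<dots> \<le> 16 * (1 + L * \<bar>z $ l - a\<bar>) powr (- r)"
    proof (rule mult_right_mono)
      have "4 powr r \<le> 4 powr 2" using r by (intro powr_mono) auto
      then show "4 powr r \<le> 16" by simp
    qed simp
    also have "(1 + L * \<bar>z $ l - a\<bar>) powr (- r) \<le> decay1 ?n L (z $ l)"
      unfolding decay1_def r_def
      by (rule member_le_sum[OF a(1), where f = "\<lambda>a. (1 + L * \<bar>z $ l - a\<bar>) powr (- (1 + 1 / real ?n))"]) auto
    finally show "(1 + \<tau> l) powr (- r) \<le> 16 * decay1 ?n L (z $ l)" by simp
  qed (use Q0 in auto)
  also have "\<dots> = (2 ^ N * 16 ^ ?n * real (5 + 2 * N) ^ ?n) * B * kernel_majorant L z"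
    by (simp add: Q_def kernel_majorant_def prod.distrib mult_ac)
  finally show ?thesis by (simp only: P_def)
qed

section \<open>Fourier multipliers on Lebesgue spaces\<close>

lemma represents_fourier_series_finite:
  fixes c :: "int ^ 'n::finite \<Rightarrow> 'e::complex_banach"
  assumes "finite A" "\<And>k. k \<notin> A \<Longrightarrow> c k = 0"
  shows "represents (\<lambda>x. \<Sum>k\<in>A. echar k x *\<^sub>C c k) (fourier_series c)"
  unfolding represents_def
proof (intro conjI allI)
  show "periodic (\<lambda>x. \<Sum>k\<in>A. echar k x *\<^sub>C c k)"
    by (simp add: periodic_def periodic_test_fun[unfolded periodic_def, rule_format])
  fix \<phi> :: "'n test_fun"
  have "has_bochner_integral_strong torus (\<lambda>x. (echar k x * Rep_test_fun \<phi> x) *\<^sub>C c k)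
      (fourier_coeff_test \<phi> (- k) *\<^sub>C c k)" for k
    unfolding fourier_coeff_test_def minus_minus
    by (intro has_bochner_integral_strong_linear[OF bounded_linear_scaleC_left]
        has_bochner_integral_imp_strong has_bochner_integral_integrable integrable_echar_mult
        continuous_on_test_fun)
  then have "has_bochner_integral_strong torus (\<lambda>x. \<Sum>k\<in>A. (echar k x * Rep_test_fun \<phi> x) *\<^sub>C c k)
      (\<Sum>k\<in>A. fourier_coeff_test \<phi> (- k) *\<^sub>C c k)"
    by (intro has_bochner_integral_strong_sum assms(1))
  then show "has_bochner_integral_strong torus (\<lambda>x. Rep_test_fun \<phi> x *\<^sub>C (\<Sum>k\<in>A. echar k x *\<^sub>C c k))
      (fourier_series c \<phi>)"
    using fourier_series_finite[of A c \<phi>] assms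
    by (simp add: scaleC_sum_right scaleC_scaleC mult.commute)
qed

lemma represents_strongly_measurable:
  assumes "represents f u" shows "strongly_measurable torus f"
proof -
  have "has_bochner_integral_strong torus (\<lambda>x. echar 0 x *\<^sub>C f x) (u (texp 0))"
    using assms by (simp only: represents_def)
  from has_bochner_integral_strong_strongly_measurable[OF this] show ?thesis
    by (simp add: scaleC_one)
qed

lemma represents_norm_AE:
  assumes "represents f u"
  obtains F :: "real ^ 'n::finite \<Rightarrow> real" where "F \<in> borel_measurable borel" "\<forall>x. 0 \<le> F x"
    "AE x in torus. norm (f x) = F x"
proof -
  obtain F :: "real ^ 'n \<Rightarrow> real" where "F \<in> borel_measurable torus" "\<forall>x. 0 \<le> F x"
    "AE x in torus. norm (f x) = F x"
    using strongly_measurable_norm_AE[OF represents_strongly_measurable[OF assms]] by blast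
  then show ?thesis
    by (intro that[of F]) (simp_all add: measurable_cong_sets[OF sets_torus refl])
qed

lemma represents_zero: "represents (\<lambda>x. 0) (\<lambda>\<phi>. 0)"
  by (simp add: represents_def periodic_def has_bochner_integral_strong_zero)

lemma represents_add:
  "represents f u \<Longrightarrow> represents g v \<Longrightarrow> represents (\<lambda>x. f x + g x) (u + v)"
  by (simp add: represents_def periodic_def scaleC_add_right plus_fun_def
      has_bochner_integral_strong_add)

lemma represents_scaleC:
  assumes "represents f u" shows "represents (\<lambda>x. c *\<^sub>C f x) (c *\<^sub>C u)"
proof -
  have "has_bochner_integral_strong torus (\<lambda>x. c *\<^sub>C Rep_test_fun \<phi> x *\<^sub>C f x) (c *\<^sub>C u \<phi>)" for \<phi>
    using assms by (intro has_bochner_integral_strong_linear[OF bounded_linear_scaleC]) (simp add: represents_def)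
  then show ?thesis
    using assms by (simp add: represents_def periodic_def scaleC_fun_def scaleC_scaleC mult.commute)
qed

lemma Lp_distr_enorm_le: "represents f u \<Longrightarrow> Lp_distr_enorm p u \<le> Lp_enorm torus p (\<lambda>x. ennreal (norm (f x)))"
  unfolding Lp_distr_enorm_def by (rule INF_lower) simp

lemma Lp_distr_enorm_zero:
  assumes "1 \<le> p" shows "Lp_distr_enorm p (\<lambda>\<phi>. 0) = 0"
proof -
  have "Lp_distr_enorm p (\<lambda>\<phi>. 0) \<le> 0"
    using Lp_distr_enorm_le[OF represents_zero, of p] unfolding norm_zero ennreal_0 Lp_enorm_zero[OF assms] .
  then show ?thesis by simp
qed

text \<open>For estimates of a sum by two norms of distributions, which are infima over independent choices
  of representing functions.\<close>

lemma Inf_plus_Inf_ge_ennreal: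
  fixes S T :: "ennreal set"
  assumes "\<And>s t. s \<in> S \<Longrightarrow> t \<in> T \<Longrightarrow> Y \<le> s + t"
  shows "Y \<le> Inf S + Inf T"
proof -
  have *: "Y \<le> s + Inf T" if "\<And>t. t \<in> T \<Longrightarrow> Y \<le> s + t" for s and T :: "ennreal set"
  proof (cases "s = top")
    case False
    have "Y - s \<le> Inf T"
      using that False by (intro Inf_greatest) (simp add: ennreal_minus_le_iff)
    then show ?thesis using False by (simp add: ennreal_minus_le_iff)
  qed simp
  have "Y \<le> s + Inf T" if "s \<in> S" for s
    using assms that by (intro *) auto
  then have "Y \<le> Inf T + s" if "s \<in> S" for s
    using that by (simp add: add.commute)
  from *[of S "Inf T", OF this] show ?thesis by (simp add: add.commute)
qed

lemma Lp_distr_enorm_le_cmult: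
  assumes "0 < B" and "\<And>f. represents f v \<Longrightarrow> X \<le> ennreal B * Lp_enorm torus p (\<lambda>x. ennreal (norm (f x)))"
  shows "X \<le> ennreal B * Lp_distr_enorm p v"
  unfolding Lp_distr_enorm_def using assms by (intro le_cmult_Inf_ennreal) auto

lemma Lp_distr_enorm_add_le:
  fixes u v :: "'n::finite test_fun \<Rightarrow> 'e::complex_banach"
  assumes p: "1 \<le> p"
  shows "Lp_distr_enorm p (u + v) \<le> 4 * (Lp_distr_enorm p u + Lp_distr_enorm p v)"
proof -
  let ?N = "\<lambda>f. Lp_enorm torus p (\<lambda>x. ennreal (norm (f x :: 'e)))"
  have le: "Lp_distr_enorm p (u + v) \<le> 4 * (?N f + ?N g)" if f: "represents f u" and g: "represents g v" for f g
  proof -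
    obtain F where F [measurable]: "F \<in> borel_measurable borel" "\<forall>x. 0 \<le> F x" "AE x in torus. norm (f x) = F x"
      using represents_norm_AE[OF f] by blast
    obtain G where G [measurable]: "G \<in> borel_measurable borel" "\<forall>x. 0 \<le> G x" "AE x in torus. norm (g x) = G x"
      using represents_norm_AE[OF g] by blast
    have "Lp_distr_enorm p (u + v) \<le> ?N (\<lambda>x. f x + g x)"
      by (rule Lp_distr_enorm_le[OF represents_add[OF f g]])
    also have "\<dots> \<le> Lp_enorm torus p (\<lambda>x. ennreal (F x) + ennreal (G x))"
    proof (rule Lp_enorm_mono_AE)
      show "AE x in torus. ennreal (norm (f x + g x)) \<le> ennreal (F x) + ennreal (G x)"
        using F(3) G(3)
      proof eventually_elim
        case (elim x)
        then show ?case using norm_triangle_ineq[of "f x" "g x"] F(2) G(2)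
          by (simp flip: ennreal_plus add: ennreal_leI)
      qed
    qed
    also have "\<dots> \<le> 4 * (Lp_enorm torus p (\<lambda>x. ennreal (F x)) + Lp_enorm torus p (\<lambda>x. ennreal (G x)))"
      by (rule Lp_enorm_add_le[OF p]) measurable
    also have "\<dots> \<le> 4 * (?N f + ?N g)"
    proof (intro mult_left_mono add_mono Lp_enorm_mono_AE)
      show "AE x in torus. ennreal (F x) \<le> ennreal (norm (f x))"
        using F(3) by eventually_elim simp
      show "AE x in torus. ennreal (G x) \<le> ennreal (norm (g x))"
        using G(3) by eventually_elim simp
    qed simp
    finally show ?thesis .
  qed
  define S where "S = {s + t | s t. s \<in> ?N ` {f. represents f u} \<and> t \<in> ?N ` {g. represents g v}}"
  have "Lp_distr_enorm p (u + v) \<le> ennreal 4 * Inf S"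
    using le by (intro le_cmult_Inf_ennreal) (auto simp: S_def)
  also have "\<dots> \<le> 4 * (Lp_distr_enorm p u + Lp_distr_enorm p v)"
    unfolding Lp_distr_enorm_def ennreal_numeral
    by (intro mult_left_mono Inf_plus_Inf_ge_ennreal Inf_lower) (auto simp: S_def)
  finally show ?thesis .
qed

lemma Lp_distr_enorm_scaleC_le:
  assumes p: "1 \<le> p"
  shows "Lp_distr_enorm p (c *\<^sub>C u) \<le> ennreal (cmod c + 1) * Lp_distr_enorm p u"
proof (rule Lp_distr_enorm_le_cmult)
  fix f assume f: "represents f u"
  obtain F where F [measurable]: "F \<in> borel_measurable borel" "\<forall>x. 0 \<le> F x" "AE x in torus. norm (f x) = F x"
    using represents_norm_AE[OF f] by blast
  have "Lp_distr_enorm p (c *\<^sub>C u) \<le> Lp_enorm torus p (\<lambda>x. ennreal (norm (c *\<^sub>C f x)))"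
    by (rule Lp_distr_enorm_le[OF represents_scaleC[OF f]])
  also have "\<dots> \<le> Lp_enorm torus p (\<lambda>x. ennreal (cmod c) * ennreal (F x))"
    using F by (intro Lp_enorm_mono_AE) (auto simp: norm_scaleC ennreal_mult elim!: eventually_mono)
  also have "\<dots> \<le> ennreal (cmod c) * Lp_enorm torus p (\<lambda>x. ennreal (F x))"
    by (rule Lp_enorm_cmult_le[OF p]) auto
  also have "\<dots> \<le> ennreal (cmod c + 1) * Lp_enorm torus p (\<lambda>x. ennreal (norm (f x)))"
    using F(3) by (intro mult_mono ennreal_leI Lp_enorm_mono_AE) (auto elim!: eventually_mono)
  finally show "Lp_distr_enorm p (c *\<^sub>C u) \<le> ennreal (cmod c + 1) * Lp_enorm torus p (\<lambda>x. ennreal (norm (f x)))" .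
qed (simp add: add_nonneg_pos)

lemma Lp_distr_enorm_sum_le:
  assumes "1 \<le> p" "finite I"
  shows "Lp_distr_enorm p (\<Sum>l\<in>I. u l) \<le> 4 ^ card I * (\<Sum>l\<in>I. Lp_distr_enorm p (u l))"
  using assms(2)
proof (induction I)
  case empty
  show ?case by (simp add: Lp_distr_enorm_zero assms(1) zero_fun_def)
next
  case (insert i I)
  let ?S = "\<Sum>l\<in>I. Lp_distr_enorm p (u l)"
  have "Lp_distr_enorm p (\<Sum>l\<in>insert i I. u l) \<le> 4 * (Lp_distr_enorm p (u i) + Lp_distr_enorm p (\<Sum>l\<in>I. u l))"
    using insert.hyps Lp_distr_enorm_add_le[OF assms(1)] by simp
  also have "\<dots> \<le> 4 * (4 ^ card I * Lp_distr_enorm p (u i) + 4 ^ card I * ?S)"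
  proof (intro mult_left_mono add_mono insert.IH)
    have "1 * Lp_distr_enorm p (u i) \<le> 4 ^ card I * Lp_distr_enorm p (u i)"
      by (intro mult_right_mono one_le_power) auto
    then show "Lp_distr_enorm p (u i) \<le> 4 ^ card I * Lp_distr_enorm p (u i)" by simp
  qed simp
  also have "\<dots> = 4 ^ card (insert i I) * (\<Sum>l\<in>insert i I. Lp_distr_enorm p (u l))"
    using insert.hyps by (simp add: distrib_left mult.assoc)
  finally show ?case .
qed

text \<open>A Fourier multiplier with finitely many frequencies acts on functions as the convolution with
  the trigonometric polynomial of its symbol. Pointwise norms reduce the estimate to Young's
  inequality for scalar functions. Complex linearity of the values of \<open>b\<close> is what moves the factors
  \<open>e\<^sub>-\<^sub>k(y)\<close> from \<open>f(y)\<close> to the kernel.\<close>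

lemma Lp_distr_enorm_multiplier_le:
  fixes b :: "int ^ 'n::finite \<Rightarrow> 'e::complex_banach \<Rightarrow>\<^sub>L 'e"
  assumes p: "1 \<le> p" and L: "0 < L" and A: "0 < A"
    and fin: "finite {k. b k \<noteq> 0}" and lin: "\<And>k. clinear_on UNIV (blinfun_apply (b k))"
    and kernel: "\<And>z. (\<And>l. \<bar>z $ l\<bar> \<le> 2 * pi) \<Longrightarrow> norm (trig_poly b z) \<le> A * kernel_majorant L z"
  shows "Lp_distr_enorm p (fourier_series (\<lambda>k. blinfun_apply (b k) (fourier_coeff v k)))
    \<le> ennreal (A * (6 * real CARD('n)) ^ CARD('n)) * Lp_distr_enorm p v"
proof (rule Lp_distr_enorm_le_cmult)
  show "0 < A * (6 * real CARD('n)) ^ CARD('n)" using A by simp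
next
  fix f assume f: "represents f v"
  let ?S = "{k. b k \<noteq> 0}"
  define g where "g = (\<lambda>x. \<Sum>k\<in>?S. echar k x *\<^sub>C blinfun_apply (b k) (fourier_coeff v k))"
  have g: "represents g (fourier_series (\<lambda>k. blinfun_apply (b k) (fourier_coeff v k)))"
    unfolding g_def by (rule represents_fourier_series_finite[OF fin]) simp
  obtain F where F [measurable]: "F \<in> borel_measurable borel" "\<forall>x. 0 \<le> F x" "AE x in torus. norm (f x) = F x"
    using represents_norm_AE[OF f] by blast
  have conv: "has_bochner_integral_strong torus (\<lambda>y. blinfun_apply (trig_poly b (x - y)) (f y)) (g x)" for x
  proof -
    have "has_bochner_integral_strong torus
        (\<lambda>y. \<Sum>k\<in>?S. echar k x *\<^sub>C blinfun_apply (b k) (echar (- k) y *\<^sub>C f y)) (g x)"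
      unfolding g_def fourier_coeff_def
    proof (intro has_bochner_integral_strong_sum fin)
      fix k
      have "has_bochner_integral_strong torus (\<lambda>y. echar (- k) y *\<^sub>C f y) (v (texp (- k)))"
        using f by (simp add: represents_def)
      then show "has_bochner_integral_strong torus (\<lambda>y. echar k x *\<^sub>C blinfun_apply (b k) (echar (- k) y *\<^sub>C f y))
          (echar k x *\<^sub>C blinfun_apply (b k) (v (texp (- k))))"
        by (intro has_bochner_integral_strong_linear[OF bounded_linear_scaleC]
            has_bochner_integral_strong_linear[OF blinfun.bounded_linear_right])
    qed
    moreover have "(\<Sum>k\<in>?S. echar k x *\<^sub>C blinfun_apply (b k) (echar (- k) y *\<^sub>C f y))
        = blinfun_apply (trig_poly b (x - y)) (f y)" for y
    proof -
      have "echar k x *\<^sub>C blinfun_apply (b k) (echar (- k) y *\<^sub>C f y) = blinfun_apply (echar k (x - y) *\<^sub>C b k) (f y)" for k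
        using clinear_onD_scaleC[OF lin, of "f y" k "echar (- k) y"]
        by (simp add: scaleC_blinfun.rep_eq echar_diff_right scaleC_scaleC)
      then show ?thesis by (simp add: trig_poly_def blinfun.sum_left)
    qed
    ultimately show ?thesis by simp
  qed
  have "Lp_distr_enorm p (fourier_series (\<lambda>k. blinfun_apply (b k) (fourier_coeff v k)))
      \<le> Lp_enorm torus p (\<lambda>x. ennreal (norm (g x)))"
    by (rule Lp_distr_enorm_le[OF g])
  also have "\<dots> \<le> Lp_enorm torus p (\<lambda>x. \<integral>\<^sup>+y. ennreal (A * kernel_majorant L (x - y)) * ennreal (F y) \<partial>torus)"
  proof (rule Lp_enorm_mono_AE)
    show "AE x in torus. ennreal (norm (g x)) \<le> (\<integral>\<^sup>+y. ennreal (A * kernel_majorant L (x - y)) * ennreal (F y) \<partial>torus)"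
      using AE_torus_cube
    proof eventually_elim
      case (elim x)
      have "ennreal (norm (g x)) \<le> (\<integral>\<^sup>+y. ennreal (norm (blinfun_apply (trig_poly b (x - y)) (f y))) \<partial>torus)"
        by (rule has_bochner_integral_strong_norm_le[OF conv])
      also have "\<dots> \<le> (\<integral>\<^sup>+y. ennreal (A * kernel_majorant L (x - y)) * ennreal (F y) \<partial>torus)"
      proof (rule nn_integral_mono_AE)
        show "AE y in torus. ennreal (norm (blinfun_apply (trig_poly b (x - y)) (f y)))
            \<le> ennreal (A * kernel_majorant L (x - y)) * ennreal (F y)"
          using AE_torus_cube F(3)
        proof eventually_elim
          case (elim y)
          have "\<bar>(x - y) $ l\<bar> \<le> 2 * pi" for l
          proof -
            have "0 \<le> x $ l" "x $ l \<le> 2 * pi" "0 \<le> y $ l" "y $ l \<le> 2 * pi"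
              using \<open>x \<in> cube\<close> \<open>y \<in> cube\<close> by (simp_all add: mem_cube)
            then show ?thesis unfolding vector_minus_component by linarith
          qed
          then have "norm (trig_poly b (x - y)) * norm (f y) \<le> (A * kernel_majorant L (x - y)) * F y"
            unfolding elim(2) using F(2) by (intro mult_right_mono kernel) auto
          then have "norm (blinfun_apply (trig_poly b (x - y)) (f y)) \<le> (A * kernel_majorant L (x - y)) * F y"
            using norm_blinfun[of "trig_poly b (x - y)" "f y"] by linarith
          moreover have "0 \<le> A * kernel_majorant L (x - y)"
            using A L by (intro mult_nonneg_nonneg kernel_majorant_nonneg) auto
          ultimately show ?case
            using F(2) by (simp flip: ennreal_mult add: ennreal_leI)
        qed
      qed
      finally show ?case .
    qed
  qed
  also have "\<dots> \<le> ennreal (A * (6 * real CARD('n)) ^ CARD('n)) * Lp_enorm torus p (\<lambda>y. ennreal (F y))"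
    by (rule Lp_enorm_convolution_le[OF p L A]) measurable
  also have "\<dots> \<le> ennreal (A * (6 * real CARD('n)) ^ CARD('n)) * Lp_enorm torus p (\<lambda>y. ennreal (norm (f y)))"
    using F(3) by (intro mult_left_mono Lp_enorm_mono_AE) (auto elim!: eventually_mono)
  finally show "Lp_distr_enorm p (fourier_series (\<lambda>k. blinfun_apply (b k) (fourier_coeff v k)))
    \<le> ennreal (A * (6 * real CARD('n)) ^ CARD('n)) * Lp_enorm torus p (\<lambda>y. ennreal (norm (f y)))" .
qed

section \<open>Dyadic pieces of a symbol\<close>

lemma dyadic_support:
  assumes "dyadic_decomposition \<phi>" "\<phi> j \<xi> \<noteq> 0"
  shows "norm \<xi> \<le> 2 * 2 ^ j" and "1 \<le> j \<Longrightarrow> 2 ^ j \<le> 2 * norm \<xi>"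
proof -
  have cl: "\<xi> \<in> closure {\<xi>. \<phi> j \<xi> \<noteq> 0}"
    by (rule subsetD[OF closure_subset]) (simp add: assms(2))
  have sub0: "closure {\<xi>. \<phi> 0 \<xi> \<noteq> 0} \<subseteq> {\<xi>. norm \<xi> \<le> 2}"
    and sub: "\<forall>j\<ge>1. closure {\<xi>. \<phi> j \<xi> \<noteq> 0} \<subseteq> {\<xi>. 2 ^ (j - 1) \<le> norm \<xi> \<and> norm \<xi> \<le> 2 ^ (j + 1)}"
    using assms(1) by (simp_all add: dyadic_decomposition_def)
  have *: "j = 0 \<Longrightarrow> norm \<xi> \<le> 2"
    using subsetD[OF sub0] cl by simp
  have **: "1 \<le> j \<Longrightarrow> 2 ^ (j - 1) \<le> norm \<xi> \<and> norm \<xi> \<le> 2 ^ (j + 1)"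
    using subsetD[OF sub[rule_format], OF _ cl] by simp
  show "norm \<xi> \<le> 2 * 2 ^ j" using * ** by (cases j) auto
  show "2 ^ j \<le> 2 * norm \<xi>" if "1 \<le> j" using ** that by (cases j) auto
qed

text \<open>The closed annuli that contain the supports of \<open>\<phi>\<^sub>j\<close> and \<open>\<phi>\<^sub>j\<^sub>+\<^sub>2\<close> touch in a sphere, so the
  annuli of \<open>\<phi>\<^sub>j\<close> and \<open>\<phi>\<^sub>l\<close> are disjoint only from \<open>\<bar>l - j\<bar> \<ge> 3\<close> on. Hence the windows have radius \<open>2\<close>.\<close>

lemma dyadic_window_sum:
  assumes d: "dyadic_decomposition \<phi>" and j: "\<phi> j \<xi> \<noteq> 0"
  shows "(\<Sum>l\<in>{j-2..j+2}. \<phi> l \<xi>) = 1"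
proof -
  have "\<phi> l \<xi> = 0" if out: "l \<notin> {j-2..j+2}" for l
  proof (rule ccontr)
    assume l: "\<phi> l \<xi> \<noteq> 0"
    consider "j + 3 \<le> l" | "l + 3 \<le> j" using out by fastforce
    then show False
    proof cases
      case 1
      then have "(2::real) ^ (j + 3) \<le> 2 ^ l" by (intro power_increasing) auto
      also have "\<dots> \<le> 2 * norm \<xi>" using dyadic_support(2)[OF d l] 1 by simp
      also have "\<dots> \<le> 4 * 2 ^ j" using dyadic_support(1)[OF d j] by simp
      finally show False by (simp add: power_add)
    next
      case 2
      then have "(2::real) ^ (l + 3) \<le> 2 ^ j" by (intro power_increasing) auto
      also have "\<dots> \<le> 2 * norm \<xi>" using dyadic_support(2)[OF d j] 2 by simp
      also have "\<dots> \<le> 4 * 2 ^ l" using dyadic_support(1)[OF d l] by simp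
      finally show False by (simp add: power_add)
    qed
  qed
  then have "(\<lambda>l. \<phi> l \<xi>) sums (\<Sum>l\<in>{j-2..j+2}. \<phi> l \<xi>)"
    by (intro sums_finite) auto
  moreover have "(\<lambda>l. \<phi> l \<xi>) sums 1" using d by (simp add: dyadic_decomposition_def)
  ultimately show ?thesis by (metis sums_unique2)
qed

lemma shift_diff_funpow_rvec:
  "(shift_diff (axis l 1) ^^ i) (\<lambda>k. f (rvec k)) = (\<lambda>k. (shift_diff (1 *\<^sub>R axis l 1) ^^ i) f (rvec k))"
proof (induction i)
  case (Suc i)
  have "rvec (k + axis l 1) = rvec k + 1 *\<^sub>R axis l 1" for k
    by (simp add: rvec_add rvec_axis)
  then show ?case using Suc by (simp add: shift_diff_def fun_eq_iff)
qed simp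

lemma dyadic_shift_diff_le:
  fixes \<phi> :: "nat \<Rightarrow> real ^ 'n::finite \<Rightarrow> complex"
  assumes d: "dyadic_decomposition \<phi>"
  obtains C where "0 < C"
    "\<And>i j l k. i \<le> N \<Longrightarrow> norm ((shift_diff (axis l 1) ^^ i) (\<lambda>k. \<phi> j (rvec k)) k) \<le> C * (1 / 2 ^ j) ^ i"
proof -
  have "\<forall>\<alpha>. \<exists>c>0. \<forall>\<xi> j. norm (mi_power partial \<alpha> (\<phi> j) \<xi>) \<le> c * 2 powr (- real (j * mi_abs \<alpha>))"
    using d by (simp add: dyadic_decomposition_def)
  then obtain c where c: "\<And>\<alpha>. 0 < c \<alpha>"
    "\<And>\<alpha> \<xi> j. norm (mi_power partial \<alpha> (\<phi> j) \<xi>) \<le> c \<alpha> * 2 powr (- real (j * mi_abs \<alpha>))"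
    by metis
  define C where "C = 1 + (\<Sum>\<alpha>\<in>mi_upto N. c \<alpha>)"
  have "0 < C" unfolding C_def using c(1) by (intro add_pos_nonneg sum_nonneg) (auto simp: less_imp_le)
  moreover have "norm ((shift_diff (axis l 1) ^^ i) (\<lambda>k. \<phi> j (rvec k)) k) \<le> C * (1 / 2 ^ j) ^ i"
    if i: "i \<le> N" for i j l k
  proof -
    have smooth: "smooth (\<phi> j)" using d by (simp add: dyadic_decomposition_def schwartz_def)
    have "c (axis l i) \<le> (\<Sum>\<alpha>\<in>mi_upto N. c \<alpha>)"
      using i c(1) by (intro member_le_sum) (auto simp: mi_upto_def mi_abs_axis finite_mi_upto[unfolded mi_upto_def] less_imp_le)
    then have cC: "c (axis l i) \<le> C" by (simp add: C_def)
    have pow: "2 powr (- real (j * i)) = (1 / 2 ^ j :: real) ^ i"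
      by (simp only: powr_minus powr_realpow zero_less_numeral power_mult power_one_over inverse_eq_divide)
    have "norm ((partial l ^^ i) (\<phi> j) \<xi>) \<le> C * (1 / 2 ^ j) ^ i" for \<xi>
    proof -
      have "norm ((partial l ^^ i) (\<phi> j) \<xi>) \<le> c (axis l i) * (1 / 2 ^ j) ^ i"
        using c(2)[of "axis l i" j \<xi>] unfolding mi_power_axis mi_abs_axis pow .
      also have "\<dots> \<le> C * (1 / 2 ^ j) ^ i" by (intro mult_right_mono cC) simp
      finally show ?thesis .
    qed
    then have "norm ((shift_diff (1 *\<^sub>R axis l 1) ^^ i) (\<phi> j) (rvec k)) \<le> 1 ^ i * (C * (1 / 2 ^ j) ^ i)"
      by (intro norm_shift_diff_funpow_le_partial smooth_partial_funpow smooth) auto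
    then show ?thesis by (simp add: shift_diff_funpow_rvec)
  qed
  ultimately show ?thesis using that by blast
qed

text \<open>The symbol estimates that enter the proof: pure differences in each coordinate direction, up
  to the order \<open>N\<close>. The constant \<open>B\<close> may exceed the norm of \<open>a\<close>; a positive one exists even
  for \<open>a = 0\<close>.\<close>

definition symbol_bound :: "real \<Rightarrow> nat \<Rightarrow> (int ^ 'n::finite \<Rightarrow> 'e::complex_banach \<Rightarrow>\<^sub>L 'e) \<Rightarrow> real \<Rightarrow> bool" where
  "symbol_bound m N a B \<longleftrightarrow>
     (\<forall>l i k. i \<le> N \<longrightarrow> norm ((shift_diff (axis l 1) ^^ i) a k) \<le> B * jap (rvec k) powr (m - real i))"

lemma powr_le_powr_abs:
  fixes x H m :: real
  assumes "1 \<le> H" "1 / H \<le> x" "x \<le> H"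
  shows "x powr m \<le> H powr \<bar>m\<bar>"
proof (cases "0 \<le> m")
  case True
  have "0 \<le> x" using assms by (meson order_trans divide_nonneg_nonneg zero_le_one)
  then show ?thesis using True assms by (simp add: powr_mono2)
next
  case False
  have "x powr m \<le> (1 / H) powr m" using assms False by (intro powr_mono2') auto
  then show ?thesis using assms False by (simp add: powr_divide powr_minus_divide)
qed

text \<open>On the support of \<open>\<phi>\<^sub>j\<close> and on its translates that enter the differences, \<open>\<langle>k\<rangle>\<close> is comparable
  to \<open>2\<^sup>j\<close>. So \<open>\<phi>\<^sub>j a\<close> satisfies the estimates of a symbol at the fixed frequency \<open>2\<^sup>j\<close>.\<close>

lemma dyadic_symbol_estimate:
  fixes \<phi> :: "nat \<Rightarrow> real ^ 'n::finite \<Rightarrow> complex"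
  assumes d: "dyadic_decomposition \<phi>"
  obtains K where "0 < K"
    "\<And>(a :: int ^ 'n \<Rightarrow> 'e::complex_banach \<Rightarrow>\<^sub>L 'e) B M j l k. symbol_bound m N a B \<Longrightarrow> 0 \<le> B \<Longrightarrow> M \<le> N \<Longrightarrow>
      norm ((shift_diff (axis l 1) ^^ M) (\<lambda>k. \<phi> j (rvec k) *\<^sub>C a k) k) \<le> K * B * 2 powr (real j * m) / (2 ^ j) ^ M"
proof -
  obtain C where C: "0 < C"
    "\<And>i j l k. i \<le> N \<Longrightarrow> norm ((shift_diff (axis l 1) ^^ i) (\<lambda>k. \<phi> j (rvec k)) k) \<le> C * (1 / 2 ^ j) ^ i"
    by (rule dyadic_shift_diff_le[OF d, of N]) blast
  \<comment> \<open>chosen such that \<open>2\<^sup>j / H \<le> \<langle>k\<rangle> \<le> H 2\<^sup>j\<close> whenever a difference of order at most \<open>N\<close> does not vanish at \<open>k\<close>\<close>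
  define H where "H = 6 * (1 + real N)"
  define K where "K = C * H powr \<bar>m\<bar> * (2 * H) ^ N"
  have H: "1 \<le> H" by (simp add: H_def)
  have K: "0 < K" using C H by (simp add: K_def)
  have "norm ((shift_diff (axis l 1) ^^ M) (\<lambda>k. \<phi> j (rvec k) *\<^sub>C a k) k) \<le> K * B * 2 powr (real j * m) / (2 ^ j) ^ M"
    if a: "symbol_bound m N a B" and B: "0 \<le> B" and M: "M \<le> N"
    for a :: "int ^ 'n \<Rightarrow> 'e \<Rightarrow>\<^sub>L 'e" and B M j l k
  proof (cases "\<exists>i\<le>M. \<phi> j (rvec (((\<lambda>y. y + axis l 1) ^^ i) k)) \<noteq> 0")
    case False
    then have "(shift_diff (axis l 1) ^^ M) (\<lambda>k. \<phi> j (rvec k) *\<^sub>C a k) k = 0"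
      by (intro shift_diff_funpow_eq_0) auto
    then show ?thesis using K B by simp
  next
    case True
    then obtain i where i: "i \<le> M" "\<phi> j (rvec (((\<lambda>y. y + axis l 1) ^^ i) k)) \<noteq> 0" by blast
    define \<eta> where "\<eta> = rvec (((\<lambda>y. y + axis l 1) ^^ i) k)"
    define h where "h = (real i *\<^sub>R axis l 1 :: real ^ 'n)"
    have \<eta>: "\<eta> = rvec k + h"
    proof -
      have "((\<lambda>y. y + axis l 1) ^^ i) k = k + axis l (int i)"
        by (induction i) (auto simp: vec_eq_iff axis_def)
      then show ?thesis by (simp add: \<eta>_def h_def rvec_add rvec_axis)
    qed
    have h: "1 + norm h \<le> 1 + real N" "1 + norm (- h) \<le> 1 + real N" using i M by (simp_all add: h_def)
    have "jap (rvec k) \<le> 2 * jap \<eta> * (1 + norm (- h))"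
      using jap_add_le[of \<eta> "- h"] by (simp add: \<eta>)
    also have "\<dots> \<le> 2 * (3 * 2 ^ j) * (1 + real N)"
    proof (intro mult_mono h)
      have "jap \<eta> \<le> 1 + 2 * 2 ^ j"
        using jap_le[of \<eta>] dyadic_support(1)[OF d i(2)] unfolding \<eta>_def by linarith
      also have "\<dots> \<le> 3 * 2 ^ j" by simp
      finally show "jap \<eta> \<le> 3 * 2 ^ j" .
    qed (auto simp: jap_pos less_imp_le)
    finally have upper: "jap (rvec k) \<le> H * 2 ^ j" by (simp add: H_def algebra_simps)
    have "2 ^ j \<le> 2 * jap \<eta>"
    proof (cases "j = 0")
      case True
      then show ?thesis using jap_ge_1[of \<eta>] by simp
    next
      case False
      then show ?thesis using dyadic_support(2)[OF d i(2)] norm_le_jap[of \<eta>] by (simp add: \<eta>_def)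
    qed
    also have "\<dots> \<le> 2 * (2 * jap (rvec k) * (1 + real N))"
    proof -
      have "jap \<eta> \<le> 2 * jap (rvec k) * (1 + norm h)" unfolding \<eta> by (rule jap_add_le)
      also have "\<dots> \<le> 2 * jap (rvec k) * (1 + real N)"
        using jap_pos[of "rvec k"] by (intro mult_left_mono h) auto
      finally show ?thesis by simp
    qed
    also have "\<dots> \<le> H * jap (rvec k)"
      using jap_pos[of "rvec k"] by (simp add: H_def)
    finally have lower: "2 ^ j \<le> H * jap (rvec k)" .
    have J: "0 < jap (rvec k)" by (rule jap_pos)
    have pow_m: "jap (rvec k) powr m \<le> H powr \<bar>m\<bar> * 2 powr (real j * m)"
    proof -
      have "(jap (rvec k) / 2 ^ j) powr m \<le> H powr \<bar>m\<bar>"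
        using upper lower H by (intro powr_le_powr_abs) (auto simp: field_simps)
      moreover have "(2 ^ j) powr m = 2 powr (real j * m)"
        by (simp add: powr_realpow[symmetric] powr_powr)
      ultimately show ?thesis using J by (simp add: powr_divide field_simps)
    qed
    have ga: "norm ((shift_diff (axis l 1) ^^ i) a k) \<le> (B * H powr \<bar>m\<bar> * 2 powr (real j * m)) * (H / 2 ^ j) ^ i"
      if "i \<le> M" for i
    proof -
      have "norm ((shift_diff (axis l 1) ^^ i) a k) \<le> B * jap (rvec k) powr (m - real i)"
        using a that M by (simp add: symbol_bound_def)
      also have "jap (rvec k) powr (m - real i) = jap (rvec k) powr m * (1 / jap (rvec k)) ^ i"
        using J by (simp add: powr_diff powr_realpow power_one_over)
      also have "\<dots> \<le> (H powr \<bar>m\<bar> * 2 powr (real j * m)) * (H / 2 ^ j) ^ i"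
        using J lower by (intro mult_mono pow_m power_mono) (auto simp: field_simps)
      finally show ?thesis using B by (simp add: mult_left_mono mult.assoc)
    qed
    have fa: "norm ((shift_diff (axis l 1) ^^ i) (\<lambda>k. \<phi> j (rvec k)) y) \<le> C * (H / 2 ^ j) ^ i"
      if "i \<le> M" for i y
    proof -
      have "(1 / 2 ^ j) ^ i \<le> (H / 2 ^ j) ^ i"
        using H by (intro power_mono divide_right_mono) auto
      then show ?thesis
        using C(2)[of i l j y] that M C(1) by (meson mult_left_mono less_imp_le order_trans)
    qed
    have "norm ((shift_diff (axis l 1) ^^ M) (\<lambda>k. \<phi> j (rvec k) *\<^sub>C a k) k)
        \<le> C * (B * H powr \<bar>m\<bar> * 2 powr (real j * m)) * (2 * (H / 2 ^ j)) ^ M"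
      using C(1) by (intro norm_shift_diff_scaleC_le fa ga) auto
    also have "\<dots> = (C * H powr \<bar>m\<bar> * (2 * H) ^ M) * (B * 2 powr (real j * m) / (2 ^ j) ^ M)"
      by (simp add: power_divide mult_ac)
    also have "\<dots> \<le> K * (B * 2 powr (real j * m) / (2 ^ j) ^ M)"
      unfolding K_def using C(1) H B M by (intro mult_right_mono mult_left_mono power_increasing) auto
    finally show ?thesis by (simp add: mult_ac)
  qed
  then show ?thesis using that K by blast
qed

lemma op_tor_scalar_symbol:
  "op_tor (scalar_symbol f) u = fourier_series (\<lambda>k. f (rvec k) *\<^sub>C fourier_coeff u k)"
  by (simp add: op_tor_eq_fourier_series scalar_symbol_def scaleC_blinfun.rep_eq)

lemma dyadic_finite_support:
  assumes "dyadic_decomposition \<phi>"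
  shows "finite {k. \<phi> j (rvec k) \<noteq> 0}"
proof (rule finite_subset)
  show "{k. \<phi> j (rvec k) \<noteq> 0} \<subseteq> int_box (2 * 2 ^ j)"
  proof
    fix k assume "k \<in> {k. \<phi> j (rvec k) \<noteq> 0}"
    then have le: "norm (rvec k) \<le> 2 * 2 ^ j" using dyadic_support(1)[OF assms] by blast
    have "\<bar>k $ l\<bar> \<le> int (2 * 2 ^ j)" for l
    proof -
      have "\<bar>rvec k $ l\<bar> \<le> 2 * 2 ^ j" using component_le_norm_cart le order_trans by blast
      then have "real_of_int \<bar>k $ l\<bar> \<le> real_of_int (int (2 * 2 ^ j))" by (simp add: rvec_def)
      then show ?thesis by (simp only: of_int_le_iff)
    qed
    then show "k \<in> int_box (2 * 2 ^ j)" by (simp add: int_box_def)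
  qed
qed (rule int_box)

section \<open>Linearity and the spaces involved\<close>

lemma fourier_coeff_add: "fourier_coeff (u + v) k = fourier_coeff u k + fourier_coeff v k"
  and fourier_coeff_scaleC: "fourier_coeff (c *\<^sub>C u) k = c *\<^sub>C fourier_coeff u k"
  by (simp_all add: fourier_coeff_def scaleC_fun_def)

lemma poly_growth_blinfun_apply:
  assumes "poly_growth a" "poly_growth c"
  shows "poly_growth (\<lambda>k. blinfun_apply (a k) (c k))"
  by (rule poly_growth_mult[OF assms]) (rule norm_blinfun)

lemma poly_growth_dyadic:
  "dyadic_decomposition \<phi> \<Longrightarrow> poly_growth (\<lambda>k. \<phi> j (rvec k) *\<^sub>C c k)"
  by (rule poly_growth_finite_support[OF dyadic_finite_support[of \<phi> j]]) auto

lemma fourier_series_sum: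
  assumes "finite I" "\<And>l. l \<in> I \<Longrightarrow> poly_growth (c l)"
  shows "fourier_series (\<lambda>k. \<Sum>l\<in>I. c l k) = (\<Sum>l\<in>I. fourier_series (c l))
    \<and> poly_growth (\<lambda>k. \<Sum>l\<in>I. c l k)"
  using assms
proof (induction I)
  case empty
  show ?case by (simp add: poly_growth_const fourier_series_def fun_eq_iff)
next
  case (insert i I)
  then show ?case by (simp add: fourier_series_add poly_growth_add)
qed

lemma distributions_add:
  assumes "u \<in> distributions" "v \<in> distributions" shows "u + v \<in> distributions"
proof -
  have "clinear_on UNIV (\<lambda>\<phi>. u \<phi> + v \<phi>)"
    using assms by (simp add: distributions_def clinear_on_def scaleC_add_right)
  moreover have "continuous_on UNIV (\<lambda>\<phi>. u \<phi> + v \<phi>)"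
    using assms by (intro continuous_on_add) (auto simp: distributions_def)
  ultimately show ?thesis by (simp add: distributions_def plus_fun_def)
qed

lemma distributions_scaleC:
  assumes "u \<in> distributions" shows "c *\<^sub>C u \<in> distributions"
proof -
  have "clinear_on UNIV (\<lambda>\<phi>. c *\<^sub>C u \<phi>)"
    using assms by (simp add: distributions_def clinear_on_def scaleC_add_right scaleC_scaleC mult.commute)
  moreover have "continuous_on UNIV (\<lambda>\<phi>. c *\<^sub>C u \<phi>)"
    using assms by (intro bounded_linear.continuous_on[OF bounded_linear_scaleC]) (auto simp: distributions_def)
  ultimately show ?thesis by (simp add: distributions_def scaleC_fun_def)
qed

lemma zero_distribution: "0 \<in> distributions"
  by (simp add: distributions_def clinear_on_def zero_fun_def)

lemma op_tor_add_right:
  assumes "poly_growth a" "u \<in> distributions" "v \<in> distributions"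
  shows "op_tor a (u + v) = op_tor a u + op_tor a v"
  unfolding op_tor_eq_fourier_series fourier_coeff_add blinfun.add_right
  by (intro fourier_series_add poly_growth_blinfun_apply poly_growth_fourier_coeff assms)

lemma op_tor_scaleC_right:
  assumes "poly_growth a" "\<And>k. clinear_on UNIV (blinfun_apply (a k))" "u \<in> distributions"
  shows "op_tor a (c *\<^sub>C u) = c *\<^sub>C op_tor a u"
proof -
  have "op_tor a (c *\<^sub>C u) = fourier_series (\<lambda>k. c *\<^sub>C blinfun_apply (a k) (fourier_coeff u k))"
    by (simp add: op_tor_eq_fourier_series fourier_coeff_scaleC clinear_onD_scaleC[OF assms(2)])
  then show ?thesis
    unfolding op_tor_eq_fourier_series
    by (simp add: fourier_series_scaleC poly_growth_blinfun_apply poly_growth_fourier_coeff assms)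
qed

lemma op_tor_add_left:
  assumes "poly_growth a" "poly_growth b" "u \<in> distributions"
  shows "op_tor (a + b) u = op_tor a u + op_tor b u"
proof -
  have "op_tor (a + b) u = fourier_series (\<lambda>k. blinfun_apply (a k) (fourier_coeff u k) + blinfun_apply (b k) (fourier_coeff u k))"
    by (simp add: op_tor_eq_fourier_series blinfun.add_left)
  also have "\<dots> = op_tor a u + op_tor b u"
    unfolding op_tor_eq_fourier_series
    by (intro fourier_series_add poly_growth_blinfun_apply poly_growth_fourier_coeff assms)
  finally show ?thesis .
qed

lemma op_tor_scaleC_left:
  assumes "poly_growth a" "u \<in> distributions"
  shows "op_tor (c *\<^sub>C a) u = c *\<^sub>C op_tor a u"
  unfolding op_tor_eq_fourier_series scaleC_fun_def[of c a] scaleC_blinfun.rep_eq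
  by (intro fourier_series_scaleC poly_growth_blinfun_apply poly_growth_fourier_coeff assms)

lemma op_tor_distribution:
  "poly_growth a \<Longrightarrow> u \<in> distributions \<Longrightarrow> op_tor a u \<in> distributions"
  unfolding op_tor_eq_fourier_series
  by (intro fourier_series_distribution poly_growth_blinfun_apply poly_growth_fourier_coeff)

lemma besov_enorm_add_le:
  assumes d: "dyadic_decomposition \<phi>" and p: "1 \<le> p" and q: "1 \<le> q"
  shows "besov_enorm \<phi> s p q (u + v) \<le> 16 * (besov_enorm \<phi> s p q u + besov_enorm \<phi> s p q v)"
proof -
  let ?w = "\<lambda>j. ennreal (2 powr (real j * s))"
  let ?L = "\<lambda>u j. Lp_distr_enorm p (op_tor (scalar_symbol (\<phi> j)) u)"
  let ?Q = "Lp_enorm (count_space (UNIV :: nat set)) q"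
  have add: "op_tor (scalar_symbol (\<phi> j)) (u + v) = op_tor (scalar_symbol (\<phi> j)) u + op_tor (scalar_symbol (\<phi> j)) v" for j
    unfolding op_tor_scalar_symbol fourier_coeff_add scaleC_add_right
    by (intro fourier_series_add poly_growth_dyadic d)
  have "?Q (\<lambda>j. ?w j * ?L (u + v) j) \<le> ?Q (\<lambda>j. ennreal 4 * (?w j * ?L u j + ?w j * ?L v j))"
  proof (intro Lp_enorm_mono_AE AE_I2)
    fix j
    have "?w j * ?L (u + v) j \<le> ?w j * (4 * (?L u j + ?L v j))"
      unfolding add by (intro mult_left_mono Lp_distr_enorm_add_le p) simp
    then show "?w j * ?L (u + v) j \<le> ennreal 4 * (?w j * ?L u j + ?w j * ?L v j)"
      by (simp add: algebra_simps)
  qed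
  also have "\<dots> \<le> ennreal 4 * ?Q (\<lambda>j. ?w j * ?L u j + ?w j * ?L v j)"
    by (rule Lp_enorm_cmult_le[OF q]) auto
  also have "\<dots> \<le> ennreal 4 * (4 * (?Q (\<lambda>j. ?w j * ?L u j) + ?Q (\<lambda>j. ?w j * ?L v j)))"
    by (intro mult_left_mono Lp_enorm_add_le q) auto
  finally show ?thesis
    by (simp add: besov_enorm_def mult.assoc[symmetric] del: distrib_left_numeral)
qed

lemma besov_enorm_scaleC_le:
  assumes d: "dyadic_decomposition \<phi>" and p: "1 \<le> p" and q: "1 \<le> q"
  shows "besov_enorm \<phi> s p q (c *\<^sub>C u) \<le> ennreal (cmod c + 1) * besov_enorm \<phi> s p q u"
proof -
  have eq: "op_tor (scalar_symbol (\<phi> j)) (c *\<^sub>C u) = c *\<^sub>C op_tor (scalar_symbol (\<phi> j)) u" for j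
  proof -
    have "(\<lambda>k. \<phi> j (rvec k) *\<^sub>C fourier_coeff (c *\<^sub>C u) k) = (\<lambda>k. c *\<^sub>C \<phi> j (rvec k) *\<^sub>C fourier_coeff u k)"
      by (simp add: fourier_coeff_scaleC scaleC_scaleC mult.commute)
    then show ?thesis
      unfolding op_tor_scalar_symbol by (simp add: fourier_series_scaleC poly_growth_dyadic d)
  qed
  have "besov_enorm \<phi> s p q (c *\<^sub>C u) \<le> Lp_enorm (count_space UNIV) q
      (\<lambda>j. ennreal (cmod c + 1) * (ennreal (2 powr (real j * s)) * Lp_distr_enorm p (op_tor (scalar_symbol (\<phi> j)) u)))"
    unfolding besov_enorm_def eq
  proof (intro Lp_enorm_mono_AE AE_I2)
    fix j
    let ?w = "ennreal (2 powr (real j * s))"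
    have "?w * Lp_distr_enorm p (c *\<^sub>C op_tor (scalar_symbol (\<phi> j)) u)
        \<le> ?w * (ennreal (cmod c + 1) * Lp_distr_enorm p (op_tor (scalar_symbol (\<phi> j)) u))"
      by (intro mult_left_mono Lp_distr_enorm_scaleC_le p) simp
    then show "?w * Lp_distr_enorm p (c *\<^sub>C op_tor (scalar_symbol (\<phi> j)) u)
        \<le> ennreal (cmod c + 1) * (?w * Lp_distr_enorm p (op_tor (scalar_symbol (\<phi> j)) u))"
      by (simp only: mult.left_commute)
  qed
  also have "\<dots> \<le> ennreal (cmod c + 1) * besov_enorm \<phi> s p q u"
    unfolding besov_enorm_def by (rule Lp_enorm_cmult_le[OF q]) auto
  finally show ?thesis .
qed

lemma besov_enorm_zero:
  assumes "1 \<le> p" "1 \<le> q"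
  shows "besov_enorm \<phi> s p q (0 :: 'n::finite test_fun \<Rightarrow> 'e::complex_banach) = 0"
proof -
  have "op_tor (scalar_symbol (\<phi> j)) (0 :: 'n test_fun \<Rightarrow> 'e) = (\<lambda>_. 0)" for j
    by (simp add: op_tor_def fourier_coeff_def blinfun.zero_right)
  then show ?thesis
    using assms by (simp add: besov_enorm_def Lp_distr_enorm_zero Lp_enorm_zero)
qed

text \<open>The real-valued norm is \<open>0\<close> where the extended one is infinite. A small norm of a difference is
  therefore informative only if the difference is known to lie in the space.\<close>

lemma besov_add:
  assumes "dyadic_decomposition \<phi>" "1 \<le> p" "1 \<le> q" "u \<in> carr (besov \<phi> s p q)" "v \<in> carr (besov \<phi> s p q)"
  shows "u + v \<in> carr (besov \<phi> s p q)"
  using assms order.strict_trans1[OF besov_enorm_add_le[OF assms(1-3), of s u v], of \<infinity>]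
  by (simp add: besov_def distributions_add ennreal_mult_less_top)

lemma besov_scaleC:
  assumes "dyadic_decomposition \<phi>" "1 \<le> p" "1 \<le> q" "u \<in> carr (besov \<phi> s p q)"
  shows "c *\<^sub>C u \<in> carr (besov \<phi> s p q)"
  using assms order.strict_trans1[OF besov_enorm_scaleC_le[OF assms(1-3), of s c u], of \<infinity>]
  by (simp add: besov_def distributions_scaleC ennreal_mult_less_top)

lemma diff_eq_add_scaleC: "x - y = x + (-1) *\<^sub>C y" for x y :: "'a::complex_vector"
  by (simp add: scaleC_one)

lemma mi_power_diff_op_add:
  "mi_power diff_op \<alpha> (\<lambda>k. a k + b k) = (\<lambda>k. mi_power diff_op \<alpha> a k + mi_power diff_op \<alpha> b k)"
proof -
  have "foldr (\<lambda>j. diff_op j ^^ (\<alpha> $ j)) js (\<lambda>k. a k + b k)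
    = (\<lambda>k. foldr (\<lambda>j. diff_op j ^^ (\<alpha> $ j)) js a k + foldr (\<lambda>j. diff_op j ^^ (\<alpha> $ j)) js b k)" for js
    by (induction js) (simp_all add: diff_op_eq_shift_diff shift_diff_funpow_add)
  then show ?thesis by (simp add: mi_power_def)
qed

lemma mi_power_diff_op_scaleC: "mi_power diff_op \<alpha> (c *\<^sub>C a) = c *\<^sub>C mi_power diff_op \<alpha> a"
  for a :: "int ^ 'n::finite \<Rightarrow> 'b::complex_vector"
proof -
  have pow: "(diff_op j ^^ i) (c *\<^sub>C f) = c *\<^sub>C (diff_op j ^^ i) f" for j i and f :: "int ^ 'n \<Rightarrow> 'b"
    by (induction i) (simp_all add: diff_op_def fun_eq_iff scaleC_fun_def scaleC_diff_right)
  have "foldr (\<lambda>j. diff_op j ^^ (\<alpha> $ j)) js (c *\<^sub>C a)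
    = c *\<^sub>C foldr (\<lambda>j. diff_op j ^^ (\<alpha> $ j)) js a" for js
    by (induction js) (simp_all add: pow)
  then show ?thesis by (simp add: mi_power_def)
qed

lemma symbol_space_add:
  assumes "a \<in> carr (symbol_space m \<rho>)" "b \<in> carr (symbol_space m \<rho>)"
  shows "a + b \<in> carr (symbol_space m \<rho>)"
proof -
  have "bdd_above (range (symbol_weight m (a + b) \<alpha>))" if \<alpha>: "\<alpha> \<in> mi_upto \<rho>" for \<alpha>
  proof -
    have "bdd_above (range (symbol_weight m a \<alpha>))" "bdd_above (range (symbol_weight m b \<alpha>))"
      using assms \<alpha> by (simp_all add: symbol_space_def)
    then obtain A B where "\<And>k. symbol_weight m a \<alpha> k \<le> A" "\<And>k. symbol_weight m b \<alpha> k \<le> B"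
      unfolding bdd_above_def by blast
    moreover have "symbol_weight m (a + b) \<alpha> k \<le> symbol_weight m a \<alpha> k + symbol_weight m b \<alpha> k" for k
      unfolding symbol_weight_def plus_fun_def mi_power_diff_op_add distrib_left[symmetric]
      by (intro mult_left_mono norm_triangle_ineq) simp
    ultimately have "symbol_weight m (a + b) \<alpha> k \<le> A + B" for k
      by (meson add_mono order_trans)
    then show ?thesis by (intro bdd_aboveI[of _ "A + B"]) auto
  qed
  moreover have "clinear_on UNIV (blinfun_apply ((a + b) k))" for k
    using assms by (simp add: symbol_space_def clinear_on_def blinfun.add_left scaleC_add_right)
  ultimately show ?thesis by (simp add: symbol_space_def)
qed

lemma symbol_space_scaleC:
  assumes "a \<in> carr (symbol_space m \<rho>)"
  shows "c *\<^sub>C a \<in> carr (symbol_space m \<rho>)"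
proof -
  have "bdd_above (range (symbol_weight m (c *\<^sub>C a) \<alpha>))" if \<alpha>: "\<alpha> \<in> mi_upto \<rho>" for \<alpha>
  proof -
    have "bdd_above (range (symbol_weight m a \<alpha>))"
      using assms \<alpha> by (simp add: symbol_space_def)
    then obtain A where A: "\<And>k. symbol_weight m a \<alpha> k \<le> A"
      unfolding bdd_above_def by blast
    have "symbol_weight m (c *\<^sub>C a) \<alpha> k = cmod c * symbol_weight m a \<alpha> k" for k
      unfolding symbol_weight_def mi_power_diff_op_scaleC by (simp add: scaleC_fun_def norm_scaleC)
    then have "symbol_weight m (c *\<^sub>C a) \<alpha> k \<le> cmod c * A" for k
      using A by (simp add: mult_left_mono)
    then show ?thesis by (intro bdd_aboveI[of _ "cmod c * A"]) auto
  qed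
  moreover have "clinear_on UNIV (blinfun_apply ((c *\<^sub>C a) k))" for k
    using assms by (simp add: symbol_space_def clinear_on_def scaleC_fun_def scaleC_blinfun.rep_eq
        scaleC_add_right scaleC_scaleC mult.commute)
  ultimately show ?thesis by (simp add: symbol_space_def)
qed

lemma symbol_space_bound:
  fixes a :: "int ^ 'n::finite \<Rightarrow> 'e::complex_banach \<Rightarrow>\<^sub>L 'e"
  assumes a: "a \<in> carr (symbol_space m \<rho>)" and B: "nrm (symbol_space m \<rho>) a \<le> B" and N: "N \<le> \<rho>"
  shows "symbol_bound m N a B"
  unfolding symbol_bound_def
proof (intro allI impI)
  fix l :: 'n and i k assume i: "i \<le> N"
  have \<alpha>: "axis l i \<in> mi_upto \<rho>" using i N by (simp add: mi_upto_def mi_abs_axis)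
  have "symbol_weight m a (axis l i) k \<le> (SUP k. symbol_weight m a (axis l i) k)"
    using a \<alpha> by (intro cSUP_upper) (auto simp: symbol_space_def)
  also have "\<dots> \<le> nrm (symbol_space m \<rho>) a"
    unfolding symbol_space_def using \<alpha> by (simp add: Max_ge finite_mi_upto)
  finally have "jap (rvec k) powr (real i - m) * norm ((shift_diff (axis l 1) ^^ i) a k) \<le> B"
    using B by (simp add: symbol_weight_def mi_abs_axis mi_power_axis diff_op_eq_shift_diff)
  then have "jap (rvec k) powr (m - real i) * (jap (rvec k) powr (real i - m) * norm ((shift_diff (axis l 1) ^^ i) a k))
      \<le> jap (rvec k) powr (m - real i) * B"
    by (rule mult_left_mono) simp
  moreover have "jap (rvec k) powr (m - real i) * jap (rvec k) powr (real i - m) = 1"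
    using jap_pos[of "rvec k"] by (simp flip: powr_add)
  ultimately show "norm ((shift_diff (axis l 1) ^^ i) a k) \<le> B * jap (rvec k) powr (m - real i)"
    by (simp add: mult.assoc[symmetric] mult.commute)
qed

lemma poly_growth_symbol_bound:
  assumes "symbol_bound m N a B" "0 \<le> B"
  shows "poly_growth a"
proof (rule poly_growthI)
  fix k
  have "norm (a k) \<le> B * jap (rvec k) powr m"
    using assms(1)[unfolded symbol_bound_def, rule_format, of 0] by simp
  also have "\<dots> \<le> B * jap (rvec k) powr real (nat \<lceil>m\<rceil>)"
    using assms(2) jap_ge_1[of "rvec k"] by (intro mult_left_mono powr_mono) linarith+
  also have "\<dots> = B * jap (rvec k) ^ nat \<lceil>m\<rceil>"
    using jap_pos[of "rvec k"] by (simp add: powr_realpow)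
  finally show "norm (a k) \<le> B * jap (rvec k) ^ nat \<lceil>m\<rceil>" .
qed


section \<open>Mapping properties\<close>

text \<open>The estimate behind the theorem. As \<open>C\<close> does not depend on \<open>a\<close>, it yields the
  continuity in \<open>u\<close> as well as, for differences of symbols, the continuity in \<open>a\<close>.\<close>

lemma op_tor_besov_estimate:
  fixes \<phi> :: "nat \<Rightarrow> real ^ 'n::finite \<Rightarrow> complex" and m s :: real
  assumes d: "dyadic_decomposition \<phi>" and p: "1 \<le> p" and q: "1 \<le> q"
  obtains C where "0 < C"
    "\<And>(a :: int ^ 'n \<Rightarrow> 'e::complex_banach \<Rightarrow>\<^sub>L 'e) B u.
      symbol_bound m (CARD('n) + 1) a B \<Longrightarrow> 0 < B \<Longrightarrow> (\<And>k. clinear_on UNIV (blinfun_apply (a k))) \<Longrightarrow>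
      besov_enorm \<phi> s p q (op_tor a u) \<le> ennreal (C * B) * besov_enorm \<phi> (s + m) p q u"
proof -
  let ?n = "CARD('n)"
  define N where "N = ?n + 1"
  obtain K where K: "0 < K"
    "\<And>(a :: int ^ 'n \<Rightarrow> 'e \<Rightarrow>\<^sub>L 'e) B M j l k. symbol_bound m N a B \<Longrightarrow> 0 \<le> B \<Longrightarrow> M \<le> N \<Longrightarrow>
      norm ((shift_diff (axis l 1) ^^ M) (\<lambda>k. \<phi> j (rvec k) *\<^sub>C a k) k) \<le> K * B * 2 powr (real j * m) / (2 ^ j) ^ M"
    by (rule dyadic_symbol_estimate[OF d, where N = N and m = m]) blast
  define K2 where "K2 = 2 ^ N * 16 ^ ?n * real (5 + 2 * N) ^ ?n"
  \<comment> \<open>\<open>4\<^sup>5\<close> is the constant of the triangle inequality for the five terms of a window\<close>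
  define K3 where "K3 = 4 ^ 5 * (K2 * K * (6 * real ?n) ^ ?n)"
  have K2: "0 < K2" by (simp add: K2_def)
  have K3: "0 < K3" using K2 K(1) by (simp add: K3_def)
  have main: "besov_enorm \<phi> s p q (op_tor a u) \<le> ennreal ((5 * (K3 * 4 powr \<bar>s + m\<bar>)) * B) * besov_enorm \<phi> (s + m) p q u"
    if a: "symbol_bound m N a B" and B: "0 < B" and lin: "\<And>k. clinear_on UNIV (blinfun_apply (a k))"
    for a :: "int ^ 'n \<Rightarrow> 'e \<Rightarrow>\<^sub>L 'e" and B u
  proof -
    let ?P = "\<lambda>l. op_tor (scalar_symbol (\<phi> l)) u"
    have piece: "Lp_distr_enorm p (op_tor (scalar_symbol (\<phi> j)) (op_tor a u))
        \<le> ennreal (K3 * B * 2 powr (real j * m)) * (\<Sum>l\<in>{j-2..j+2}. Lp_distr_enorm p (?P l))" for j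
    proof -
      define b where "b = (\<lambda>k. \<phi> j (rvec k) *\<^sub>C a k)"
      define A where "A = K2 * (K * B * 2 powr (real j * m))"
      have A: "0 < A" using K2 K(1) B by (simp add: A_def)
      have b_supp: "finite {k. b k \<noteq> 0}"
        by (rule finite_subset[OF _ dyadic_finite_support[OF d, of j]]) (auto simp: b_def)
      have b_lin: "clinear_on UNIV (blinfun_apply (b k))" for k
        using lin[of k] by (simp add: b_def clinear_on_def scaleC_blinfun.rep_eq scaleC_add_right scaleC_scaleC mult.commute)
      have kernel: "norm (trig_poly b z) \<le> A * kernel_majorant (2 ^ j) z" if "\<And>l. \<bar>z $ l\<bar> \<le> 2 * pi" for z
      proof -
        have "b k = 0" if "2 * 2 ^ j < norm (rvec k)" for k
          using dyadic_support(1)[OF d, of j "rvec k"] that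
          by (cases "\<phi> j (rvec k) = 0") (auto simp: b_def)
        moreover have "norm (b k) \<le> K * B * 2 powr (real j * m)" for k
          using K(2)[OF a, of 0] B by (simp add: b_def)
        moreover have "norm ((shift_diff (axis l 1) ^^ N) b k) \<le> K * B * 2 powr (real j * m) / (2 ^ j) ^ N" for k l
          using K(2)[OF a, of N] B by (simp add: b_def)
        ultimately show ?thesis
          using norm_trig_poly_le_kernel_majorant[of j b "K * B * 2 powr (real j * m)" z] that
          unfolding A_def K2_def N_def mult.assoc by blast
      qed
      have coeff: "\<phi> j (rvec k) *\<^sub>C fourier_coeff (op_tor a u) k
          = (\<Sum>l\<in>{j-2..j+2}. blinfun_apply (b k) (fourier_coeff (?P l) k))" for k
      proof (cases "\<phi> j (rvec k) = 0")
        case True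
        then show ?thesis by (simp add: b_def)
      next
        case False
        have "(\<Sum>l\<in>{j-2..j+2}. blinfun_apply (b k) (fourier_coeff (?P l) k))
            = blinfun_apply (b k) ((\<Sum>l\<in>{j-2..j+2}. \<phi> l (rvec k)) *\<^sub>C fourier_coeff u k)"
          by (simp only: op_tor_scalar_symbol fourier_coeff_fourier_series scaleC_sum_left blinfun.sum_right)
        also have "\<dots> = blinfun_apply (b k) (fourier_coeff u k)"
          by (simp only: dyadic_window_sum[of \<phi> j, OF d False] scaleC_one)
        also have "\<dots> = \<phi> j (rvec k) *\<^sub>C fourier_coeff (op_tor a u) k"
          by (simp add: b_def scaleC_blinfun.rep_eq op_tor_eq_fourier_series fourier_coeff_fourier_series)
        finally show ?thesis by simp
      qed
      have eq: "op_tor (scalar_symbol (\<phi> j)) (op_tor a u)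
          = (\<Sum>l\<in>{j-2..j+2}. fourier_series (\<lambda>k. blinfun_apply (b k) (fourier_coeff (?P l) k)))"
        unfolding op_tor_scalar_symbol[of _ "op_tor a u"] coeff
        by (rule fourier_series_sum[THEN conjunct1])
          (auto intro!: poly_growth_finite_support[OF b_supp])
      have "Lp_distr_enorm p (op_tor (scalar_symbol (\<phi> j)) (op_tor a u)) \<le> 4 ^ card {j-2..j+2}
          * (\<Sum>l\<in>{j-2..j+2}. Lp_distr_enorm p (fourier_series (\<lambda>k. blinfun_apply (b k) (fourier_coeff (?P l) k))))"
        unfolding eq by (rule Lp_distr_enorm_sum_le[OF p]) simp
      also have "\<dots> \<le> 4 ^ 5 * (\<Sum>l\<in>{j-2..j+2}. ennreal (A * (6 * real ?n) ^ ?n) * Lp_distr_enorm p (?P l))"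
        by (intro mult_mono power_increasing sum_mono
            Lp_distr_enorm_multiplier_le[OF p _ A b_supp b_lin kernel]) (auto simp: sum_nonneg)
      also have "\<dots> = ennreal (4 ^ 5 * (A * (6 * real ?n) ^ ?n)) * (\<Sum>l\<in>{j-2..j+2}. Lp_distr_enorm p (?P l))"
        using A by (simp only: sum_distrib_left[symmetric] mult.assoc[symmetric] ennreal_mult ennreal_power[symmetric]
            ennreal_numeral zero_le_power zero_le_numeral less_imp_le mult_nonneg_nonneg of_nat_0_le_iff)
      also have "4 ^ 5 * (A * (6 * real ?n) ^ ?n) = K3 * B * 2 powr (real j * m)"
        by (simp add: A_def K3_def)
      finally show ?thesis .
    qed
    have "besov_enorm \<phi> s p q (op_tor a u) \<le> ennreal (5 * (K3 * 4 powr \<bar>s + m\<bar> * B)) * besov_enorm \<phi> (s + m) p q u"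
      unfolding besov_enorm_def
    proof (rule Lp_enorm_window_le[OF q])
      show "0 < K3 * 4 powr \<bar>s + m\<bar> * B" using K3 B by simp
      fix j
      let ?x = "\<lambda>l. ennreal (2 powr (real l * (s + m))) * Lp_distr_enorm p (?P l)"
      have "ennreal (2 powr (real j * s)) * Lp_distr_enorm p (op_tor (scalar_symbol (\<phi> j)) (op_tor a u))
          \<le> ennreal (2 powr (real j * s)) * (ennreal (K3 * B * 2 powr (real j * m)) * (\<Sum>l\<in>{j-2..j+2}. Lp_distr_enorm p (?P l)))"
        by (intro mult_left_mono piece) simp
      also have "\<dots> = (\<Sum>l\<in>{j-2..j+2}. ennreal (K3 * B * 2 powr (real j * (s + m))) * Lp_distr_enorm p (?P l))"
      proof -
        have "2 powr (real j * s) * (K3 * B * 2 powr (real j * m)) = K3 * B * 2 powr (real j * (s + m))"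
          by (simp add: distrib_left powr_add)
        then have "ennreal (2 powr (real j * s)) * ennreal (K3 * B * 2 powr (real j * m)) = ennreal (K3 * B * 2 powr (real j * (s + m)))"
          using K3 B by (simp flip: ennreal_mult)
        then show ?thesis by (simp only: mult.assoc[symmetric] sum_distrib_left)
      qed
      also have "\<dots> \<le> (\<Sum>l\<in>{j-2..j+2}. ennreal (K3 * 4 powr \<bar>s + m\<bar> * B) * ?x l)"
      proof (rule sum_mono)
        fix l assume l: "l \<in> {j-2..j+2}"
        \<comment> \<open>within a window the weights \<open>2\<^bsup>l(s+m)\<^esup>\<close> differ by a factor of at most \<open>4\<^bsup>\<bar>s+m\<bar>\<^esup>\<close>\<close>
        have "real j * (s + m) \<le> 2 * \<bar>s + m\<bar> + real l * (s + m)"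
        proof -
          have "(real j - real l) * (s + m) \<le> \<bar>real j - real l\<bar> * \<bar>s + m\<bar>"
            by (metis abs_ge_self abs_mult)
          also have "\<dots> \<le> 2 * \<bar>s + m\<bar>" using l by (intro mult_right_mono) auto
          finally show ?thesis by (simp add: algebra_simps)
        qed
        then have "2 powr (real j * (s + m)) \<le> 2 powr (2 * \<bar>s + m\<bar> + real l * (s + m))"
          by (rule powr_mono) simp
        also have "\<dots> = 4 powr \<bar>s + m\<bar> * 2 powr (real l * (s + m))"
        proof -
          have "2 powr (2 * \<bar>s + m\<bar>) = (2 powr 2) powr \<bar>s + m\<bar>" by (simp only: powr_powr)
          then show ?thesis by (simp add: powr_add)
        qed
        finally have "K3 * B * 2 powr (real j * (s + m)) \<le> K3 * B * (4 powr \<bar>s + m\<bar> * 2 powr (real l * (s + m)))"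
          using K3 B by (intro mult_left_mono) auto
        then have "ennreal (K3 * B * 2 powr (real j * (s + m)))
            \<le> ennreal (K3 * 4 powr \<bar>s + m\<bar> * B) * ennreal (2 powr (real l * (s + m)))"
          using K3 B by (subst ennreal_mult[symmetric]) (auto intro!: ennreal_leI simp: mult_ac)
        then show "ennreal (K3 * B * 2 powr (real j * (s + m))) * Lp_distr_enorm p (?P l)
            \<le> ennreal (K3 * 4 powr \<bar>s + m\<bar> * B) * ?x l"
          unfolding mult.assoc[symmetric] by (rule mult_right_mono) simp
      qed
      also have "\<dots> = ennreal (K3 * 4 powr \<bar>s + m\<bar> * B) * (\<Sum>l\<in>{j-2..j+2}. ?x l)"
        by (simp only: sum_distrib_left)
      finally show "ennreal (2 powr (real j * s)) * Lp_distr_enorm p (op_tor (scalar_symbol (\<phi> j)) (op_tor a u))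
          \<le> ennreal (K3 * 4 powr \<bar>s + m\<bar> * B) * (\<Sum>l\<in>{j-2..j+2}. ?x l)" .
    qed
    then show ?thesis by (simp only: mult.assoc)
  qed
  show ?thesis
    by (rule that[of "5 * (K3 * 4 powr \<bar>s + m\<bar>)"]) (use K3 main in \<open>auto simp: N_def\<close>)
qed

lemma continuous_clinear_restrict0:
  assumes "continuous_clinear X Y T"
    and add: "\<And>x y. x \<in> carr X \<Longrightarrow> y \<in> carr X \<Longrightarrow> x + y \<in> carr X"
    and scale: "\<And>c x. x \<in> carr X \<Longrightarrow> c *\<^sub>C x \<in> carr X"
  shows "continuous_clinear X Y (restrict0 (carr X) T)"
  using assms by (simp add: continuous_clinear_def clinear_on_def restrict0_def cong: conj_cong)

theorem theorem3p17:
  fixes \<phi> :: "nat \<Rightarrow> real ^ 'n::finite \<Rightarrow> complex"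
    and m s :: real and p q :: ennreal and \<rho> :: nat
  assumes "dyadic_decomposition \<phi>"
    and "1 \<le> p" and "1 \<le> q"
    and "CARD('n) + 1 \<le> \<rho>"
  defines "S \<equiv> symbol_space m \<rho> :: (int ^ 'n \<Rightarrow> 'e::complex_banach \<Rightarrow>\<^sub>L 'e) nspace"
    and "X \<equiv> besov \<phi> (s + m) p q"
    and "Y \<equiv> besov \<phi> s p q"
  shows "(\<forall>a\<in>carr S. continuous_clinear X Y (op_tor a)) \<and>
         continuous_clinear S (L_space X Y) (\<lambda>a. restrict0 (carr X) (op_tor a))"
proof -
  obtain C where C: "0 < C"
    "\<And>(a :: int ^ 'n \<Rightarrow> 'e \<Rightarrow>\<^sub>L 'e) B u.
      symbol_bound m (CARD('n) + 1) a B \<Longrightarrow> 0 < B \<Longrightarrow> (\<And>k. clinear_on UNIV (blinfun_apply (a k))) \<Longrightarrow>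
      besov_enorm \<phi> s p q (op_tor a u) \<le> ennreal (C * B) * besov_enorm \<phi> (s + m) p q u"
    by (rule op_tor_besov_estimate[OF assms(1-3), where m = m and s = s and ?'e = 'e]) blast
  have S_lin: "clinear_on UNIV (blinfun_apply (a k))" if "a \<in> carr S" for a k
    using that by (simp add: S_def symbol_space_def)
  have S_bound: "symbol_bound m (CARD('n) + 1) a B" if "a \<in> carr S" "nrm S a \<le> B" for a B
    using that assms(4) unfolding S_def by (intro symbol_space_bound)
  have S_nonneg: "0 \<le> nrm S a" if "a \<in> carr S" for a
  proof -
    have "norm (a 0) \<le> nrm S a * jap (rvec (0 :: int ^ 'n)) powr m"
      using S_bound[OF that order_refl, unfolded symbol_bound_def, rule_format, of 0 _ 0] by simp
    then show ?thesis by (simp add: jap_def) (metis norm_ge_zero order_trans)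
  qed
  have S_growth: "poly_growth a" if "a \<in> carr S" for a
    using poly_growth_symbol_bound[OF S_bound[OF that order_refl] S_nonneg[OF that]] .
  have S_diff: "a - b \<in> carr S" if "a \<in> carr S" "b \<in> carr S" for a b
    using that unfolding S_def diff_eq_add_scaleC by (intro symbol_space_add symbol_space_scaleC)
  have X_distr: "u \<in> distributions" if "u \<in> carr X" for u
    using that by (simp add: X_def besov_def)
  have X_add: "u + v \<in> carr X" if "u \<in> carr X" "v \<in> carr X" for u v
    using that unfolding X_def by (intro besov_add assms(1-3))
  have X_scaleC: "c *\<^sub>C u \<in> carr X" if "u \<in> carr X" for c u
    using that unfolding X_def by (intro besov_scaleC assms(1-3))
  have X_diff: "u - v \<in> carr X" if "u \<in> carr X" "v \<in> carr X" for u v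
    using that unfolding diff_eq_add_scaleC by (intro X_add X_scaleC)
  have X_nonneg: "0 \<le> nrm X u" for u by (simp add: X_def besov_def)
  have estimate: "op_tor a u \<in> carr Y \<and> nrm Y (op_tor a u) \<le> C * B * nrm X u"
    if a: "a \<in> carr S" "nrm S a \<le> B" and B: "0 < B" and u: "u \<in> carr X" for a B u
  proof -
    have fin: "besov_enorm \<phi> (s + m) p q u < \<infinity>" using u by (simp add: X_def besov_def)
    have le: "besov_enorm \<phi> s p q (op_tor a u) \<le> ennreal (C * B) * besov_enorm \<phi> (s + m) p q u"
      by (intro C S_bound S_lin a B)
    also have "\<dots> < \<infinity>" using fin by (simp add: ennreal_mult_less_top)
    finally have "op_tor a u \<in> carr Y"
      using op_tor_distribution[OF S_growth[OF a(1)] X_distr[OF u]] by (simp add: Y_def besov_def)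
    moreover have "enn2real (besov_enorm \<phi> s p q (op_tor a u)) \<le> enn2real (ennreal (C * B) * besov_enorm \<phi> (s + m) p q u)"
      using le fin by (intro enn2real_mono) (simp_all add: ennreal_mult_less_top)
    ultimately show ?thesis
      using C(1) B by (simp add: X_def Y_def besov_def enn2real_mult)
  qed
  have lin_right: "clinear_on (carr X) (op_tor a)" if a: "a \<in> carr S" for a
    unfolding clinear_on_def
    by (intro conjI ballI allI op_tor_add_right op_tor_scaleC_right S_growth S_lin a X_distr)
  have op_diff_right: "op_tor a u - op_tor a v = op_tor a (u - v)"
    if "a \<in> carr S" "u \<in> carr X" "v \<in> carr X" for a u v
    unfolding diff_eq_add_scaleC
    using clinear_onD_add[OF lin_right[OF that(1)] that(2) X_scaleC[OF that(3)]]
      clinear_onD_scaleC[OF lin_right[OF that(1)] that(3)] by (simp only:)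
  have op_diff_left: "op_tor a u - op_tor b u = op_tor (a - b) u"
    if "a \<in> carr S" "b \<in> carr S" "u \<in> carr X" for a b u
  proof -
    have "(-1) *\<^sub>C b \<in> carr S" using that(2) unfolding S_def by (rule symbol_space_scaleC)
    then have "op_tor (a + (-1) *\<^sub>C b) u = op_tor a u + op_tor ((-1) *\<^sub>C b) u"
      by (intro op_tor_add_left S_growth that X_distr)
    also have "op_tor ((-1) *\<^sub>C b) u = (-1) *\<^sub>C op_tor b u"
      by (intro op_tor_scaleC_left S_growth that X_distr)
    finally show ?thesis unfolding diff_eq_add_scaleC by (simp only:)
  qed
  have cont: "continuous_clinear X Y (op_tor a)" if a: "a \<in> carr S" for a
    unfolding continuous_clinear_def
  proof (intro conjI ballI allI impI)
    \<comment> \<open>the summand \<open>1\<close> makes the bound positive\<close>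
    define B where "B = nrm S a + 1"
    have B: "0 < B" "nrm S a \<le> B" using S_nonneg[OF a] by (simp_all add: B_def)
    show "op_tor a u \<in> carr Y" if "u \<in> carr X" for u
      using estimate[OF a B(2,1) that] by simp
    show "clinear_on (carr X) (op_tor a)" by (rule lin_right[OF a])
    fix u and \<epsilon> :: real assume u: "u \<in> carr X" and \<epsilon>: "0 < \<epsilon>"
    have "nrm Y (op_tor a v - op_tor a u) < \<epsilon>" if v: "v \<in> carr X" and "nrm X (v - u) < \<epsilon> / (C * B)" for v
    proof -
      have "nrm Y (op_tor a v - op_tor a u) \<le> C * B * nrm X (v - u)"
        unfolding op_diff_right[OF a v u] using estimate[OF a B(2,1) X_diff[OF v u]] by simp
      also have "\<dots> < \<epsilon>" using that(2) C(1) B(1) by (simp add: field_simps)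
      finally show ?thesis .
    qed
    then show "\<exists>\<delta>>0. \<forall>v\<in>carr X. nrm X (v - u) < \<delta> \<longrightarrow> nrm Y (op_tor a v - op_tor a u) < \<epsilon>"
      using C(1) B(1) \<epsilon> by (intro exI[of _ "\<epsilon> / (C * B)"]) auto
  qed
  moreover have "continuous_clinear S (L_space X Y) (\<lambda>a. restrict0 (carr X) (op_tor a))"
    unfolding continuous_clinear_def[of S]
  proof (intro conjI ballI allI impI)
    show "restrict0 (carr X) (op_tor a) \<in> carr (L_space X Y)" if "a \<in> carr S" for a
      using continuous_clinear_restrict0[OF cont[OF that] X_add X_scaleC]
      by (simp add: L_space_def) (simp add: restrict0_def fun_eq_iff)
    show "clinear_on (carr S) (\<lambda>a. restrict0 (carr X) (op_tor a))"
      unfolding clinear_on_def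
    proof (intro conjI ballI allI)
      show "restrict0 (carr X) (op_tor (a + b)) = restrict0 (carr X) (op_tor a) + restrict0 (carr X) (op_tor b)"
        if "a \<in> carr S" "b \<in> carr S" for a b
        using that by (auto simp: fun_eq_iff restrict0_def op_tor_add_left S_growth X_distr)
      show "restrict0 (carr X) (op_tor (c *\<^sub>C a)) = c *\<^sub>C restrict0 (carr X) (op_tor a)"
        if "a \<in> carr S" for c a
        using that by (auto simp: fun_eq_iff restrict0_def scaleC_fun_def[of c "\<lambda>x. if x \<in> carr X then op_tor a x else 0"]
            op_tor_scaleC_left S_growth X_distr)
    qed
    fix a and \<epsilon> :: real assume a: "a \<in> carr S" and \<epsilon>: "0 < \<epsilon>"
    define \<delta> where "\<delta> = \<epsilon> / (2 * C)"
    have \<delta>: "0 < \<delta>" "C * \<delta> < \<epsilon>" using \<epsilon> C(1) by (simp_all add: \<delta>_def)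
    have "nrm (L_space X Y) (restrict0 (carr X) (op_tor b) - restrict0 (carr X) (op_tor a)) < \<epsilon>"
      if b: "b \<in> carr S" and ba: "nrm S (b - a) < \<delta>" for b
    proof -
      \<comment> \<open>a supremum of real numbers can be bounded only over a nonempty set\<close>
      have "0 \<in> {u \<in> carr X. nrm X u \<le> 1}"
        using assms(2,3) by (simp add: X_def besov_def zero_distribution besov_enorm_zero)
      moreover have "nrm Y ((restrict0 (carr X) (op_tor b) - restrict0 (carr X) (op_tor a)) u) \<le> C * \<delta>"
        if u: "u \<in> {u \<in> carr X. nrm X u \<le> 1}" for u
      proof -
        have "nrm Y ((restrict0 (carr X) (op_tor b) - restrict0 (carr X) (op_tor a)) u) = nrm Y (op_tor (b - a) u)"
          using u op_diff_left[OF b a, of u] by (simp add: restrict0_def)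
        also have "\<dots> \<le> C * \<delta> * nrm X u"
          using estimate[OF S_diff[OF b a] _ \<delta>(1), of u] ba u by simp
        also have "\<dots> \<le> C * \<delta> * 1" using u C(1) \<delta>(1) by (intro mult_left_mono) auto
        finally show ?thesis by simp
      qed
      ultimately have "nrm (L_space X Y) (restrict0 (carr X) (op_tor b) - restrict0 (carr X) (op_tor a)) \<le> C * \<delta>"
        unfolding L_space_def nspace.simps by (intro cSUP_least) blast+
      then show ?thesis using \<delta>(2) by simp
    qed
    then show "\<exists>\<delta>>0. \<forall>b\<in>carr S. nrm S (b - a) < \<delta> \<longrightarrow>
        nrm (L_space X Y) (restrict0 (carr X) (op_tor b) - restrict0 (carr X) (op_tor a)) < \<epsilon>"
      using \<delta>(1) by blast
  qed
  ultimately show ?thesis by blast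
qed

end
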